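(* For $\epsilon>0$, $\mathbf{p}=(0,p)$ and a unit vector $\mathbf{a}=(a_1,a_2)\in\mathbb{R}^2$, let $D_1,D_2$ be the two disks and let $u$, with boundary values $c_1,c_2$, be the solution of the dipole-emitter problem, all described in the context. Then $u$ admits a decomposition $$u=Q+r\quad\text{in }\mathbb{R}^2\setminus\overline{D_1\cup D_2},$$ where $Q$ and $r$ satisfy $$\begin{cases}\Delta Q=0 & \text{in }\mathbb{R}^2\setminus\overline{D_1\cup D_2},\\ Q=u\ (=c_j) & \text{on }\partial D_j,\ j=1,2,\\ \int_{\mathbb{R}^2\setminus\overline{D_1\cup D_2}}|\nabla Q|^2\,d\mathbf{x}<\infty,\end{cases}$$ and $$\begin{cases}\Delta r=\mathbf{a}\cdot\nabla\delta_{\mathbf{p}} & \text{in }\mathbb{R}^2\setminus\overline{D_1\cup D_2},\\ r=0 & \text{on }\partial D_j,\ j=1,2,\\ \int_{\mathbb{R}^2\setminus\overline{D_1\cup D_2}}|\nabla(r-\mathbf{a}\cdot\nabla\mathcal{N}_{\mathbf{p}})|^2\,d\mathbf{x}<\infty.\end{cases}$$ Moreover, there exists a positive constant $A$ such that the following inequalities hold for all sufficiently small $\epsilon>0$, all $\mathbf{p}=(0,p)$ with $|\mathbf{p}|<1/2$, all $\mathbf{x}=(x_1,x_2)\in B_{1/2}\setminus\overline{D_1\cup D_2}$ (with $\mathbf{x}\neq\mathbf{p}$ in the second one), and all unit vectors $\mathbf{a}=(a_1,a_2)$: $$|\nabla Q(\mathbf{x})|\simeq|a_1|\,\frac{\sqrt{\epsilon}}{(\epsilon+p^2)(\epsilon+x_2^2)}$$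 and $$|\nabla r(\mathbf{x})|\lesssim\frac{1}{|\mathbf{x}-\mathbf{p}|^2}\exp\left(-A\,\frac{|\mathbf{x}-\mathbf{p}|}{\sqrt{\epsilon}\,|\mathbf{x}-\mathbf{p}|+|p\,\mathbf{x}+(0,\epsilon)|}\right).$$ The constants implicit in $\simeq$ and $\lesssim$ can be chosen independently of $\mathbf{p}$ and $\mathbf{a}$ as well as $\epsilon$ (and $\mathbf{x}$).
   Context: Notation: $B_r(\mathbf{c})$ is the open disk in $\mathbb{R}^2$ of radius $r$ centered at $\mathbf{c}$, and $B_r=B_r(\mathbf{0})$. For $\epsilon>0$, $$D_j=B_1\big((-1)^j(1+\epsilon/2),0\big),\quad j=1,2,$$ so $\mathrm{dist}(D_1,D_2)=\epsilon$. The emitter location is $\mathbf{p}=(0,p)$ on the $x_2$-axis. $\delta_{\mathbf{p}}$ is the Dirac mass at $\mathbf{p}$. The fundamental solution is $\mathcal{N}_{\mathbf{p}}(\mathbf{x})=\frac{1}{2\pi}\log|\mathbf{x}-\mathbf{p}|$, so $$\mathbf{a}\cdot\nabla\mathcal{N}_{\mathbf{p}}(\mathbf{x})=\frac{1}{2\pi}\frac{\mathbf{a}\cdot(\mathbf{x}-\mathbf{p})}{|\mathbf{x}-\mathbf{p}|^2}.$$ The dipole-emitter problem is: find $u$ such that $$\begin{cases}\Delta u=\mathbf{a}\cdot\nabla\delta_{\mathbf{p}} & \text{in }\mathbb{R}^2\setminus\overline{D_1\cup D_2}\ \text{(in the sense of distributions)},\\ u=c_j & \text{on }\partial D_j,\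 j=1,2,\\ \int_{\partial D_j}\partial_\nu u\,ds=0, & j=1,2,\\ u(\mathbf{x})=O(|\mathbf{x}|^{-1}) & \text{as }|\mathbf{x}|\to\infty,\end{cases}$$ where the constants $c_1,c_2$ are not prescribed but are part of the unknowns (determined by the problem), and $\nu$ is the unit normal on $\partial D_1\cup\partial D_2$ pointing inward to $D_1\cup D_2$. This problem has a unique solution $u$. $\alpha\lesssim\beta$ means $\alpha\le C\beta$ for a positive constant $C$ independent of (sufficiently small) $\epsilon$; $\alpha\simeq\beta$ means $\alpha\lesssim\beta$ and $\beta\lesssim\alpha$. *)

theory Defs
  imports "HOL-Analysis.Analysis" "HOL-Library.Landau_Symbols"
begin

section \<open>Differential operators\<close>

text \<open>Only meaningful where \<open>f\<close> is differentiable.\<close>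

definition grad :: "('a::real_inner \<Rightarrow> real) \<Rightarrow> 'a \<Rightarrow> 'a" where
  "grad f x = (THE D. GDERIV f x :> D)"

definition laplacian :: "('a::euclidean_space \<Rightarrow> real) \<Rightarrow> 'a \<Rightarrow> real" where
  "laplacian f x = (\<Sum>b\<in>Basis. b \<bullet> grad (\<lambda>y. b \<bullet> grad f y) x)"

text \<open>The class \<open>C\<^sup>k\<close> on \<open>S\<close>, for an open set \<open>S\<close>.\<close>

primrec Ck_on :: "nat \<Rightarrow> ('a::euclidean_space \<Rightarrow> real) \<Rightarrow> 'a set \<Rightarrow> bool" where
  "Ck_on 0 f S \<longleftrightarrow> continuous_on S f"
| "Ck_on (Suc k) f S \<longleftrightarrow>
     (\<forall>x\<in>S. f differentiable (at x)) \<and> (\<forall>b\<in>Basis. Ck_on k (\<lambda>x. b \<bullet> grad f x) S)"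

definition harmonic_in :: "('a::euclidean_space \<Rightarrow> real) \<Rightarrow> 'a set \<Rightarrow> bool" where
  "harmonic_in f S \<longleftrightarrow> Ck_on 2 f S \<and> (\<forall>x\<in>S. laplacian f x = 0)"

section \<open>Distributions\<close>

definition test_functions :: "'a::euclidean_space set \<Rightarrow> ('a \<Rightarrow> real) set" where
  "test_functions S =
     {\<phi>. (\<forall>k. Ck_on k \<phi> UNIV) \<and> compact (closure {x. \<phi> x \<noteq> 0}) \<and> closure {x. \<phi> x \<noteq> 0} \<subseteq> S}"

definition locally_integrable :: "('a::euclidean_space \<Rightarrow> real) \<Rightarrow> 'a set \<Rightarrow> bool" where
  "locally_integrable f S \<longleftrightarrow> (\<forall>K. compact K \<and> K \<subseteq> S \<longrightarrow> set_integrable lborel K f)"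

definition dirac :: "'a \<Rightarrow> ('a \<Rightarrow> real) \<Rightarrow> real" where
  "dirac p \<phi> = \<phi> p"

text \<open>The derivative \<open>a \<cdot> \<nabla>T\<close> of a distribution \<open>T\<close>, by duality.\<close>

definition distr_deriv ::
  "'a::euclidean_space \<Rightarrow> (('a \<Rightarrow> real) \<Rightarrow> real) \<Rightarrow> ('a \<Rightarrow> real) \<Rightarrow> real" where
  "distr_deriv a T \<phi> = - T (\<lambda>x. a \<bullet> grad \<phi> x)"

text \<open>\<open>\<Delta>u = T\<close> in \<open>S\<close> in the sense of distributions.\<close>

definition distr_laplace_eq ::
  "'a::euclidean_space set \<Rightarrow> ('a \<Rightarrow> real) \<Rightarrow> (('a \<Rightarrow> real) \<Rightarrow> real) \<Rightarrow> bool" where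
  "distr_laplace_eq S u T \<longleftrightarrow> locally_integrable u S \<and>
     (\<forall>\<phi>\<in>test_functions S. (LINT x:S|lborel. u x * laplacian \<phi> x) = T \<phi>)"

section \<open>The two disks and the dipole-emitter problem\<close>

type_synonym R2 = "real \<times> real"

definition center :: "real \<Rightarrow> nat \<Rightarrow> R2" where
  "center \<epsilon> j = ((-1) ^ j * (1 + \<epsilon> / 2), 0)"

definition D :: "real \<Rightarrow> nat \<Rightarrow> R2 set" where
  "D \<epsilon> j = ball (center \<epsilon> j) 1"

definition exterior_dom :: "real \<Rightarrow> R2 set" where
  "exterior_dom \<epsilon> = UNIV - closure (D \<epsilon> 1 \<union> D \<epsilon> 2)"

definition fund_sol :: "R2 \<Rightarrow> R2 \<Rightarrow> real" where
  "fund_sol P x = ln (norm (x - P)) / (2 * pi)"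

text \<open>\<open>\<partial>\<^sub>\<nu>u = d\<close> at the boundary point \<open>y\<close> of the unit disk centered at \<open>c\<close>, where \<open>\<nu> = c - y\<close>
  points into the disk: a one-sided derivative, involving only values of \<open>u\<close> outside the
  open disk.\<close>

definition has_normal_deriv :: "(R2 \<Rightarrow> real) \<Rightarrow> R2 \<Rightarrow> R2 \<Rightarrow> real \<Rightarrow> bool" where
  "has_normal_deriv u c y d \<longleftrightarrow>
     ((\<lambda>t. u (y + t *\<^sub>R (c - y))) has_real_derivative d) (at 0 within {..0})"

text \<open>\<open>\<integral> \<partial>\<^sub>\<nu>u ds = 0\<close> over the unit circle centered at \<open>c\<close>, parametrized by arc length.\<close>

definition zero_flux :: "(R2 \<Rightarrow> real) \<Rightarrow> R2 \<Rightarrow> bool" where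
  "zero_flux u c \<longleftrightarrow>
     (\<exists>g. (\<forall>\<theta>\<in>{0..2*pi}. has_normal_deriv u c (c + (cos \<theta>, sin \<theta>)) (g \<theta>)) \<and>
          (g has_integral 0) {0..2*pi})"

text \<open>The value of \<open>u\<close> at the singular point \<open>P\<close> and its values inside the disks are irrelevant.
  Continuity on the closed exterior domain away from \<open>P\<close> selects the continuous representative
  of the distributional solution and gives a meaning to its boundary values.\<close>

definition dipole_solution ::
  "real \<Rightarrow> R2 \<Rightarrow> R2 \<Rightarrow> (nat \<Rightarrow> real) \<Rightarrow> (R2 \<Rightarrow> real) \<Rightarrow> bool" where
  "dipole_solution \<epsilon> P a c u \<longleftrightarrow>
     continuous_on (closure (exterior_dom \<epsilon>) - {P}) u \<and>
     distr_laplace_eq (exterior_dom \<epsilon>) u (distr_deriv a (dirac P)) \<and>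
     (\<forall>j\<in>{1,2}. \<forall>x\<in>frontier (D \<epsilon> j). u x = c j) \<and>
     (\<forall>j\<in>{1,2}. zero_flux u (center \<epsilon> j)) \<and>
     u \<in> O[at_infinity](\<lambda>x. 1 / norm x)"

definition is_Q_part :: "real \<Rightarrow> (nat \<Rightarrow> real) \<Rightarrow> (R2 \<Rightarrow> real) \<Rightarrow> bool" where
  "is_Q_part \<epsilon> c Q \<longleftrightarrow>
     continuous_on (closure (exterior_dom \<epsilon>)) Q \<and>
     harmonic_in Q (exterior_dom \<epsilon>) \<and>
     (\<forall>j\<in>{1,2}. \<forall>x\<in>frontier (D \<epsilon> j). Q x = c j) \<and>
     set_integrable lborel (exterior_dom \<epsilon>) (\<lambda>x. (norm (grad Q x))\<^sup>2)"

text \<open>Differentiability away from \<open>P\<close> is stated so that \<open>\<nabla>r\<close> is the actual gradient there.\<close>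

definition is_r_part :: "real \<Rightarrow> R2 \<Rightarrow> R2 \<Rightarrow> (R2 \<Rightarrow> real) \<Rightarrow> bool" where
  "is_r_part \<epsilon> P a r \<longleftrightarrow>
     continuous_on (closure (exterior_dom \<epsilon>) - {P}) r \<and>
     (\<forall>x\<in>exterior_dom \<epsilon> - {P}. r differentiable (at x)) \<and>
     distr_laplace_eq (exterior_dom \<epsilon>) r (distr_deriv a (dirac P)) \<and>
     (\<forall>j\<in>{1,2}. \<forall>x\<in>frontier (D \<epsilon> j). r x = 0) \<and>
     set_integrable lborel (exterior_dom \<epsilon>)
       (\<lambda>x. (norm (grad (\<lambda>y. r y - a \<bullet> grad (fund_sol P) y) x))\<^sup>2)"

end

theory Submission
  imports Defs "HOL-Complex_Analysis.Complex_Analysis" "HOL-Real_Asymp.Real_Asymp"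
begin

text \<open>A Moebius map \<open>M\<close> takes the exterior of the two disks to an annulus, and \<open>t = Ln (M z)\<close> takes it
  to the strip \<open>|Re t| < s0\<close>, modulo \<open>2\<pi>i\<close>, with the emitter at \<open>t = 0\<close>. In the strip a dipole with
  zero boundary values is the real part of a combination \<open>F\<close> of the cotangent and the tangent of
  \<open>\<pi> t / (4 s0)\<close>; its sum over the periods gives \<open>r\<close>, and \<open>Q\<close> is a multiple of \<open>log |M|\<close> plus a
  constant. The multiple is forced by the flux conditions: \<open>F\<close> has different limits at the two ends
  of the strip, so the harmonic conjugate of \<open>r\<close> has a period around the disks, which that of \<open>Q\<close> must
  cancel. As \<open>F'\<close> decays like \<open>exp (- \<pi> |Im t| / (2 s0))\<close>, the image nearest to the emitter dominates
  and yields the bound for \<open>r\<close>.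

  That every solution \<open>u\<close> is \<open>Q + r\<close> follows from the maximum principle and Hopf's lemma, for which
  the mean value property of harmonic distributions suffices: the difference of two radial mollifiers
  of different scale is the Laplacian of a test function.\<close>

section \<open>Calculus of \<open>C\<^sup>k\<close> functions\<close>

text \<open>The exponent in the bound for r is, up to a constant, a lower bound for |t| / s0.
  Writing \<alpha> for \<open>al\<close>, \<open>M z - 1\<close> equals 2\<alpha>(z - zP) / ((z +
  \<alpha>)(zP + \<alpha>)) up to a factor of modulus 1. For small \<epsilon> both s0 and \<alpha>
  are comparable to sqrt \<epsilon>, and |z + \<alpha>| |zP + \<alpha>| is at most a constant times
  the denominator in the exponent. The factor |a1| in the bound for Q arises because the emitter
  lies on the axis of symmetry: there the logarithmic derivative of \<open>M\<close> is real, so the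
  strength of the dipole in the strip is a real multiple of \<open>a\<close>, and only its real part
  enters the period. The obstacle in the uniqueness part is that a solution is merely continuous,
  with a Laplacian known only against test functions, and is uncontrolled at the emitter. The
  arguments there work with averages and differentiate the solution only in the flux condition. The
  averaging kernels live on annuli, which keeps the auxiliary functions regular at the centre and
  still lets a maximum spread.\<close>

lemma grad_eq:
  assumes "GDERIV f x :> V"
  shows "grad f x = V"
  unfolding grad_def
proof (rule the_equality)
  show "GDERIV f x :> V" by (rule assms)
next
  fix V' assume "GDERIV f x :> V'"
  with assms have "(\<lambda>h. h \<bullet> V') = (\<lambda>h. h \<bullet> V)"
    unfolding gderiv_def using has_derivative_unique by blast
  then have "h \<bullet> V' = h \<bullet> V" for h by meson
  then have "(V' - V) \<bullet> (V' - V) = 0" by (simp add: inner_diff_right)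
  then show "V' = V" by simp
qed

lemma GDERIV_grad:
  fixes f :: "'a::euclidean_space \<Rightarrow> real"
  assumes "f differentiable (at x)"
  shows "GDERIV f x :> grad f x"
proof -
  obtain f' where f': "(f has_derivative f') (at x)"
    using assms unfolding differentiable_def by blast
  interpret bounded_linear f' using f' by (rule has_derivative_bounded_linear)
  have "f' = (\<lambda>h. h \<bullet> (\<Sum>b\<in>Basis. f' b *\<^sub>R b))"
  proof
    fix h
    have "f' h = f' (\<Sum>b\<in>Basis. (h \<bullet> b) *\<^sub>R b)" by (simp add: euclidean_representation)
    also have "\<dots> = (\<Sum>b\<in>Basis. (h \<bullet> b) * f' b)" by (simp add: sum scaleR)
    finally show "f' h = h \<bullet> (\<Sum>b\<in>Basis. f' b *\<^sub>R b)"
      by (simp add: inner_sum_right mult.commute)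
  qed
  then have "GDERIV f x :> (\<Sum>b\<in>Basis. f' b *\<^sub>R b)"
    unfolding gderiv_def using f' by simp
  from grad_eq[OF this] this show ?thesis by simp
qed

lemma GDERIV_differentiable: "GDERIV f x :> V \<Longrightarrow> f differentiable (at x)"
  unfolding gderiv_def differentiable_def by blast

lemma GDERIV_transform_open:
  assumes "GDERIV f x :> V" "open S" "x \<in> S" "\<And>y. y \<in> S \<Longrightarrow> f y = g y"
  shows "GDERIV g x :> V"
  using assms unfolding gderiv_def by (meson has_derivative_transform_within_open)

lemma differentiable_cong_open:
  assumes "open S" "x \<in> S" "\<And>y. y \<in> S \<Longrightarrow> f y = g y" "f differentiable (at x)"
  shows "g differentiable (at x)"
  using assms unfolding differentiable_def by (meson has_derivative_transform_within_open)

lemma grad_cong_open: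
  assumes "open S" "x \<in> S" "\<And>y. y \<in> S \<Longrightarrow> f y = g y"
  shows "grad f x = grad g x"
proof -
  have "(\<lambda>V. GDERIV f x :> V) = (\<lambda>V. GDERIV g x :> V)"
    using assms GDERIV_transform_open[of f x _ S g] GDERIV_transform_open[of g x _ S f]
    by (intro ext iffI) auto
  then show ?thesis unfolding grad_def by simp
qed

lemma Ck_on_cong:
  assumes "open S" "\<And>x. x \<in> S \<Longrightarrow> f x = g x" "Ck_on k f S"
  shows "Ck_on k g S"
  using assms(2,3)
proof (induction k arbitrary: f g)
  case 0
  then show ?case by (metis Ck_on.simps(1) continuous_on_cong)
next
  case (Suc k)
  have "Ck_on k (\<lambda>x. b \<bullet> grad g x) S" if "b \<in> Basis" for b
  proof (rule Suc.IH)
    show "b \<bullet> grad f x = b \<bullet> grad g x" if "x \<in> S" for x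
      using grad_cong_open[OF assms(1) that Suc.prems(1)] by simp
    show "Ck_on k (\<lambda>x. b \<bullet> grad f x) S" using Suc.prems(2) that by simp
  qed
  moreover have "g differentiable (at x)" if "x \<in> S" for x
    using differentiable_cong_open[OF assms(1) that] Suc.prems that by (meson Ck_on.simps(2))
  ultimately show ?case by simp
qed

lemma Ck_on_Suc_D: "Ck_on (Suc k) f S \<Longrightarrow> Ck_on k f S"
proof (induction k arbitrary: f)
  case 0
  then show ?case
    by (auto intro!: continuous_at_imp_continuous_on differentiable_imp_continuous_within)
next
  case (Suc k)
  then show ?case by (metis Ck_on.simps(2))
qed

lemma Ck_on_subset: "Ck_on k f S \<Longrightarrow> T \<subseteq> S \<Longrightarrow> Ck_on k f T"
proof (induction k arbitrary: f)
  case 0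
  then show ?case by (auto intro: continuous_on_subset)
qed auto

text \<open>Smoothness is local, so functions given by different formulas on different open sets,
  such as extensions by zero, are treated one piece of a cover at a time.\<close>

lemma Ck_on_local:
  assumes "\<And>x. x \<in> S \<Longrightarrow> \<exists>T. open T \<and> x \<in> T \<and> Ck_on k f T"
  shows "Ck_on k f S"
  using assms
proof (induction k arbitrary: f)
  case 0
  have "continuous (at x) f" if "x \<in> S" for x
    using 0[OF that] by (auto simp: continuous_on_eq_continuous_at)
  then show ?case by (simp add: continuous_at_imp_continuous_on)
next
  case (Suc k)
  have "Ck_on k (\<lambda>x. b \<bullet> grad f x) S" if "b \<in> Basis" for b
    by (rule Suc.IH) (use Suc.prems that in \<open>metis Ck_on.simps(2)\<close>)
  moreover have "f differentiable (at x)" if "x \<in> S" for x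
    using Suc.prems[OF that] by auto
  ultimately show ?case by simp
qed

lemma Ck_on_imp_continuous_on: "Ck_on k f S \<Longrightarrow> continuous_on S f"
  by (induction k) (auto dest: Ck_on_Suc_D simp del: Ck_on.simps(2))

lemma Ck_on_const [simp]: "Ck_on k (\<lambda>x::'a::euclidean_space. c) S"
proof (induction k arbitrary: c)
  case (Suc k)
  have "grad (\<lambda>x::'a. c) = (\<lambda>x. 0)"
    by (rule ext, rule grad_eq, rule GDERIV_const)
  then have "(\<lambda>x. b \<bullet> grad (\<lambda>x::'a. c) x) = (\<lambda>x. 0)" for b :: 'a by simp
  then show ?case using Suc by (simp only: Ck_on.simps) simp
qed simp

lemma GDERIV_inner_left: "GDERIV (\<lambda>x. x \<bullet> c) x :> c"
  unfolding gderiv_def by (auto intro!: derivative_eq_intros)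

lemma Ck_on_inner [simp]: "Ck_on k (\<lambda>x. x \<bullet> c) S"
proof (cases k)
  case 0
  then show ?thesis by (auto intro: continuous_intros)
next
  case (Suc j)
  have "grad (\<lambda>x. x \<bullet> c) = (\<lambda>x. c)"
    by (rule ext, rule grad_eq, rule GDERIV_inner_left)
  then show ?thesis using Suc GDERIV_differentiable[OF GDERIV_inner_left] by simp
qed

lemma Ck_on_add:
  assumes "open S" "Ck_on k f S" "Ck_on k g S"
  shows "Ck_on k (\<lambda>x. f x + g x) S"
  using assms(2,3)
proof (induction k arbitrary: f g)
  case 0
  then show ?case by (auto intro: continuous_intros)
next
  case (Suc k)
  have gr: "GDERIV (\<lambda>x. f x + g x) x :> grad f x + grad g x" if "x \<in> S" for x
    using Suc.prems that by (auto intro!: GDERIV_add GDERIV_grad)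
  have "Ck_on k (\<lambda>x. b \<bullet> grad (\<lambda>x. f x + g x) x) S" if "b \<in> Basis" for b
    by (rule Ck_on_cong[OF assms(1) _ Suc.IH[of "\<lambda>x. b \<bullet> grad f x" "\<lambda>x. b \<bullet> grad g x"]])
      (use Suc.prems that in \<open>auto simp: grad_eq[OF gr] inner_add_right\<close>)
  then show ?case using GDERIV_differentiable[OF gr] by auto
qed

lemma Ck_on_mult:
  assumes "open S" "Ck_on k f S" "Ck_on k g S"
  shows "Ck_on k (\<lambda>x. f x * g x) S"
  using assms(2,3)
proof (induction k arbitrary: f g)
  case 0
  then show ?case by (auto intro: continuous_intros)
next
  case (Suc k)
  have gr: "GDERIV (\<lambda>x. f x * g x) x :> f x *\<^sub>R grad g x + g x *\<^sub>R grad f x" if "x \<in> S" for x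
    using Suc.prems that by (auto intro!: GDERIV_mult GDERIV_grad)
  have "Ck_on k (\<lambda>x. b \<bullet> grad (\<lambda>x. f x * g x) x) S" if "b \<in> Basis" for b
  proof (rule Ck_on_cong[OF assms(1)])
    show "Ck_on k (\<lambda>x. f x * (b \<bullet> grad g x) + g x * (b \<bullet> grad f x)) S"
      using Suc.prems that Ck_on_Suc_D by (intro Ck_on_add[OF assms(1)] Suc.IH) auto
  qed (simp add: grad_eq[OF gr] inner_add_right)
  then show ?case using GDERIV_differentiable[OF gr] by auto
qed

lemma Ck_on_cmult: "open S \<Longrightarrow> Ck_on k f S \<Longrightarrow> Ck_on k (\<lambda>x. c * f x) S"
  by (intro Ck_on_mult) auto

lemma Ck_on_diff:
  assumes "open S" "Ck_on k f S" "Ck_on k g S"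
  shows "Ck_on k (\<lambda>x. f x - g x) S"
  using Ck_on_add[OF assms(1,2) Ck_on_cmult[OF assms(1,3), of "-1"]] by simp

lemma Ck_on_sum:
  assumes "open S" "\<And>i. i \<in> I \<Longrightarrow> Ck_on k (f i) S"
  shows "Ck_on k (\<lambda>x. \<Sum>i\<in>I. f i x) S"
  using assms(2) by (induction I rule: infinite_finite_induct) (auto intro: Ck_on_add[OF assms(1)])

lemma Ck_on_compose:
  fixes f :: "real \<Rightarrow> real"
  assumes "open S" "open T" "q ` S \<subseteq> T" "Ck_on k f T" "Ck_on k q S"
  shows "Ck_on k (\<lambda>x. f (q x)) S"
  using assms(4,5)
proof (induction k arbitrary: f)
  case 0
  then show ?case using assms(3) by (auto intro: continuous_on_compose2)
next
  case (Suc k)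
  have gr: "GDERIV (\<lambda>x. f (q x)) x :> grad f (q x) *\<^sub>R grad q x" if "x \<in> S" for x
  proof -
    have "f differentiable (at (q x))" using Suc.prems(1) assms(3) that by auto
    from GDERIV_grad[OF this] have "DERIV f (q x) :> grad f (q x)" by simp
    moreover have "GDERIV q x :> grad q x" using Suc.prems(2) that by (auto intro: GDERIV_grad)
    ultimately show ?thesis by (intro GDERIV_DERIV_compose)
  qed
  have "Ck_on k (grad f) T" using Suc.prems(1) by simp
  then have 1: "Ck_on k (\<lambda>x. grad f (q x)) S"
    using Suc.IH Suc.prems(2) Ck_on_Suc_D by blast
  have "Ck_on k (\<lambda>x. b \<bullet> grad (\<lambda>x. f (q x)) x) S" if "b \<in> Basis" for b
  proof (rule Ck_on_cong[OF assms(1)])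
    show "Ck_on k (\<lambda>x. grad f (q x) * (b \<bullet> grad q x)) S"
      using Suc.prems that 1 by (intro Ck_on_mult[OF assms(1)]) auto
  qed (simp add: grad_eq[OF gr])
  then show ?case using GDERIV_differentiable[OF gr] by auto
qed

lemma Ck_on_Suc_real:
  fixes f :: "real \<Rightarrow> real"
  assumes "open S" "\<And>x. x \<in> S \<Longrightarrow> (f has_real_derivative f' x) (at x)" "Ck_on k f' S"
  shows "Ck_on (Suc k) f S"
proof -
  have "grad f x = f' x" if "x \<in> S" for x
    using grad_eq[of f x "f' x"] assms(2)[OF that] by simp
  then have "Ck_on k (\<lambda>x. 1 \<bullet> grad f x) S"
    by (intro Ck_on_cong[OF assms(1) _ assms(3)]) simp
  moreover have "f differentiable (at x)" if "x \<in> S" for x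
    using assms(2)[OF that] real_differentiable_def by blast
  ultimately show ?thesis by simp
qed

lemma Ck_on_inverse: "Ck_on k (\<lambda>x::real. inverse x) {0<..}"
proof (induction k)
  case 0
  then show ?case by (auto intro!: continuous_intros)
next
  case (Suc k)
  show ?case
  proof (rule Ck_on_Suc_real)
    show "Ck_on k (\<lambda>x. - 1 * (inverse x * inverse x)) {0::real<..}"
      using Suc by (intro Ck_on_cmult Ck_on_mult) auto
  qed (auto intro!: derivative_eq_intros)
qed

lemma Ck_on_laplacian:
  assumes "open S" "Ck_on (Suc (Suc k)) f S"
  shows "Ck_on k (laplacian f) S"
  unfolding laplacian_def using assms by (intro Ck_on_sum) auto

text \<open>Up to linear combinations this family is closed under differentiation, even at \<open>0\<close>;
  hence all its members are smooth.\<close>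

definition flat :: "nat \<Rightarrow> real \<Rightarrow> real" where
  "flat j x = (if x > 0 then inverse x ^ j * exp (- inverse x) else 0)"

lemma flat_tendsto_0: "(flat j \<longlongrightarrow> 0) (at_right 0)"
proof -
  have "((\<lambda>y::real. y ^ j / exp y) \<longlongrightarrow> 0) at_top" by (rule tendsto_power_div_exp_0)
  then have "((\<lambda>x::real. inverse x ^ j / exp (inverse x)) \<longlongrightarrow> 0) (at_right 0)"
    by (rule filterlim_compose) (rule filterlim_inverse_at_top_right)
  moreover have "\<forall>\<^sub>F x in at_right 0. inverse x ^ j / exp (inverse x) = flat j x"
    unfolding eventually_at_right_field
    by (auto simp: flat_def exp_minus field_simps intro!: exI[of _ 1])
  ultimately show ?thesis using tendsto_cong by fastforce
qed

lemma flat_deriv: "(flat j has_real_derivative flat (j + 2) x - real j * flat (Suc j) x) (at x)"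
proof -
  consider "x > 0" | "x = 0" | "x < 0" by linarith
  then show ?thesis
  proof cases
    case 1
    have "((\<lambda>x. inverse x ^ j * exp (- inverse x)) has_real_derivative
        flat (j + 2) x - real j * flat (Suc j) x) (at x)"
      using 1
      apply (auto intro!: derivative_eq_intros simp: flat_def)
      apply (cases j)
       apply (auto simp: algebra_simps power2_eq_square)
      done
    then show ?thesis
      by (rule has_field_derivative_transform_within_open[of _ _ _ "{0<..}"])
        (use 1 in \<open>auto simp: flat_def\<close>)
  next
    case 2
    \<comment> \<open>From the right the difference quotient of \<open>flat j\<close> at 0 is
      \<open>flat (Suc j)\<close> itself: dividing by x adds one factor
      \<open>inverse x\<close>.\<close>
    have "((\<lambda>h. (flat j (0 + h) - flat j 0) / h) \<longlongrightarrow> 0) (at_right 0)"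
    proof (rule Lim_transform_eventually[OF flat_tendsto_0[of "Suc j"]])
      show "\<forall>\<^sub>F x in at_right 0. flat (Suc j) x = (flat j (0 + x) - flat j 0) / x"
        unfolding eventually_at_right_field
        by (auto simp: flat_def field_simps intro!: exI[of _ 1])
    qed
    moreover have "((\<lambda>h. (flat j (0 + h) - flat j 0) / h) \<longlongrightarrow> 0) (at_left 0)"
    proof (rule Lim_transform_eventually[of "\<lambda>_. 0"])
      show "\<forall>\<^sub>F x in at_left 0. 0 = (flat j (0 + x) - flat j 0) / x"
        unfolding eventually_at_left_field
        by (auto simp: flat_def field_simps intro!: exI[of _ "-1"])
    qed simp
    ultimately have "((\<lambda>h. (flat j (0 + h) - flat j 0) / h) \<longlongrightarrow> 0) (at 0)"
      using filterlim_split_at by blast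
    then show ?thesis using 2 by (simp add: DERIV_def flat_def)
  next
    case 3
    have "((\<lambda>x. 0) has_real_derivative flat (j + 2) x - real j * flat (Suc j) x) (at x)"
      using 3 by (simp add: flat_def)
    then show ?thesis
      by (rule has_field_derivative_transform_within_open[of _ _ _ "{..<0}"])
        (use 3 in \<open>auto simp: flat_def\<close>)
  qed
qed

lemma Ck_on_flat: "Ck_on k (flat j) UNIV"
proof (induction k arbitrary: j)
  case 0
  then show ?case
    using flat_deriv by (auto intro!: continuous_at_imp_continuous_on DERIV_isCont)
next
  case (Suc k)
  show ?case
    by (rule Ck_on_Suc_real[OF open_UNIV flat_deriv]) (intro Ck_on_diff Ck_on_cmult Suc, auto)
qed

section \<open>Green's identity and harmonic distributions\<close>

lemma integrable_lborel_if_continuous_compact: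
  fixes g :: "'a::euclidean_space \<Rightarrow> real"
  assumes "continuous_on K g" "compact K" "K \<subseteq> S" "\<And>x. x \<in> S - K \<Longrightarrow> g x = 0"
  shows "set_integrable lborel S g"
proof -
  have "(\<lambda>x. indicator S x *\<^sub>R g x) = (\<lambda>x. indicator K x *\<^sub>R g x)"
    using assms(3,4) by (auto simp: fun_eq_iff indicator_def)
  then show ?thesis
    unfolding set_integrable_def using borel_integrable_compact[OF assms(2,1)] by simp
qed

lemma integrable_if_continuous_bounded_support:
  fixes g :: "'a::euclidean_space \<Rightarrow> real"
  assumes "continuous_on UNIV g" "\<And>x. norm x > R \<Longrightarrow> g x = 0"
  shows "integrable lborel g"
proof -
  have "set_integrable lborel UNIV g"
    by (rule integrable_lborel_if_continuous_compact[of "cball 0 R"])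
      (use assms in \<open>auto intro: continuous_on_subset\<close>)
  then show ?thesis by (simp add: set_integrable_def)
qed

lemma integral_deriv_compact_support:
  fixes F f :: "real \<Rightarrow> real"
  assumes "\<And>x. (F has_real_derivative f x) (at x)" "continuous_on UNIV f"
    and "\<And>x. \<bar>x\<bar> \<ge> R \<Longrightarrow> F x = 0" "\<And>x. \<bar>x\<bar> > R \<Longrightarrow> f x = 0"
  shows "(\<integral>x. f x \<partial>lborel) = 0"
proof -
  define T where "T = \<bar>R\<bar> + 1"
  have "(\<integral>x. f x * indicator {-T..T} x \<partial>lborel) = F T - F (-T)"
    by (rule integral_FTC_Icc_real)
      (use assms T_def in \<open>auto simp: continuous_on_eq_continuous_at\<close>)
  moreover have "(\<lambda>x. f x * indicator {-T..T} x) = f"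
  proof
    fix x
    show "f x * indicator {-T..T} x = f x"
      using assms(4)[of x] by (cases "x \<in> {-T..T}") (auto simp: T_def)
  qed
  moreover have "F T = 0" "F (-T) = 0" using assms(3) by (auto simp: T_def)
  ultimately show ?thesis by simp
qed

lemma GDERIV_zero_outside:
  fixes F :: "'a::euclidean_space \<Rightarrow> real"
  assumes "GDERIV F x :> v" "open S" "x \<in> S" "\<And>y. y \<in> S \<Longrightarrow> F y = 0"
  shows "v = 0"
  using GDERIV_transform_open[OF assms(1-3), of "\<lambda>_. 0"] assms(4) GDERIV_const[of 0 x]
    grad_eq[of "\<lambda>_. 0" x] by metis

text \<open>Takes the place of the divergence theorem. Fubini reduces it to lines parallel to the
  axes, where the fundamental theorem of calculus applies because \<open>F\<close> vanishes at both
  ends.\<close>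

lemma integral_directional_derivative_zero:
  fixes F :: "R2 \<Rightarrow> real"
  assumes F: "\<And>x. GDERIV F x :> G x" and G: "continuous_on UNIV G"
    and supp: "\<And>x. norm x \<ge> R \<Longrightarrow> F x = 0"
  shows "integrable lborel (\<lambda>x. b \<bullet> G x)" and "(\<integral>x. b \<bullet> G x \<partial>lborel) = 0"
proof -
  have G0: "G x = 0" if "norm x > R" for x
  proof (rule GDERIV_zero_outside[OF F])
    show "open (- cball (0::R2) R)" by auto
    show "x \<in> - cball 0 R" using that by auto
  qed (use supp in auto)
  have int: "integrable lborel (\<lambda>x. b' \<bullet> G x)" for b'
    by (rule integrable_if_continuous_bounded_support[of _ R])
      (use G G0 in \<open>auto intro!: continuous_intros\<close>)
  show "integrable lborel (\<lambda>x. b \<bullet> G x)" by (rule int)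
  have cfst: "continuous_on UNIV (\<lambda>x. fst (G x))" and csnd: "continuous_on UNIV (\<lambda>x. snd (G x))"
    using G by (auto intro: continuous_intros)
  have norm_le: "\<bar>x\<bar> \<le> norm (x, y)" "\<bar>y\<bar> \<le> norm (x, y)" for x y :: real
    using norm_fst_le[of x y] norm_snd_le[of y x] by auto
  have ints: "integrable (lborel \<Otimes>\<^sub>M lborel) (\<lambda>x. fst (G x))"
    "integrable (lborel \<Otimes>\<^sub>M lborel) (\<lambda>x. snd (G x))"
    using int[of "(1,0)"] int[of "(0,1)"] by (simp_all add: inner_prod_def lborel_prod)
  have d1: "((\<lambda>s. F (s, y)) has_real_derivative fst (G (x, y))) (at x)" for x y
  proof -
    have "((\<lambda>s. (s, y)) has_derivative (\<lambda>h. (h, 0))) (at x)"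
      by (auto intro!: derivative_eq_intros)
    from has_derivative_compose[OF this, of F "\<lambda>h. h \<bullet> G (x, y)"] show ?thesis
      using F[of "(x, y)"] by (simp add: gderiv_def has_field_derivative_def inner_prod_def mult_commute_abs)
  qed
  have d2: "((\<lambda>s. F (x, s)) has_real_derivative snd (G (x, y))) (at y)" for x y
  proof -
    have "((\<lambda>s. (x, s)) has_derivative (\<lambda>h. (0, h))) (at y)"
      by (auto intro!: derivative_eq_intros)
    from has_derivative_compose[OF this, of F "\<lambda>h. h \<bullet> G (x, y)"] show ?thesis
      using F[of "(x, y)"] by (simp add: gderiv_def has_field_derivative_def inner_prod_def mult_commute_abs)
  qed
  have "(\<integral>x. fst (G x) \<partial>lborel) = (\<integral>y. (\<integral>x. fst (G (x, y)) \<partial>lborel) \<partial>lborel)"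
    using lborel_pair.integral_snd[of "\<lambda>x y. fst (G (x, y))"] ints(1)
    by (simp add: lborel_prod case_prod_unfold)
  also have "\<dots> = 0"
  proof -
    have "(\<integral>x. fst (G (x, y)) \<partial>lborel) = 0" for y
    proof (rule integral_deriv_compact_support[OF d1])
      show "continuous_on UNIV (\<lambda>x. fst (G (x, y)))"
        by (rule continuous_on_compose2[OF cfst]) (auto intro: continuous_intros)
      show "F (x, y) = 0" if "\<bar>x\<bar> \<ge> R" for x using that norm_le(1)[of x y] supp by force
      show "fst (G (x, y)) = 0" if "\<bar>x\<bar> > R" for x using that norm_le(1)[of x y] G0 by force
    qed
    then show ?thesis by simp
  qed
  finally have 1: "(\<integral>x. fst (G x) \<partial>lborel) = 0" .
  have "(\<integral>x. snd (G x) \<partial>lborel) = (\<integral>x. (\<integral>y. snd (G (x, y)) \<partial>lborel) \<partial>lborel)"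
    using lborel_pair.integral_fst[of "\<lambda>x y. snd (G (x, y))"] ints(2)
    by (simp add: lborel_prod case_prod_unfold)
  also have "\<dots> = 0"
  proof -
    have "(\<integral>y. snd (G (x, y)) \<partial>lborel) = 0" for x
    proof (rule integral_deriv_compact_support[OF d2])
      show "continuous_on UNIV (\<lambda>y. snd (G (x, y)))"
        by (rule continuous_on_compose2[OF csnd]) (auto intro: continuous_intros)
      show "F (x, y) = 0" if "\<bar>y\<bar> \<ge> R" for y using that norm_le(2)[of y x] supp by force
      show "snd (G (x, y)) = 0" if "\<bar>y\<bar> > R" for y using that norm_le(2)[of y x] G0 by force
    qed
    then show ?thesis by simp
  qed
  finally have 2: "(\<integral>x. snd (G x) \<partial>lborel) = 0" .
  show "(\<integral>x. b \<bullet> G x \<partial>lborel) = 0"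
    using 1 2 ints by (simp add: inner_prod_def lborel_prod)
qed

lemma GDERIV_field_continuous:
  fixes F :: "'a::euclidean_space \<Rightarrow> real"
  assumes "Ck_on (Suc k) F UNIV"
  shows "GDERIV F x :> grad F x" "continuous_on UNIV (grad F)"
proof -
  show "GDERIV F x :> grad F x" using assms by (auto intro: GDERIV_grad)
  have "continuous_on UNIV (\<lambda>x. \<Sum>b\<in>Basis. (b \<bullet> grad F x) *\<^sub>R b)"
    using assms by (intro continuous_on_sum continuous_on_scaleR continuous_on_const)
      (auto intro: Ck_on_imp_continuous_on)
  then show "continuous_on UNIV (grad F)"
    by (simp add: inner_commute[of _ "grad F _"] euclidean_representation)
qed

lemma test_functions_props:
  assumes "\<phi> \<in> test_functions S"
  defines "K \<equiv> closure {x. \<phi> x \<noteq> 0}"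
  shows "compact K" "K \<subseteq> S" "\<And>k. Ck_on k \<phi> UNIV" "open (- K)"
    "\<And>x. x \<notin> K \<Longrightarrow> \<phi> x = 0" "\<And>x. x \<notin> K \<Longrightarrow> grad \<phi> x = 0"
    "\<And>x. x \<notin> K \<Longrightarrow> laplacian \<phi> x = 0"
proof -
  show "compact K" "K \<subseteq> S" "\<And>k. Ck_on k \<phi> UNIV"
    using assms unfolding test_functions_def by auto
  show o: "open (- K)" unfolding K_def by auto
  show z: "\<phi> x = 0" if "x \<notin> K" for x
    using that closure_subset[of "{x. \<phi> x \<noteq> 0}"] unfolding K_def by auto
  show g: "grad \<phi> x = 0" if "x \<notin> K" for x
    using grad_cong_open[OF o, of x \<phi> "\<lambda>_. 0"] grad_eq[OF GDERIV_const[of 0 x]] that z by auto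
  show "laplacian \<phi> x = 0" if "x \<notin> K" for x
  proof -
    have "grad (\<lambda>y. b \<bullet> grad \<phi> y) x = 0" for b
      using grad_cong_open[OF o, of x "\<lambda>y. b \<bullet> grad \<phi> y" "\<lambda>_. 0"] that g
        grad_eq[OF GDERIV_const[of 0 x]] by auto
    then show ?thesis unfolding laplacian_def by simp
  qed
qed

text \<open>The field e \<nabla>\<phi> - \<phi> \<nabla>e, with components \<open>X b\<close>, has
  divergence e \<Delta>\<phi> - \<phi> \<Delta>e, since the products of gradients cancel. As
  \<open>e\<close> is regular only in \<open>S\<close>, the field is extended by zero;
  \<open>S\<close> and the complement of the support \<open>K\<close> cover the plane, which shows
  that the extension is continuously differentiable.\<close>

theorem Green_identity:
  fixes e :: "R2 \<Rightarrow> real"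
  assumes S: "open S" and e: "Ck_on 2 e S" and \<phi>: "\<phi> \<in> test_functions S"
  shows "set_integrable lborel S (\<lambda>x. e x * laplacian \<phi> x)"
    and "(LINT x:S|lborel. e x * laplacian \<phi> x) = (LINT x:S|lborel. \<phi> x * laplacian e x)"
proof -
  define K where "K = closure {x. \<phi> x \<noteq> 0}"
  note tf = test_functions_props[OF \<phi>, folded K_def]
  define X where "X b x = (if x \<in> S then e x * (b \<bullet> grad \<phi> x) - \<phi> x * (b \<bullet> grad e x) else 0)" for b x
  have e2: "Ck_on (Suc (Suc 0)) e S" using e by (simp add: numeral_2_eq_2)
  have e1: "Ck_on (Suc 0) e S" using e2 by (rule Ck_on_Suc_D)
  have phi2: "Ck_on (Suc (Suc 0)) \<phi> UNIV" by (rule tf)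
  have phi1: "Ck_on (Suc 0) \<phi> S" "Ck_on (Suc (Suc 0)) \<phi> S"
    using tf(3) Ck_on_subset by blast+
  have X0: "X b x = 0" if "x \<in> - K" for b x using that tf by (auto simp: X_def)
  have C1: "Ck_on 1 (X b) UNIV" if b: "b \<in> Basis" for b
  proof (rule Ck_on_local)
    fix x
    show "\<exists>T. open T \<and> x \<in> T \<and> Ck_on 1 (X b) T"
    proof (cases "x \<in> S")
      case True
      have "Ck_on (Suc 0) (\<lambda>x. e x * (b \<bullet> grad \<phi> x) - \<phi> x * (b \<bullet> grad e x)) S"
        using b phi1 e1 e2[THEN Ck_on.simps(2)[THEN iffD1]] phi1(2)[THEN Ck_on.simps(2)[THEN iffD1]]
        by (intro Ck_on_diff[OF S] Ck_on_mult[OF S])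
          (blast dest: Ck_on_Suc_D intro: Ck_on_Suc_D e1[THEN Ck_on_Suc_D])+
      then have "Ck_on 1 (X b) S"
        unfolding One_nat_def by (rule Ck_on_cong[OF S, rotated]) (simp add: X_def)
      with True S show ?thesis by blast
    next
      case False
      then have "x \<in> - K" using tf(2) by auto
      moreover have "Ck_on 1 (X b) (- K)"
        by (rule Ck_on_cong[OF tf(4), of "\<lambda>_. 0"]) (use X0 in auto)
      ultimately show ?thesis using tf(4) by blast
    qed
  qed
  obtain R where R: "K \<subseteq> ball 0 R" using tf(1) compact_imp_bounded bounded_subset_ballD by blast
  have "(\<integral>x. b \<bullet> grad (X b) x \<partial>lborel) = 0 \<and> integrable lborel (\<lambda>x. b \<bullet> grad (X b) x)" if "b \<in> Basis" for b
  proof -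
    note C = GDERIV_field_continuous[OF C1[OF that, unfolded One_nat_def]]
    have "X b x = 0" if "norm x \<ge> R" for x
    proof (rule X0)
      have "x \<notin> ball 0 R" using that by simp
      then show "x \<in> - K" using R by blast
    qed
    from integral_directional_derivative_zero[OF C this] show ?thesis by blast
  qed
  then have "(\<integral>x. (\<Sum>b\<in>Basis. b \<bullet> grad (X b) x) \<partial>lborel) = 0"
    by (subst Bochner_Integration.integral_sum) auto
  moreover have "(\<Sum>b\<in>Basis. b \<bullet> grad (X b) x) =
      indicator S x *\<^sub>R (e x * laplacian \<phi> x) - indicator S x *\<^sub>R (\<phi> x * laplacian e x)" for x
  proof (cases "x \<in> S")
    case True
    have "b \<bullet> grad (X b) x = e x * (b \<bullet> grad (\<lambda>y. b \<bullet> grad \<phi> y) x) - \<phi> x * (b \<bullet> grad (\<lambda>y. b \<bullet> grad e y) x)"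
      if b: "b \<in> Basis" for b
    proof -
      have "GDERIV (\<lambda>x. e x * (b \<bullet> grad \<phi> x) - \<phi> x * (b \<bullet> grad e x)) x :>
          (e x *\<^sub>R grad (\<lambda>y. b \<bullet> grad \<phi> y) x + (b \<bullet> grad \<phi> x) *\<^sub>R grad e x) -
          (\<phi> x *\<^sub>R grad (\<lambda>y. b \<bullet> grad e y) x + (b \<bullet> grad e x) *\<^sub>R grad \<phi> x)"
        using True b e2 phi2
        by (intro GDERIV_diff GDERIV_mult GDERIV_grad) (auto simp del: split_paired_All)
      from grad_eq[OF this] grad_cong_open[OF S True, of "X b" "\<lambda>x. e x * (b \<bullet> grad \<phi> x) - \<phi> x * (b \<bullet> grad e x)"]
      show ?thesis by (simp add: X_def inner_diff_right inner_add_right)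
    qed
    then show ?thesis using True
      by (simp add: laplacian_def sum_distrib_left sum_subtractf)
  next
    case False
    then have "x \<in> - K" using tf(2) by auto
    have "grad (X b) x = 0" for b
      using grad_cong_open[OF tf(4) \<open>x \<in> - K\<close>, of "X b" "\<lambda>_. 0"] X0 grad_eq[OF GDERIV_const[of 0 x]] by simp
    with False show ?thesis by simp
  qed
  ultimately have eq: "(\<integral>x. indicator S x *\<^sub>R (e x * laplacian \<phi> x) - indicator S x *\<^sub>R (\<phi> x * laplacian e x) \<partial>lborel) = 0"
    by simp
  have cK: "continuous_on K e" "continuous_on K \<phi>" "continuous_on K (laplacian e)" "continuous_on K (laplacian \<phi>)"
    using Ck_on_laplacian[OF S e2] Ck_on_laplacian[OF open_UNIV phi2] e2 phi2 tf(2)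
    by (auto dest!: Ck_on_imp_continuous_on intro: continuous_on_subset simp del: Ck_on.simps)
  show i1: "set_integrable lborel S (\<lambda>x. e x * laplacian \<phi> x)"
    by (rule integrable_lborel_if_continuous_compact[of K])
      (use tf cK in \<open>auto intro!: continuous_intros\<close>)
  have i2: "set_integrable lborel S (\<lambda>x. \<phi> x * laplacian e x)"
    by (rule integrable_lborel_if_continuous_compact[of K])
      (use tf cK in \<open>auto intro!: continuous_intros\<close>)
  show "(LINT x:S|lborel. e x * laplacian \<phi> x) = (LINT x:S|lborel. \<phi> x * laplacian e x)"
    using eq i1 i2 unfolding set_lebesgue_integral_def set_integrable_def
    by (simp add: Bochner_Integration.integral_diff)
qed

lemma harmonic_in_distr:
  fixes e :: "R2 \<Rightarrow> real"
  assumes "open S" "harmonic_in e S"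
  shows "distr_laplace_eq S e (\<lambda>_. 0)"
proof -
  have e: "Ck_on 2 e S" and l: "\<And>x. x \<in> S \<Longrightarrow> laplacian e x = 0"
    using assms(2) by (auto simp: harmonic_in_def)
  have "locally_integrable e S"
    unfolding locally_integrable_def
  proof (intro allI impI)
    fix K assume "compact K \<and> K \<subseteq> S"
    then show "set_integrable lborel K e"
      using Ck_on_imp_continuous_on[OF e]
      by (intro integrable_lborel_if_continuous_compact[of K]) (auto intro: continuous_on_subset)
  qed
  moreover have "(LINT x:S|lborel. e x * laplacian \<phi> x) = 0" if "\<phi> \<in> test_functions S" for \<phi>
  proof -
    have "(LINT x:S|lborel. \<phi> x * laplacian e x) = (LINT x:S|lborel. 0)"
      unfolding set_lebesgue_integral_def
      by (rule Bochner_Integration.integral_cong) (auto simp: indicator_def l)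
    then show ?thesis using Green_identity(2)[OF assms(1) e that] by simp
  qed
  ultimately show ?thesis by (simp add: distr_laplace_eq_def)
qed

text \<open>Local integrability controls \<open>v\<close> only on compact sets, but the Laplacian of
  a test function is bounded and vanishes off the support \<open>K\<close>. This justifies splitting
  such integrals.\<close>

lemma set_integrable_times_laplacian:
  assumes "locally_integrable v S" "\<phi> \<in> test_functions S"
  shows "set_integrable lborel S (\<lambda>x. v x * laplacian \<phi> x)"
proof -
  define K where "K = closure {x. \<phi> x \<noteq> 0}"
  note tf = test_functions_props[OF assms(2), folded K_def]
  have c: "continuous_on UNIV (laplacian \<phi>)"
    using Ck_on_laplacian[OF open_UNIV, of 0 \<phi>] tf(3)[of "Suc (Suc 0)"] by auto
  have "bounded (laplacian \<phi> ` K)"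
    by (rule compact_imp_bounded[OF compact_continuous_image[OF continuous_on_subset[OF c subset_UNIV] tf(1)]])
  then obtain B where B: "\<And>x. x \<in> K \<Longrightarrow> \<bar>laplacian \<phi> x\<bar> \<le> B"
    unfolding bounded_iff by (metis imageI real_norm_def)
  have i: "integrable lborel (\<lambda>x. indicator K x *\<^sub>R v x)"
    using assms(1)[unfolded locally_integrable_def, rule_format, of K] tf(1,2)
    by (simp only: set_integrable_def)
  have eq: "indicator S x *\<^sub>R (v x * laplacian \<phi> x) = (indicator K x *\<^sub>R v x) * laplacian \<phi> x" for x
    using tf(2) tf(7)[of x] by (auto simp: indicator_def)
  have "integrable lborel (\<lambda>x. (indicator K x *\<^sub>R v x) * laplacian \<phi> x)"
  proof (rule Bochner_Integration.integrable_bound[OF integrable_mult_left[OF i, of B]])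
    show "(\<lambda>x. indicator K x *\<^sub>R v x * laplacian \<phi> x) \<in> borel_measurable lborel"
      using borel_measurable_integrable[OF i] borel_measurable_continuous_onI[OF c]
      by (intro borel_measurable_times) simp_all
    show "AE x in lborel. norm (indicator K x *\<^sub>R v x * laplacian \<phi> x) \<le> norm (indicator K x *\<^sub>R v x * B)"
    proof (rule AE_I2)
      fix x :: 'a
      show "norm (indicator K x *\<^sub>R v x * laplacian \<phi> x) \<le> norm (indicator K x *\<^sub>R v x * B)"
        using B[of x] by (cases "x \<in> K") (auto simp: abs_mult intro!: mult_left_mono)
    qed
  qed
  then show ?thesis unfolding set_integrable_def eq .
qed

lemma distr_laplace_eq_add:
  assumes "distr_laplace_eq S v T" "distr_laplace_eq S w T'"
  shows "distr_laplace_eq S (\<lambda>x. v x + w x) (\<lambda>\<phi>. T \<phi> + T' \<phi>)"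
proof -
  have "(LINT x:S|lborel. (v x + w x) * laplacian \<phi> x) = T \<phi> + T' \<phi>" if "\<phi> \<in> test_functions S" for \<phi>
    using assms that set_integrable_times_laplacian[of v S \<phi>] set_integrable_times_laplacian[of w S \<phi>]
    by (simp add: distr_laplace_eq_def distrib_right set_integral_add)
  moreover have "locally_integrable (\<lambda>x. v x + w x) S"
    using assms unfolding distr_laplace_eq_def locally_integrable_def by (auto intro: set_integral_add)
  ultimately show ?thesis by (simp add: distr_laplace_eq_def)
qed

lemma distr_laplace_eq_cmult:
  assumes "distr_laplace_eq S v T"
  shows "distr_laplace_eq S (\<lambda>x. c * v x) (\<lambda>\<phi>. c * T \<phi>)"
  using assms unfolding distr_laplace_eq_def locally_integrable_def
  by (simp add: mult.assoc)

text \<open>A single point is a null set. The equation is thus transferred between functions that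
  differ at the emitter, where the value of a solution is arbitrary.\<close>

lemma distr_laplace_eq_cong_except:
  fixes v w :: "'a::euclidean_space \<Rightarrow> real"
  assumes "distr_laplace_eq S v T" "\<And>x. x \<in> S - {P} \<Longrightarrow> v x = w x"
  shows "distr_laplace_eq S w T"
proof -
  have ae: "AE x in lborel. x \<noteq> P" by (simp add: AE_lborel_singleton)
  have 1: "AE x in lborel. indicator S x *\<^sub>R (v x * g x) = indicator S x *\<^sub>R (w x * g x)" for g :: "'a \<Rightarrow> real"
    using ae by eventually_elim (use assms(2) in \<open>auto simp: indicator_def\<close>)
  have "locally_integrable w S"
    unfolding locally_integrable_def
  proof (intro allI impI)
    fix K assume K: "compact K \<and> K \<subseteq> S"
    then have "integrable lborel (\<lambda>x. indicator K x *\<^sub>R v x)"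
      using assms(1) by (simp add: distr_laplace_eq_def locally_integrable_def set_integrable_def)
    \<comment> \<open>Writing \<open>w\<close> on \<open>K\<close> as \<open>v\<close> plus a
      multiple of the indicator of \<open>{P}\<close> also settles the measurability of
      \<open>w\<close>.\<close>
    moreover have "integrable lborel (\<lambda>x. indicator {P} x * (indicator K P * (w P - v P)))"
      by (rule integrable_mult_left) (auto simp: integrable_real_indicator)
    ultimately have "integrable lborel (\<lambda>x. indicator K x *\<^sub>R v x + indicator {P} x * (indicator K P * (w P - v P)))"
      by (rule Bochner_Integration.integrable_add)
    moreover have "(\<lambda>x. indicator K x *\<^sub>R v x + indicator {P} x * (indicator K P * (w P - v P))) =
        (\<lambda>x. indicator K x *\<^sub>R w x)"
      using K assms(2) by (auto simp: fun_eq_iff indicator_def)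
    ultimately show "set_integrable lborel K w" unfolding set_integrable_def by simp
  qed
  moreover have "(LINT x:S|lborel. w x * laplacian \<phi> x) = (LINT x:S|lborel. v x * laplacian \<phi> x)"
    if "\<phi> \<in> test_functions S" for \<phi>
  proof -
    have "integrable lborel (\<lambda>x. indicator S x *\<^sub>R (v x * laplacian \<phi> x))"
      "integrable lborel (\<lambda>x. indicator S x *\<^sub>R (w x * laplacian \<phi> x))"
      using set_integrable_times_laplacian that assms(1) calculation
      unfolding set_integrable_def distr_laplace_eq_def by blast+
    then show ?thesis
      unfolding set_lebesgue_integral_def
      by (intro integral_cong_AE) (use 1[of "laplacian \<phi>"] in auto)
  qed
  ultimately show ?thesis using assms(1) by (simp add: distr_laplace_eq_def)
qed

section \<open>The dipole distribution\<close>

lemma integral_lborel_affine: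
  fixes f :: "R2 \<Rightarrow> real"
  assumes [measurable]: "f \<in> borel_measurable borel" and c: "c > 0"
  shows "(\<integral>x. f x \<partial>lborel) = (\<integral>y. c\<^sup>2 * f (P + c *\<^sub>R y) \<partial>lborel)"
proof -
  have "(\<integral>x. f x \<partial>lborel) = (\<integral>x. f x \<partial>density (distr lborel borel (\<lambda>x. P + c *\<^sub>R x)) (\<lambda>_. \<bar>c\<bar> ^ DIM(R2)))"
    using lborel_affine[of c P] c by simp
  also have "\<dots> = (\<integral>x. \<bar>c\<bar> ^ DIM(R2) *\<^sub>R f x \<partial>distr lborel borel (\<lambda>x. P + c *\<^sub>R x))"
    by (rule integral_density) auto
  also have "\<dots> = (\<integral>y. \<bar>c\<bar> ^ DIM(R2) *\<^sub>R f (P + c *\<^sub>R y) \<partial>lborel)"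
    by (rule integral_distr) auto
  finally show ?thesis using c by (simp add: power2_eq_square)
qed

lemma integral_FTC_real_line:
  fixes f F :: "real \<Rightarrow> real"
  assumes F: "\<And>x. (F has_real_derivative f x) (at x)" and f: "\<And>x. isCont f x" "\<And>x. f x \<ge> 0"
    and lim: "(F \<longlongrightarrow> A) at_bot" "(F \<longlongrightarrow> B) at_top"
  shows "integrable lborel f" "(\<integral>x. f x \<partial>lborel) = B - A"
proof -
  note * = interval_integral_FTC_nonneg[of "-\<infinity>" \<infinity> F f A B]
  have l: "((F \<circ> real_of_ereal) \<longlongrightarrow> A) (at_right (-\<infinity>))" "((F \<circ> real_of_ereal) \<longlongrightarrow> B) (at_left \<infinity>)"
    using lim by (auto simp: ereal_tendsto_simps)
  show "integrable lborel f" "(\<integral>x. f x \<partial>lborel) = B - A"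
    using *(1)[OF _ F f(1) _ l] *(2)[OF _ F f(1) _ l] f(2)
    by (auto simp: set_integrable_def set_lebesgue_integral_def interval_lebesgue_integral_def)
qed

text \<open>The inner integral in \<open>integral_plane_kernel\<close>, with A = 1 + x^2. The
  antiderivative \<open>F\<close> is the classical one, a rational function plus an
  arctangent.\<close>

lemma integral_inverse_quadratic_squared:
  fixes A :: real
  assumes A: "A > 0"
  shows "integrable lborel (\<lambda>y. 1 / (A + y\<^sup>2)\<^sup>2)" "(\<integral>y. 1 / (A + y\<^sup>2)\<^sup>2 \<partial>lborel) = pi / (2 * A * sqrt A)"
proof -
  define F where "F y = y / (2 * A * (y\<^sup>2 + A)) + arctan (y / sqrt A) / (2 * A * sqrt A)" for y
  have pos: "y\<^sup>2 + A > 0" "A + y\<^sup>2 > 0" for y using A by (auto intro: add_nonneg_pos add_pos_nonneg)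
  have d: "(F has_real_derivative 1 / (A + y\<^sup>2)\<^sup>2) (at y)" for y
  proof -
    have s: "sqrt A * sqrt A = A" "sqrt A > 0" using A by auto
    have h1: "(F has_real_derivative
       ((2 * A * (y\<^sup>2 + A)) - y * (2 * A * (2 * y))) / (2 * A * (y\<^sup>2 + A))\<^sup>2 +
       (1 / sqrt A) / (1 + (y / sqrt A)\<^sup>2) / (2 * A * sqrt A)) (at y)"
      unfolding F_def
    proof (rule DERIV_add)
      show "((\<lambda>y. y / (2 * A * (y\<^sup>2 + A))) has_real_derivative
          ((2 * A * (y\<^sup>2 + A)) - y * (2 * A * (2 * y))) / (2 * A * (y\<^sup>2 + A))\<^sup>2) (at y)"
      proof -
        have d: "((\<lambda>y. 2 * A * (y\<^sup>2 + A)) has_real_derivative 2 * A * (2 * y)) (at y)"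
          by (auto intro!: derivative_eq_intros)
        have "2 * A * (y\<^sup>2 + A) \<noteq> 0" using A pos[of y] by simp
        from DERIV_divide[OF DERIV_ident d this] show ?thesis by (simp only: power2_eq_square mult_1)
      qed
      show "((\<lambda>y. arctan (y / sqrt A) / (2 * A * sqrt A)) has_real_derivative
          (1 / sqrt A) / (1 + (y / sqrt A)\<^sup>2) / (2 * A * sqrt A)) (at y)"
      proof -
        have "((\<lambda>y. y / sqrt A) has_real_derivative 1 / sqrt A) (at y)"
          by (rule DERIV_cdivide[OF DERIV_ident])
        from DERIV_cdivide[OF DERIV_chain2[OF DERIV_arctan this], of "2 * A * sqrt A"]
        show ?thesis by (simp only: divide_inverse mult_1 mult_1_right mult.commute[of "inverse (1 + _)"])
      qed
    qed
    have h2: "(1 / sqrt A) / (1 + (y / sqrt A)\<^sup>2) / (2 * A * sqrt A) = 1 / (2 * A * (y\<^sup>2 + A))"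
    proof -
      define r where "r = sqrt A"
      have r: "r > 0" "A = r * r" using s by (auto simp: r_def)
      have "r * r + y * y > 0" using r(1) by (intro add_pos_nonneg) auto
      then show ?thesis
        unfolding r_def[symmetric] r(2) using r(1)
        by (simp add: divide_simps power2_eq_square add.commute)
    qed
    have h3: "((2 * A * (y\<^sup>2 + A)) - y * (2 * A * (2 * y))) / (2 * A * (y\<^sup>2 + A))\<^sup>2 + 1 / (2 * A * (y\<^sup>2 + A)) = 1 / (A + y\<^sup>2)\<^sup>2"
    proof -
      define w where "w = y\<^sup>2 + A"
      have w: "w > 0" using pos w_def by simp
      have "((2 * A * w) - y * (2 * A * (2 * y))) / (2 * A * w)\<^sup>2 + 1 / (2 * A * w) = 1 / w\<^sup>2"
      proof -
        have "2 * A * w - y * (2 * A * (2 * y)) = 2 * A * (2 * A - w)"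
          by (simp add: w_def algebra_simps power2_eq_square)
        then show ?thesis using A w by (simp add: divide_simps power2_eq_square)
      qed
      then show ?thesis by (simp add: w_def add.commute)
    qed
    show ?thesis using h1 unfolding h2 h3 .
  qed
  have lim1: "(F \<longlongrightarrow> 0 + (pi/2) / (2 * A * sqrt A)) at_top"
    unfolding F_def
  proof (intro tendsto_add tendsto_divide tendsto_const)
    show "((\<lambda>y. y / (2 * A * (y\<^sup>2 + A))) \<longlongrightarrow> 0) at_top" using A by real_asymp
    have "filterlim (\<lambda>y. y / sqrt A) at_top at_top" using A by real_asymp
    then show "((\<lambda>y. arctan (y / sqrt A)) \<longlongrightarrow> pi/2) at_top"
      using tendsto_arctan_at_top by (rule filterlim_compose[rotated])
  qed (use A in auto)
  have lim2: "(F \<longlongrightarrow> 0 + (- (pi/2)) / (2 * A * sqrt A)) at_bot"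
    unfolding F_def
  proof (intro tendsto_add tendsto_divide tendsto_const)
    show "((\<lambda>y. y / (2 * A * (y\<^sup>2 + A))) \<longlongrightarrow> 0) at_bot" using A by real_asymp
    have "filterlim (\<lambda>y. y / sqrt A) at_bot at_bot" using A by real_asymp
    then show "((\<lambda>y. arctan (y / sqrt A)) \<longlongrightarrow> - (pi/2)) at_bot"
      using tendsto_arctan_at_bot by (rule filterlim_compose[rotated])
  qed (use A in auto)
  have c: "isCont (\<lambda>y. 1 / (A + y\<^sup>2)\<^sup>2) y" for y
    using pos(2)[of y] by (intro continuous_intros) auto
  show "integrable lborel (\<lambda>y. 1 / (A + y\<^sup>2)\<^sup>2)" "(\<integral>y. 1 / (A + y\<^sup>2)\<^sup>2 \<partial>lborel) = pi / (2 * A * sqrt A)"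
    using integral_FTC_real_line[OF d c _ lim2 lim1] by (auto simp: field_simps)
qed

lemma integral_inverse_three_halves:
  "integrable lborel (\<lambda>x::real. pi / (2 * (1 + x\<^sup>2) * sqrt (1 + x\<^sup>2)))"
  "(\<integral>x. pi / (2 * (1 + x\<^sup>2) * sqrt (1 + x\<^sup>2)) \<partial>lborel) = pi"
proof -
  define F where "F x = pi / 2 * (x / sqrt (1 + x\<^sup>2))" for x
  have pos: "1 + x\<^sup>2 > 0" for x :: real by (auto intro: add_pos_nonneg)
  have d: "(F has_real_derivative pi / (2 * (1 + x\<^sup>2) * sqrt (1 + x\<^sup>2))) (at x)" for x
  proof -
    define w where "w = sqrt (1 + x\<^sup>2)"
    have w: "w > 0" "w * w = 1 + x\<^sup>2" using pos[of x] by (auto simp: w_def)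
    have "(F has_real_derivative pi / 2 * ((w - x * (x / w)) / (w * w))) (at x)"
    proof -
      have "((\<lambda>x. sqrt (1 + x\<^sup>2)) has_real_derivative x / w) (at x)"
        unfolding w_def using pos[of x] by (auto intro!: derivative_eq_intros simp: field_simps)
      from DERIV_cmult[OF DERIV_divide[OF DERIV_ident this], of "pi / 2"] w show ?thesis
        unfolding F_def by (simp add: w_def)
    qed
    moreover have "pi / 2 * ((w - x * (x / w)) / (w * w)) = pi / (2 * (1 + x\<^sup>2) * w)"
    proof -
      have "w - x * (x / w) = 1 / w" using w by (simp add: field_simps power2_eq_square)
      then show ?thesis using w by (simp add: mult.commute)
    qed
    ultimately show ?thesis by (simp add: w_def)
  qed
  have lim1: "(F \<longlongrightarrow> pi / 2) at_top" unfolding F_def by real_asymp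
  have lim2: "(F \<longlongrightarrow> - (pi / 2)) at_bot" unfolding F_def by real_asymp
  have c: "isCont (\<lambda>x. pi / (2 * (1 + x\<^sup>2) * sqrt (1 + x\<^sup>2))) x" for x
    using pos[of x] by (intro continuous_intros) auto
  show "integrable lborel (\<lambda>x::real. pi / (2 * (1 + x\<^sup>2) * sqrt (1 + x\<^sup>2)))"
    "(\<integral>x. pi / (2 * (1 + x\<^sup>2) * sqrt (1 + x\<^sup>2)) \<partial>lborel) = pi"
    using integral_FTC_real_line[OF d c _ lim2 lim1] by (auto simp: less_imp_le[OF pos])
qed

lemma norm_R2_squared: "(norm (x::R2))\<^sup>2 = (fst x)\<^sup>2 + (snd x)\<^sup>2"
  by (cases x) (simp add: norm_Pair)

text \<open>The kernel serves twice: scaled, it concentrates to a multiple of the Dirac mass at the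
  emitter, and it is the majorant for the energy integrals over the exterior domain.\<close>

lemma integral_plane_kernel:
  "integrable lborel (\<lambda>x::R2. 1 / (1 + (norm x)\<^sup>2)\<^sup>2)"
  "(\<integral>x. 1 / (1 + (norm (x::R2))\<^sup>2)\<^sup>2 \<partial>lborel) = pi"
proof -
  define k where "k x = 1 / (1 + (norm (x::R2))\<^sup>2)\<^sup>2" for x
  have pos: "1 + x\<^sup>2 > 0" for x :: real by (auto intro: add_pos_nonneg)
  have k: "k (x, y) = 1 / ((1 + x\<^sup>2) + y\<^sup>2)\<^sup>2" for x y
    by (simp add: k_def norm_R2_squared add.assoc)
  have kpos: "k x \<ge> 0" for x by (simp add: k_def)
  have "continuous_on UNIV k"
    unfolding k_def by (intro continuous_intros) (auto simp: add_nonneg_eq_0_iff)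
  then have meas: "k \<in> borel_measurable (lborel \<Otimes>\<^sub>M lborel)"
    by (simp add: lborel_prod borel_measurable_continuous_onI)
  have inner: "integrable lborel (\<lambda>y. k (x, y))" "(\<integral>y. k (x, y) \<partial>lborel) = pi / (2 * (1 + x\<^sup>2) * sqrt (1 + x\<^sup>2))" for x
    using integral_inverse_quadratic_squared[OF pos[of x]] by (auto simp: k)
  have "integrable (lborel \<Otimes>\<^sub>M lborel) k"
  proof (rule lborel_pair.Fubini_integrable[OF meas])
    show "integrable lborel (\<lambda>x. LBINT y. norm (k (x, y)))"
      using integral_inverse_three_halves(1) kpos by (simp add: inner(2))
    show "AE x in lborel. integrable lborel (\<lambda>y. k (x, y))" using inner(1) by simp
  qed
  moreover have "(\<integral>x. k x \<partial>(lborel \<Otimes>\<^sub>M lborel)) = pi"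
    unfolding lborel_pair.integral_fst'[OF calculation, symmetric]
    by (simp only: inner(2) integral_inverse_three_halves(2))
  ultimately show "integrable lborel (\<lambda>x::R2. 1 / (1 + (norm x)\<^sup>2)\<^sup>2)"
  "(\<integral>x. 1 / (1 + (norm (x::R2))\<^sup>2)\<^sup>2 \<partial>lborel) = pi"
    by (simp_all add: lborel_prod k_def[abs_def])
qed

lemma integrable_inverse_sqrt:
  fixes R :: real
  assumes R: "R > 0"
  shows "integrable lborel (\<lambda>x. indicator {-R<..<R} x * (1 / sqrt \<bar>x\<bar>))"
proof -
  define f where "f x = indicator {0<..<R} x * (1 / sqrt \<bar>x\<bar>)" for x :: real
  have "set_integrable lborel (einterval (ereal 0) (ereal R)) (\<lambda>x. 1 / sqrt \<bar>x\<bar>)"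
  proof (rule interval_integral_FTC_nonneg(1)[where F = "\<lambda>x. 2 * sqrt x"])
    show "((\<lambda>x. 2 * sqrt x) has_real_derivative 1 / sqrt \<bar>x\<bar>) (at x)" if "ereal 0 < ereal x" for x
      using that by (auto intro!: derivative_eq_intros simp: field_simps)
    show "isCont (\<lambda>x. 1 / sqrt \<bar>x\<bar>) x" if "ereal 0 < ereal x" for x
      using that by (intro continuous_intros) auto
    have "((\<lambda>x. 2 * sqrt x) \<longlongrightarrow> 2 * sqrt 0) (at_right 0)" "((\<lambda>x. 2 * sqrt x) \<longlongrightarrow> 2 * sqrt R) (at_left R)"
      by (intro tendsto_intros)+
    then show "(((\<lambda>x. 2 * sqrt x) \<circ> real_of_ereal) \<longlongrightarrow> 2 * sqrt 0) (at_right (ereal 0))"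
      "(((\<lambda>x. 2 * sqrt x) \<circ> real_of_ereal) \<longlongrightarrow> 2 * sqrt R) (at_left (ereal R))"
      by (simp_all only: ereal_tendsto_simps)
  qed (use R in auto)
  then have f: "integrable lborel f"
    by (simp add: set_integrable_def f_def[abs_def])
  have "integrable lborel (\<lambda>x. f (0 + -1 * x))"
    using lborel_integrable_real_affine[OF f, of "-1" 0] by simp
  from Bochner_Integration.integrable_add[OF f this]
  show ?thesis
    by (rule Bochner_Integration.integrable_cong[THEN iffD1, rotated 2])
      (auto simp: f_def indicator_def)
qed

lemma AE_coords_nonzero: "AE x in lborel. fst x \<noteq> c \<and> snd (x::R2) \<noteq> d"
proof -
  have "AE x in (lborel \<Otimes>\<^sub>M lborel). fst x \<noteq> c \<and> snd (x::R2) \<noteq> d"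
  proof (rule lborel_pair.AE_pair_measure)
    have "closed {x::R2. fst x = c}" "closed {x::R2. snd x = d}"
      by (auto intro!: closed_Collect_eq continuous_intros)
    then have "open (- ({x::R2. fst x = c} \<union> {x::R2. snd x = d}))"
      by (intro open_Compl closed_Un)
    moreover have "- ({x::R2. fst x = c} \<union> {x::R2. snd x = d}) = {x. fst x \<noteq> c \<and> snd x \<noteq> d}" by auto
    ultimately show "{x \<in> space (lborel \<Otimes>\<^sub>M lborel). fst x \<noteq> c \<and> snd x \<noteq> d} \<in> sets (lborel \<Otimes>\<^sub>M lborel)"
      by (simp only: lborel_prod sets_lborel space_lborel space_borel borel_open UNIV_I simp_thms)
    show "AE x in lborel. AE y in lborel. fst (x, y) \<noteq> c \<and> snd (x, y) \<noteq> d"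
    proof -
      have "AE x in lborel. x \<noteq> c" by (rule AE_lborel_singleton)
      then show ?thesis
      proof eventually_elim
        case (elim x)
        have "AE y in lborel. y \<noteq> d" by (rule AE_lborel_singleton)
        then show ?case by eventually_elim (use elim in auto)
      qed
    qed
  qed
  then show ?thesis by (simp only: lborel_prod)
qed

text \<open>With s and t the distances between the coordinates of x and \<open>P\<close>, the
  inequality s t \<le> s^2 + t^2 gives 1 / |x - P| \<le> 1 / sqrt (s t), a product of two locally
  integrable functions of one variable.\<close>

lemma integrable_inverse_norm:
  fixes P :: R2
  assumes R: "R > 0"
  shows "integrable lborel (\<lambda>x. indicator (ball P R) x * (1 / norm (x - P)))"
proof -
  define j where "j t x = indicator {-R<..<R} (x - t) * (1 / sqrt \<bar>x - t\<bar>)" for t x :: real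
  have j: "integrable lborel (j t)" for t
    using lborel_integrable_real_affine[OF integrable_inverse_sqrt[OF R], of 1 "-t"]
    by (simp add: j_def[abs_def])
  have jpos: "j t x \<ge> 0" for t x by (simp add: j_def)
  have [measurable]: "j t \<in> borel_measurable borel" for t using borel_measurable_integrable[OF j[of t]] by simp
  have "integrable (lborel \<Otimes>\<^sub>M lborel) (\<lambda>x. j (fst P) (fst x) * j (snd P) (snd x))"
  proof (rule lborel_pair.Fubini_integrable)
    show "integrable lborel (\<lambda>x. LBINT y. norm (j (fst P) (fst (x, y)) * j (snd P) (snd (x, y))))"
      using j jpos by (simp add: abs_mult)
    show "AE x in lborel. integrable lborel (\<lambda>y. j (fst P) (fst (x, y)) * j (snd P) (snd (x, y)))"
      using j by simp
  qed measurable
  then have int: "integrable lborel (\<lambda>x. j (fst P) (fst x) * j (snd P) (snd x))" by (simp add: lborel_prod)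
  show ?thesis
  proof (rule Bochner_Integration.integrable_bound[OF int])
    \<comment> \<open>The coordinate lines through \<open>P\<close> have to be excluded: there the
      majorant takes the value 0, because 1 / 0 = 0.\<close>
    have "AE x in lborel. fst x \<noteq> fst P \<and> snd x \<noteq> snd P" by (rule AE_coords_nonzero)
    then show "AE x in lborel. norm (indicat_real (ball P R) x * (1 / norm (x - P))) \<le> norm (j (fst P) (fst x) * j (snd P) (snd x))"
    proof eventually_elim
      case (elim x)
      show ?case
      proof (cases "x \<in> ball P R")
        case True
        define s where "s = \<bar>fst x - fst P\<bar>"
        define t where "t = \<bar>snd x - snd P\<bar>"
        have st: "s > 0" "t > 0" using elim by (auto simp: s_def t_def)
        have n: "(norm (x - P))\<^sup>2 = s\<^sup>2 + t\<^sup>2" by (simp add: norm_R2_squared s_def t_def)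
        have "s \<le> norm (x - P)" "t \<le> norm (x - P)"
          by (rule power2_le_imp_le, simp_all add: n)+
        moreover have "norm (x - P) < R" using True by (simp add: dist_norm norm_minus_commute)
        ultimately have "s < R" "t < R" by linarith+
        have "s * t \<le> (norm (x - P))\<^sup>2" using n sum_squares_bound[of s t] mult_pos_pos[OF st]
          by (simp add: mult.assoc)
        then have "sqrt (s * t) \<le> norm (x - P)" by (intro real_le_lsqrt) auto
        then have "1 / norm (x - P) \<le> 1 / sqrt (s * t)"
          using st by (intro frac_le) auto
        moreover have "j (fst P) (fst x) * j (snd P) (snd x) = 1 / sqrt (s * t)"
        proof -
          have "fst x - fst P \<in> {-R<..<R}" "snd x - snd P \<in> {-R<..<R}"
            using \<open>s < R\<close> \<open>t < R\<close> unfolding s_def t_def by auto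
          then show ?thesis by (simp add: j_def s_def t_def real_sqrt_mult)
        qed
        ultimately show ?thesis using True st by (simp add: real_sqrt_ge_zero)
      qed (simp add: jpos)
    qed
    have [measurable]: "(\<lambda>x. norm (x - P)) \<in> borel_measurable borel"
      by (rule borel_measurable_continuous_onI) (intro continuous_intros)
    have [measurable]: "ball P R \<in> sets borel" by simp
    show "(\<lambda>x. indicat_real (ball P R) x * (1 / norm (x - P))) \<in> borel_measurable lborel"
      by measurable
  qed
qed

text \<open>The derivative of the fundamental solution in the direction \<open>a\<close>, as
  \<open>grad_fund_sol\<close> shows. The formula has the value 0 at \<open>P\<close>.\<close>

definition dipole :: "R2 \<Rightarrow> R2 \<Rightarrow> R2 \<Rightarrow> real" where
  "dipole a P x = (a \<bullet> (x - P)) / (2 * pi * (norm (x - P))\<^sup>2)"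

lemma dipole_measurable [measurable]: "dipole a P \<in> borel_measurable borel"
  unfolding dipole_def by measurable

text \<open>Uniform in \<open>q\<close>: the case q = 0 gives local integrability of the dipole, and
  q > 0 the domination needed when the regularization is removed.\<close>

lemma dipole_bound: "\<bar>a \<bullet> (x - P)\<bar> / (2 * pi * ((norm (x - P))\<^sup>2 + q)) \<le> norm a * (1 / norm (x - P))"
  if "q \<ge> 0" for x P :: R2
proof (cases "x = P")
  case False
  define n where "n = norm (x - P)"
  have n: "n > 0" using False by (simp add: n_def)
  have 1: "\<bar>a \<bullet> (x - P)\<bar> \<le> norm a * n" unfolding n_def by (rule Cauchy_Schwarz_ineq2)
  have 2: "2 * pi * (n\<^sup>2 + q) \<ge> n\<^sup>2"
  proof -
    have "1 * (n\<^sup>2 + q) \<le> 2 * pi * (n\<^sup>2 + q)"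
      using that pi_gt3 by (intro mult_right_mono) auto
    then show ?thesis using that by simp
  qed
  have "\<bar>a \<bullet> (x - P)\<bar> / (2 * pi * (n\<^sup>2 + q)) \<le> (norm a * n) / n\<^sup>2"
    using 1 2 n by (intro frac_le) auto
  then show ?thesis using n by (simp add: n_def power2_eq_square)
qed simp

lemma dipole_locally_integrable: "locally_integrable (dipole a P) S"
  unfolding locally_integrable_def
proof (intro allI impI)
  fix K :: "R2 set" assume K: "compact K \<and> K \<subseteq> S"
  obtain R where R: "R > 0" "K \<subseteq> ball P R"
    using compact_imp_bounded[of K] K bounded_subset_ballD by blast
  have int: "integrable lborel (\<lambda>x. norm a * (indicat_real (ball P R) x * (1 / norm (x - P))))"
    by (intro integrable_mult_right integrable_inverse_norm R)
  show "set_integrable lborel K (dipole a P)"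
    unfolding set_integrable_def
  proof (rule Bochner_Integration.integrable_bound[OF int])
    show "AE x in lborel. norm (indicat_real K x *\<^sub>R dipole a P x) \<le> norm (norm a * (indicat_real (ball P R) x * (1 / norm (x - P))))"
      using dipole_bound[of 0 a _ P] R by (intro AE_I2) (auto simp: indicator_def dipole_def abs_mult)
    have [measurable]: "K \<in> sets borel" using K by (simp add: compact_imp_closed borel_closed)
    show "(\<lambda>x. indicat_real K x *\<^sub>R dipole a P x) \<in> borel_measurable lborel" by measurable
  qed
qed

lemma Ck_on_norm_squared: "Ck_on k (\<lambda>x::R2. (x - P) \<bullet> (x - P) + q) UNIV"
proof -
  have "(\<lambda>x::R2. (x - P) \<bullet> (x - P) + q) = (\<lambda>x. (\<Sum>b\<in>Basis. (x \<bullet> b - P \<bullet> b) * (x \<bullet> b - P \<bullet> b)) + q)"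
    by (rule ext, subst euclidean_inner) (simp add: inner_diff_left)
  then show ?thesis by (auto intro!: Ck_on_add Ck_on_sum Ck_on_mult Ck_on_diff)
qed

lemma GDERIV_norm_squared: "GDERIV (\<lambda>x::R2. (x - P) \<bullet> (x - P) + q) x :> 2 *\<^sub>R (x - P)"
  unfolding gderiv_def by (auto intro!: derivative_eq_intros simp: inner_commute algebra_simps)

lemma GDERIV_inner_diff: "GDERIV (\<lambda>x::R2. b \<bullet> (x - P)) x :> b"
  unfolding gderiv_def by (auto intro!: derivative_eq_intros simp: inner_commute)

lemma Ck_on_inner_diff: "Ck_on k (\<lambda>x::R2. b \<bullet> (x - P)) UNIV"
proof -
  have "(\<lambda>x::R2. b \<bullet> (x - P)) = (\<lambda>x. x \<bullet> b - P \<bullet> b)" by (auto simp: inner_commute inner_diff_right)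
  then show ?thesis by (auto intro: Ck_on_diff)
qed

context
  fixes a P :: R2 and q :: real
  assumes q: "q > 0"
begin

definition rinv :: "R2 \<Rightarrow> real" where "rinv x = inverse ((x - P) \<bullet> (x - P) + q)"

text \<open>This is 2\<pi> times the dipole potential with the squared distance in the denominator
  increased by \<open>q\<close>. It is smooth, and its derivatives are polynomials in
  \<open>rinv\<close> and the coordinates.\<close>

definition rdip :: "R2 \<Rightarrow> real" where "rdip x = (a \<bullet> (x - P)) * rinv x"

lemma rden_pos: "(x - P) \<bullet> (x - P) + q > 0"
  using q by (auto intro: add_nonneg_pos)

lemma Ck_on_rinv: "Ck_on k rinv UNIV"
  unfolding rinv_def[abs_def]
  by (rule Ck_on_compose[OF open_UNIV, of "{0<..}" _ _ inverse])
    (auto intro: Ck_on_inverse Ck_on_norm_squared rden_pos)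

lemma GDERIV_rinv: "GDERIV rinv x :> (- 2 * (rinv x)\<^sup>2) *\<^sub>R (x - P)"
  unfolding rinv_def[abs_def]
  by (rule GDERIV_subst[OF GDERIV_inverse[OF GDERIV_norm_squared]]) (use rden_pos[of x] in auto)

lemma Ck_on_rdip: "Ck_on k rdip UNIV"
  unfolding rdip_def[abs_def] by (intro Ck_on_mult Ck_on_inner_diff Ck_on_rinv) auto

lemma grad_rdip: "grad rdip x = rinv x *\<^sub>R a - (2 * (a \<bullet> (x - P)) * (rinv x)\<^sup>2) *\<^sub>R (x - P)"
  unfolding rdip_def[abs_def]
  by (rule grad_eq, rule GDERIV_subst[OF GDERIV_mult[OF GDERIV_inner_diff GDERIV_rinv]]) simp

lemma grad_grad_rdip:
  "b \<bullet> grad (\<lambda>y. b \<bullet> grad rdip y) x =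
     - 2 * (a \<bullet> b) * (rinv x)\<^sup>2 * (b \<bullet> (x - P)) - 2 * (b \<bullet> a) * (rinv x)\<^sup>2 * (b \<bullet> (x - P))
     - 2 * (b \<bullet> b) * (a \<bullet> (x - P)) * (rinv x)\<^sup>2
     + 8 * (a \<bullet> (x - P)) * (b \<bullet> (x - P))\<^sup>2 * (rinv x) ^ 3"
proof -
  have "(\<lambda>y. b \<bullet> grad rdip y) = (\<lambda>y. rinv y * (b \<bullet> a) - 2 * ((a \<bullet> (y - P)) * (b \<bullet> (y - P))) * (rinv y * rinv y))"
    by (simp add: grad_rdip inner_diff_right power2_eq_square algebra_simps)
  moreover have "GDERIV (\<lambda>y. rinv y * (b \<bullet> a) - 2 * ((a \<bullet> (y - P)) * (b \<bullet> (y - P))) * (rinv y * rinv y)) x :>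
     (rinv x *\<^sub>R 0 + (b \<bullet> a) *\<^sub>R ((- 2 * (rinv x)\<^sup>2) *\<^sub>R (x - P))) -
     ((2 * ((a \<bullet> (x - P)) * (b \<bullet> (x - P)))) *\<^sub>R (rinv x *\<^sub>R ((- 2 * (rinv x)\<^sup>2) *\<^sub>R (x - P)) + rinv x *\<^sub>R ((- 2 * (rinv x)\<^sup>2) *\<^sub>R (x - P)))
      + (rinv x * rinv x) *\<^sub>R (2 *\<^sub>R ((a \<bullet> (x - P)) *\<^sub>R b + (b \<bullet> (x - P)) *\<^sub>R a) + ((a \<bullet> (x - P)) * (b \<bullet> (x - P))) *\<^sub>R 0))"
    by (intro GDERIV_diff GDERIV_mult GDERIV_rinv GDERIV_inner_diff GDERIV_const)
  ultimately show ?thesis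
    by (simp add: grad_eq inner_diff_right inner_add_right)
      (simp add: power2_eq_square power3_eq_cube inner_commute algebra_simps)
qed

text \<open>In dimension 2 the quadratic terms in \<open>rinv\<close> have total coefficient -8 and
  combine with the cubic one to a multiple of 1 - s rinv = q rinv. Hence the factor
  \<open>q\<close>, and harmonicity away from \<open>P\<close> in the limit.\<close>

lemma laplacian_rdip: "laplacian rdip x = - 8 * q * (a \<bullet> (x - P)) * (rinv x) ^ 3"
proof -
  define s where "s = (x - P) \<bullet> (x - P)"
  have sb: "(\<Sum>b\<in>Basis. (b \<bullet> (x - P))\<^sup>2) = s"
    unfolding s_def by (subst euclidean_inner) (simp add: power2_eq_square inner_commute)
  have ab: "(\<Sum>b\<in>Basis. (a \<bullet> b) * (b \<bullet> (x - P))) = a \<bullet> (x - P)"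
    by (subst euclidean_inner) (simp add: inner_commute)
  have bb: "(\<Sum>b\<in>(Basis::R2 set). b \<bullet> b) = 2" by simp
  have ri: "rinv x * (s + q) = 1" using rden_pos[of x] by (simp add: rinv_def s_def)
  have "laplacian rdip x = - 4 * (rinv x)\<^sup>2 * (\<Sum>b\<in>Basis. (a \<bullet> b) * (b \<bullet> (x - P)))
      - 2 * (a \<bullet> (x - P)) * (rinv x)\<^sup>2 * (\<Sum>b\<in>(Basis::R2 set). b \<bullet> b)
      + 8 * (a \<bullet> (x - P)) * (rinv x) ^ 3 * (\<Sum>b\<in>Basis. (b \<bullet> (x - P))\<^sup>2)"
    unfolding laplacian_def grad_grad_rdip sum_distrib_left sum_subtractf[symmetric] sum.distrib[symmetric]
    by (rule sum.cong) (auto simp: inner_commute algebra_simps)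
  also have "\<dots> = - 8 * (a \<bullet> (x - P)) * (rinv x)\<^sup>2 * (1 - rinv x * s)"
    unfolding sb ab bb by (simp add: power2_eq_square power3_eq_cube algebra_simps)
  also have "1 - rinv x * s = rinv x * q" using ri by (simp add: algebra_simps)
  finally show ?thesis by (simp add: power2_eq_square power3_eq_cube algebra_simps)
qed

text \<open>The right-hand side is the regularization of \<open>- 2\<pi> (a \<cdot> \<nabla>\<phi>)(P)\<close>: the weight
  \<open>2q / (|x - P|\<^sup>2 + q)\<^sup>2\<close> is the Laplacian of \<open>(1/2) log (|x - P|\<^sup>2 + q)\<close>.\<close>

lemma integral_rdip_laplacian:
  assumes \<phi>: "\<phi> \<in> test_functions UNIV"
  shows "(\<integral>x. rdip x * laplacian \<phi> x \<partial>lborel) = - (\<integral>x. 2 * q * (rinv x)\<^sup>2 * (a \<bullet> grad \<phi> x) \<partial>lborel)"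
    and "integrable lborel (\<lambda>x. 2 * q * (rinv x)\<^sup>2 * (a \<bullet> grad \<phi> x))"
proof -
  define K where "K = closure {x. \<phi> x \<noteq> 0}"
  note tf = test_functions_props[OF \<phi>, folded K_def]
  obtain R where R: "K \<subseteq> ball 0 R" using tf(1) compact_imp_bounded bounded_subset_ballD by blast
  have out: "x \<notin> K" if "norm x \<ge> R" for x
  proof -
    have "x \<notin> ball 0 R" using that by simp
    then show ?thesis using R by blast
  qed
  \<comment> \<open>\<open>laplacian rdip\<close> is \<open>2 * q\<close> times the derivative of
    the square of \<open>rinv\<close> in the direction \<open>a\<close>; integrating the derivative
    of the product \<open>F\<close> moves it onto \<phi>.\<close>
  define F where "F x = \<phi> x * (rinv x * rinv x)" for x
  have "Ck_on (Suc 0) F UNIV"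
    unfolding F_def[abs_def] by (intro Ck_on_mult tf(3) Ck_on_rinv) auto
  note C = GDERIV_field_continuous[OF this]
  have gF: "grad F x = \<phi> x *\<^sub>R (rinv x *\<^sub>R ((- 2 * (rinv x)\<^sup>2) *\<^sub>R (x - P)) + rinv x *\<^sub>R ((- 2 * (rinv x)\<^sup>2) *\<^sub>R (x - P)))
     + (rinv x * rinv x) *\<^sub>R grad \<phi> x" for x
    unfolding F_def[abs_def]
    by (rule grad_eq, intro GDERIV_mult GDERIV_rinv GDERIV_grad) (use tf(3)[of "Suc 0"] in \<open>simp del: split_paired_All\<close>)
  have "F x = 0" if "norm x \<ge> R" for x using out[OF that] tf(5) by (simp add: F_def)
  note I = integral_directional_derivative_zero[OF C this]
  have g\<phi>: "continuous_on UNIV (grad \<phi>)" using GDERIV_field_continuous[OF tf(3)[of "Suc 0"]] by simp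
  have rc: "continuous_on UNIV rinv" using Ck_on_rinv Ck_on_imp_continuous_on by blast
  show i1: "integrable lborel (\<lambda>x. 2 * q * (rinv x)\<^sup>2 * (a \<bullet> grad \<phi> x))"
    by (rule integrable_if_continuous_bounded_support[of _ R])
      (use out tf(6) in \<open>auto intro!: continuous_intros g\<phi> rc\<close>)
  have i2: "integrable lborel (\<lambda>x. \<phi> x * laplacian rdip x)"
    by (rule integrable_if_continuous_bounded_support[of _ R])
      (use out tf(5) Ck_on_imp_continuous_on[OF tf(3)[of 0]] in \<open>auto intro!: continuous_intros rc simp: laplacian_rdip\<close>)
  have "2 * q * (a \<bullet> grad F x) = \<phi> x * laplacian rdip x + 2 * q * (rinv x)\<^sup>2 * (a \<bullet> grad \<phi> x)" for x
    by (simp add: gF laplacian_rdip inner_add_right) (simp add: power2_eq_square power3_eq_cube algebra_simps)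
  then have "(\<integral>x. \<phi> x * laplacian rdip x + 2 * q * (rinv x)\<^sup>2 * (a \<bullet> grad \<phi> x) \<partial>lborel) = (\<integral>x. 2 * q * (a \<bullet> grad F x) \<partial>lborel)"
    by simp
  also have "\<dots> = 0" using I(2) by simp
  finally have "(\<integral>x. \<phi> x * laplacian rdip x \<partial>lborel) = - (\<integral>x. 2 * q * (rinv x)\<^sup>2 * (a \<bullet> grad \<phi> x) \<partial>lborel)"
    using i1 i2 by simp
  then show "(\<integral>x. rdip x * laplacian \<phi> x \<partial>lborel) = - (\<integral>x. 2 * q * (rinv x)\<^sup>2 * (a \<bullet> grad \<phi> x) \<partial>lborel)"
    using Green_identity(2)[OF open_UNIV Ck_on_rdip \<phi>] by (simp add: set_lebesgue_integral_def)
qed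

end


lemma rdip_tendsto:
  assumes "q \<longlonglongrightarrow> 0" "\<And>n. q n > 0"
  shows "(\<lambda>n. rdip a P (q n) x) \<longlonglongrightarrow> 2 * pi * dipole a P x"
proof (cases "x = P")
  case True
  then show ?thesis using assms by (simp add: rdip_def dipole_def)
next
  case False
  have "(\<lambda>n. (a \<bullet> (x - P)) * inverse ((x - P) \<bullet> (x - P) + q n)) \<longlonglongrightarrow> (a \<bullet> (x - P)) * inverse ((x - P) \<bullet> (x - P) + 0)"
    using False assms(1) by (intro tendsto_intros) auto
  moreover have "(a \<bullet> (x - P)) * inverse ((x - P) \<bullet> (x - P) + 0) = 2 * pi * dipole a P x"
    proof -
    have "t * inverse (n + 0) = 2 * pi * (t / (2 * pi * n))" for t n :: real
      by (cases "n = 0") (auto simp: field_simps)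
    then show ?thesis unfolding dipole_def dot_square_norm .
  qed
  ultimately show ?thesis using assms by (simp add: rdip_def rinv_def)
qed

text \<open>The identity for the regularized dipole passes to the limit q -> 0. On the left the
  majorant is a multiple of 1 / |x - P|. On the right the substitution x = P + sqrt q y turns the
  weight into the fixed kernel 2 / (1 + |y|^2)^2 of mass 2\<pi>, while the gradient of \<phi> tends
  to its value at \<open>P\<close>.\<close>

theorem dipole_distr: "distr_laplace_eq S (dipole a P) (distr_deriv a (dirac P))"
proof -
  have "(LINT x:S|lborel. dipole a P x * laplacian \<phi> x) = - (a \<bullet> grad \<phi> P)" if "\<phi> \<in> test_functions S" for \<phi>
  proof -
    define K where "K = closure {x. \<phi> x \<noteq> 0}"
    note tf = test_functions_props[OF that, folded K_def]
    have \<phi>: "\<phi> \<in> test_functions UNIV" using that by (auto simp: test_functions_def)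
    obtain R where R: "R > 0" "K \<subseteq> ball P R"
      using compact_imp_bounded[OF tf(1)] bounded_subset_ballD by blast
    \<comment> \<open>A square, so that the scale sqrt q of the substitution is 1 / (n + 1).\<close>
    define q where "q n = (1 / real (Suc n))\<^sup>2" for n
    have q: "q n > 0" for n by (simp add: q_def)
    have c0: "(\<lambda>n. 1 / real (Suc n)) \<longlonglongrightarrow> 0" by (rule LIMSEQ_Suc[OF lim_1_over_n])
    then have q0: "q \<longlonglongrightarrow> 0" unfolding q_def using tendsto_power[OF c0, of 2] by simp
    have lc: "continuous_on UNIV (laplacian \<phi>)"
      using Ck_on_laplacian[OF open_UNIV, of 0 \<phi>] tf(3)[of "Suc (Suc 0)"] by (simp only: Ck_on.simps(1))
    have gc: "continuous_on UNIV (grad \<phi>)" using GDERIV_field_continuous(2)[OF tf(3)[of "Suc 0"]] .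
    note [measurable] = borel_measurable_continuous_onI[OF lc] borel_measurable_continuous_onI[OF gc]
    have "bounded (laplacian \<phi> ` K)" "bounded (grad \<phi> ` K)"
      using compact_imp_bounded[OF compact_continuous_image[OF continuous_on_subset[OF lc subset_UNIV] tf(1)]]
        compact_imp_bounded[OF compact_continuous_image[OF continuous_on_subset[OF gc subset_UNIV] tf(1)]] by auto
    then obtain B1 B2 where B1: "\<And>x. x \<in> K \<Longrightarrow> \<bar>laplacian \<phi> x\<bar> \<le> B1" and B2: "\<And>x. x \<in> K \<Longrightarrow> norm (grad \<phi> x) \<le> B2"
      unfolding bounded_iff by (metis imageI real_norm_def)
    have B2': "norm (grad \<phi> x) \<le> \<bar>B2\<bar>" for x using B2[of x] tf(6)[of x] by (cases "x \<in> K") auto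
    have rc: "continuous_on UNIV (rdip a P (q n))" for n
      using Ck_on_rdip[OF q] Ck_on_imp_continuous_on by blast
    note [measurable] = borel_measurable_continuous_onI[OF rc]
    have L: "(\<lambda>n. \<integral>x. rdip a P (q n) x * laplacian \<phi> x \<partial>lborel) \<longlonglongrightarrow> (\<integral>x. (2 * pi * dipole a P x) * laplacian \<phi> x \<partial>lborel)"
    proof (rule integral_dominated_convergence)
      show "integrable lborel (\<lambda>x. (2 * pi * norm a * \<bar>B1\<bar>) * (indicat_real (ball P R) x * (1 / norm (x - P))))"
        by (intro integrable_mult_right integrable_inverse_norm R)
      show "AE x in lborel. (\<lambda>n. rdip a P (q n) x * laplacian \<phi> x) \<longlonglongrightarrow> 2 * pi * dipole a P x * laplacian \<phi> x"
        using rdip_tendsto[OF q0 q] by (intro AE_I2 tendsto_mult tendsto_const)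
      show "AE x in lborel. norm (rdip a P (q n) x * laplacian \<phi> x) \<le> 2 * pi * norm a * \<bar>B1\<bar> * (indicat_real (ball P R) x * (1 / norm (x - P)))" for n
      proof (rule AE_I2)
        fix x :: R2
        show "norm (rdip a P (q n) x * laplacian \<phi> x) \<le> 2 * pi * norm a * \<bar>B1\<bar> * (indicat_real (ball P R) x * (1 / norm (x - P)))"
        proof (cases "x \<in> K")
          case True
          have "\<bar>rdip a P (q n) x\<bar> = 2 * pi * (\<bar>a \<bullet> (x - P)\<bar> / (2 * pi * ((norm (x - P))\<^sup>2 + q n)))"
            proof -
            have "\<bar>t * inverse m\<bar> = 2 * pi * (\<bar>t\<bar> / (2 * pi * m))" if "m > 0" for t m :: real
              using that by (simp add: field_simps)
            from this[OF rden_pos[OF q[of n], of x P]] show ?thesis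
              unfolding rdip_def[OF q] rinv_def[OF q] dot_square_norm .
          qed
          also have "\<dots> \<le> 2 * pi * (norm a * (1 / norm (x - P)))"
            using dipole_bound[of "q n" a x P] q[of n] by (intro mult_left_mono) auto
          finally have "\<bar>rdip a P (q n) x\<bar> * \<bar>laplacian \<phi> x\<bar> \<le> 2 * pi * (norm a * (1 / norm (x - P))) * \<bar>B1\<bar>"
            using B1[OF True] by (intro mult_mono) auto
          moreover have "indicat_real (ball P R) x = 1" using True R(2) by (auto simp: indicator_def)
          ultimately show ?thesis by (simp only: real_norm_def abs_mult mult_1 mult.assoc mult.commute mult.left_commute)
        next
          case False
          then show ?thesis using tf(7)[OF False] by simp
        qed
      qed
    qed measurable
    have Rr: "(\<integral>x. 2 * q n * (rinv P (q n) x)\<^sup>2 * (a \<bullet> grad \<phi> x) \<partial>lborel)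
       = (\<integral>y. 2 * (1 / (1 + (norm y)\<^sup>2)\<^sup>2) * (a \<bullet> grad \<phi> (P + (1 / real (Suc n)) *\<^sub>R y)) \<partial>lborel)" for n
    proof -
      define c where "c = 1 / real (Suc n)"
      have c: "c > 0" "q n = c\<^sup>2" by (simp_all add: c_def q_def)
      have "continuous_on UNIV (rinv P (q n))" using Ck_on_rinv[OF q] Ck_on_imp_continuous_on by blast
      note [measurable] = borel_measurable_continuous_onI[OF this]
      have "(\<integral>x. 2 * q n * (rinv P (q n) x)\<^sup>2 * (a \<bullet> grad \<phi> x) \<partial>lborel)
        = (\<integral>y. c\<^sup>2 * (2 * q n * (rinv P (q n) (P + c *\<^sub>R y))\<^sup>2 * (a \<bullet> grad \<phi> (P + c *\<^sub>R y))) \<partial>lborel)"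
        by (rule integral_lborel_affine) (use c in measurable)
      also have "\<dots> = (\<integral>y. 2 * (1 / (1 + (norm y)\<^sup>2)\<^sup>2) * (a \<bullet> grad \<phi> (P + c *\<^sub>R y)) \<partial>lborel)"
      proof (rule Bochner_Integration.integral_cong[OF refl])
        fix y :: R2
        have "rinv P (q n) (P + c *\<^sub>R y) = inverse (c\<^sup>2 * (1 + (norm y)\<^sup>2))"
          unfolding rinv_def[OF q] unfolding c(2) by (simp add: dot_square_norm power_mult_distrib algebra_simps)
        then have "c\<^sup>2 * (2 * q n * (rinv P (q n) (P + c *\<^sub>R y))\<^sup>2) = 2 * (1 / (1 + (norm y)\<^sup>2)\<^sup>2)"
        proof -
          have "c\<^sup>2 * (2 * c\<^sup>2 * (inverse (c\<^sup>2 * w))\<^sup>2) = 2 * (1 / w\<^sup>2)" if "w > 0" for w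
            using c(1) that by (simp add: field_simps power2_eq_square)
          from this[of "1 + (norm y)\<^sup>2"] show ?thesis
            using \<open>rinv P (q n) (P + c *\<^sub>R y) = _\<close> unfolding c(2) by (simp add: add_pos_nonneg)
        qed
        then show "c\<^sup>2 * (2 * q n * (rinv P (q n) (P + c *\<^sub>R y))\<^sup>2 * (a \<bullet> grad \<phi> (P + c *\<^sub>R y)))
           = 2 * (1 / (1 + (norm y)\<^sup>2)\<^sup>2) * (a \<bullet> grad \<phi> (P + c *\<^sub>R y))"
          by (simp only: mult.assoc[symmetric])
      qed
      finally show ?thesis by (simp add: c_def)
    qed
    have "(\<lambda>n. \<integral>y. 2 * (1 / (1 + (norm y)\<^sup>2)\<^sup>2) * (a \<bullet> grad \<phi> (P + (1 / real (Suc n)) *\<^sub>R y)) \<partial>lborel)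
       \<longlonglongrightarrow> (\<integral>y. 2 * (1 / (1 + (norm (y::R2))\<^sup>2)\<^sup>2) * (a \<bullet> grad \<phi> P) \<partial>lborel)"
    proof (rule integral_dominated_convergence)
      show "integrable lborel (\<lambda>y::R2. (2 * norm a * \<bar>B2\<bar>) * (1 / (1 + (norm y)\<^sup>2)\<^sup>2))"
        by (intro integrable_mult_right integral_plane_kernel)
      show "AE y in lborel. (\<lambda>n. 2 * (1 / (1 + (norm y)\<^sup>2)\<^sup>2) * (a \<bullet> grad \<phi> (P + (1 / real (Suc n)) *\<^sub>R y)))
          \<longlonglongrightarrow> 2 * (1 / (1 + (norm y)\<^sup>2)\<^sup>2) * (a \<bullet> grad \<phi> P)"
      proof (rule AE_I2)
        fix y :: R2
        have "(\<lambda>n. P + (1 / real (Suc n)) *\<^sub>R y) \<longlonglongrightarrow> P + 0 *\<^sub>R y" by (intro tendsto_intros c0)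
        then have "(\<lambda>n. P + (1 / real (Suc n)) *\<^sub>R y) \<longlonglongrightarrow> P" by simp
        moreover have "isCont (grad \<phi>) P"
          using gc by (simp add: continuous_on_eq_continuous_at del: split_paired_All)
        ultimately have "(\<lambda>n. grad \<phi> (P + (1 / real (Suc n)) *\<^sub>R y)) \<longlonglongrightarrow> grad \<phi> P"
          by (rule isCont_tendsto_compose[rotated])
        then show "(\<lambda>n. 2 * (1 / (1 + (norm y)\<^sup>2)\<^sup>2) * (a \<bullet> grad \<phi> (P + (1 / real (Suc n)) *\<^sub>R y)))
          \<longlonglongrightarrow> 2 * (1 / (1 + (norm y)\<^sup>2)\<^sup>2) * (a \<bullet> grad \<phi> P)"
          by (intro tendsto_intros)
      qed
      show "AE y in lborel. norm (2 * (1 / (1 + (norm y)\<^sup>2)\<^sup>2) * (a \<bullet> grad \<phi> (P + (1 / real (Suc n)) *\<^sub>R y)))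
          \<le> 2 * norm a * \<bar>B2\<bar> * (1 / (1 + (norm y)\<^sup>2)\<^sup>2)" for n
      proof (rule AE_I2)
        fix y :: R2
        have "\<bar>a \<bullet> grad \<phi> (P + (1 / real (Suc n)) *\<^sub>R y)\<bar> \<le> norm a * \<bar>B2\<bar>"
          by (rule order_trans[OF Cauchy_Schwarz_ineq2 mult_left_mono[OF B2']]) simp
        then have "2 * (1 / (1 + (norm y)\<^sup>2)\<^sup>2) * \<bar>a \<bullet> grad \<phi> (P + (1 / real (Suc n)) *\<^sub>R y)\<bar> \<le> 2 * (1 / (1 + (norm y)\<^sup>2)\<^sup>2) * (norm a * \<bar>B2\<bar>)"
          by (intro mult_left_mono) auto
        then show "norm (2 * (1 / (1 + (norm y)\<^sup>2)\<^sup>2) * (a \<bullet> grad \<phi> (P + (1 / real (Suc n)) *\<^sub>R y)))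
          \<le> 2 * norm a * \<bar>B2\<bar> * (1 / (1 + (norm y)\<^sup>2)\<^sup>2)"
          by (simp add: abs_mult mult_ac)
      qed
    qed measurable
    also have "(\<integral>y. 2 * (1 / (1 + (norm (y::R2))\<^sup>2)\<^sup>2) * (a \<bullet> grad \<phi> P) \<partial>lborel) = 2 * pi * (a \<bullet> grad \<phi> P)"
      by (simp only: integral_mult_left_zero integral_mult_right_zero integral_plane_kernel(2))
    finally have "(\<lambda>n. \<integral>x. rdip a P (q n) x * laplacian \<phi> x \<partial>lborel) \<longlonglongrightarrow> - (2 * pi * (a \<bullet> grad \<phi> P))"
      unfolding integral_rdip_laplacian(1)[OF q \<phi>] Rr by (rule tendsto_minus)
    from LIMSEQ_unique[OF L this]
    have "pi * ((\<integral>x. dipole a P x * laplacian \<phi> x \<partial>lborel) + (a \<bullet> grad \<phi> P)) = 0"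
      by (simp add: mult.assoc distrib_left)
    then have "(\<integral>x. dipole a P x * laplacian \<phi> x \<partial>lborel) = - (a \<bullet> grad \<phi> P)"
      by simp
    moreover have "(\<lambda>x. indicator S x *\<^sub>R (dipole a P x * laplacian \<phi> x)) = (\<lambda>x. dipole a P x * laplacian \<phi> x)"
      using tf(2,7) by (auto simp: fun_eq_iff indicator_def)
    ultimately show ?thesis by (simp add: set_lebesgue_integral_def)
  qed
  then show ?thesis
    using dipole_locally_integrable by (simp add: distr_laplace_eq_def distr_deriv_def dirac_def)
qed

section \<open>Mean value property\<close>

lemma antiderivative_vanishing_left:
  fixes f :: "real \<Rightarrow> real"
  assumes f: "continuous_on UNIV f" and c: "c > 0" and f0: "\<And>x. x \<le> c \<Longrightarrow> f x = 0"
  obtains g where "\<And>x. (g has_real_derivative f x) (at x)" "\<And>x. x \<le> c \<Longrightarrow> g x = 0"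
proof
  \<comment> \<open>For x < 0 the interval is empty and \<open>g x\<close> is 0, which is correct
    because \<open>f\<close> vanishes up to c > 0.\<close>
  define g where "g x = integral {0..x} f" for x
  show g0: "g x = 0" if "x \<le> c" for x
  proof -
    have "integral {0..x} f = integral {0..x} (\<lambda>_. 0)"
      by (rule Henstock_Kurzweil_Integration.integral_cong) (use that f0 in auto)
    then show ?thesis by (simp add: g_def)
  qed
  show "(g has_real_derivative f x) (at x)" for x
  proof (cases "x < c")
    case True
    have "((\<lambda>_. 0) has_real_derivative f x) (at x)" using f0[of x] True by simp
    then show ?thesis
      by (rule has_field_derivative_transform_within_open[of _ _ _ "{..<c}"]) (use True g0 in auto)
  next
    case False
    then have x: "x > 0" using c by simp
    have "((\<lambda>x. integral {0..x} f) has_real_derivative f x) (at x within {0..x+1})"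
      by (rule integral_has_real_derivative) (use f x in \<open>auto intro: continuous_on_subset\<close>)
    moreover have "at x within {0..x+1} = at x"
      by (rule at_within_interior) (use x in auto)
    ultimately show ?thesis by (simp add: g_def[abs_def])
  qed
qed

text \<open>To be applied to squared distances, so that 1/4 < s < 1 corresponds to the annulus of
  radii 1/2 and 1. Vanishing near 0 is inherited by the antiderivatives and makes a division by s
  harmless.\<close>

definition bump :: "real \<Rightarrow> real" where "bump s = flat 0 (s - 1/4) * flat 0 (1 - s)"

lemma Ck_on_bump: "Ck_on k bump UNIV"
proof -
  have "Ck_on k (\<lambda>s. flat 0 (s - 1/4)) UNIV"
    by (rule Ck_on_compose[OF open_UNIV open_UNIV _ Ck_on_flat])
      (use Ck_on_diff[OF open_UNIV Ck_on_inner[of k "1::real"] Ck_on_const[of k "1/4"]] in auto)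
  moreover have "Ck_on k (\<lambda>s. flat 0 (1 - s)) UNIV"
    by (rule Ck_on_compose[OF open_UNIV open_UNIV _ Ck_on_flat])
      (use Ck_on_diff[OF open_UNIV Ck_on_const[of k "1"] Ck_on_inner[of k "1::real"]] in auto)
  ultimately show ?thesis unfolding bump_def[abs_def] by (intro Ck_on_mult) auto
qed

lemma bump_props: "bump s \<ge> 0" "s \<le> 1/4 \<Longrightarrow> bump s = 0" "s \<ge> 1 \<Longrightarrow> bump s = 0" "1/4 < s \<Longrightarrow> s < 1 \<Longrightarrow> bump s > 0"
  by (auto simp: bump_def flat_def)

lemma bump_continuous: "continuous_on UNIV bump"
  using Ck_on_bump[of 0] by simp

lemma bump_le_1: "bump s \<le> 1"
proof -
  have "flat 0 t \<le> 1" "flat 0 t \<ge> 0" for t by (auto simp: flat_def)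
  then show ?thesis unfolding bump_def using mult_le_one by blast
qed

text \<open>The equation for \<open>n = N'\<close> says that \<open>N(|y|\<^sup>2)\<close> has Laplacian \<open>4 bump(|y|\<^sup>2)\<close> in the plane.\<close>

lemma smoothed_log:
  obtains N n n' :: "real \<Rightarrow> real" and m where
    "\<And>k. Ck_on k N UNIV"
    "\<And>s. (N has_real_derivative n s) (at s)" "\<And>s. (n has_real_derivative n' s) (at s)"
    "\<And>s. n s + s * n' s = bump s" "\<And>s. s \<ge> 1 \<Longrightarrow> N s = N 1 + m * ln s"
proof -
  obtain g where g: "\<And>x. (g has_real_derivative bump x) (at x)" "\<And>x. x \<le> 1/4 \<Longrightarrow> g x = 0"
    using antiderivative_vanishing_left[OF bump_continuous, of "1/4"] bump_props(2) by auto
  have Cg: "Ck_on k g UNIV" for k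
    using Ck_on_Suc_D[OF Ck_on_Suc_real[OF open_UNIV g(1) Ck_on_bump]] .
  \<comment> \<open>The equation n + s n' = bump says (s n)' = bump, hence s n = g. For s \<ge> 1
    the function g is constant and n is a multiple of 1 / s, the source of the logarithm.\<close>
  define n where "n s = g s * inverse s" for s
  have n0: "n s = 0" if "s \<le> 1/4" for s using g(2) that by (simp add: n_def)
  have Cn: "Ck_on k n UNIV" for k
  proof (rule Ck_on_local)
    fix x :: real
    show "\<exists>T. open T \<and> x \<in> T \<and> Ck_on k n T"
    proof (cases "x < 1/4")
      case True
      have "Ck_on k n {..<1/4}"
        by (rule Ck_on_cong[of _ "\<lambda>_. 0"]) (use n0 in auto)
      then show ?thesis using True by (intro exI[of _ "{..<1/4}"]) auto
    next
      case False
      have "Ck_on k n {0<..}"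
        unfolding n_def[abs_def]
        by (intro Ck_on_mult Ck_on_inverse Ck_on_subset[OF Cg]) auto
      then show ?thesis using False by (intro exI[of _ "{0<..}"]) auto
    qed
  qed
  have "continuous_on UNIV n" using Cn[of 0] by simp
  then obtain N where N: "\<And>x. (N has_real_derivative n x) (at x)"
    using antiderivative_vanishing_left[of n "1/4"] n0 by (metis zero_less_divide_1_iff zero_less_numeral)
  have CN: "Ck_on k N UNIV" for k
    using Ck_on_Suc_D[OF Ck_on_Suc_real[OF open_UNIV N Cn]] .
  have dn: "(n has_real_derivative grad n s) (at s)" for s
    using GDERIV_grad[of n s] Cn[of "Suc 0"] by simp
  have gs: "s * n s = g s" for s
    using g(2)[of s] by (cases "s = 0") (auto simp: n_def)
  have e: "n s + s * grad n s = bump s" for s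
  proof -
    have "((\<lambda>s. s * n s) has_real_derivative 1 * n s + grad n s * s) (at s)"
      by (rule DERIV_mult[OF DERIV_ident dn])
    moreover have "(\<lambda>s. s * n s) = g" using gs by auto
    ultimately show ?thesis using DERIV_unique g(1)[of s] by (fastforce simp: mult.commute)
  qed
  have gm: "g s = g 1" if "s \<ge> 1" for s
  proof (cases "s = 1")
    case False
    show ?thesis
      by (rule DERIV_isconst2[of 1 s g s])
        (use False that g(1) bump_props(3) in \<open>auto intro!: DERIV_continuous_on intro: has_field_derivative_at_within, metis less_imp_le\<close>)
  qed simp
  have "N s = N 1 + g 1 * ln s" if "s \<ge> 1" for s
  proof (cases "s = 1")
    case False
    have d: "((\<lambda>s. N s - g 1 * ln s) has_real_derivative 0) (at x)" if "x \<ge> 1" for x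
    proof -
      have "((\<lambda>s. N s - g 1 * ln s) has_real_derivative n x - g 1 * (1 / x)) (at x)"
        by (intro DERIV_diff N DERIV_cmult DERIV_ln_divide) (use that in auto)
      then show ?thesis using gm[OF that] by (simp add: n_def divide_inverse)
    qed
    have "N s - g 1 * ln s = N 1 - g 1 * ln 1"
    proof (rule DERIV_isconst2[of 1 s _ s])
      show "continuous_on {1..s} (\<lambda>s. N s - g 1 * ln s)"
        by (rule DERIV_continuous_on[of _ _ "\<lambda>_. 0"]) (use d in \<open>auto intro: has_field_derivative_at_within\<close>)
    qed (use False that d in auto)
    then show ?thesis by simp
  qed simp
  with that CN N dn e show ?thesis by metis
qed

text \<open>The factor 4 / d^2 is the one produced by the Laplacian of N(|y - x|^2 / d^2), with N
  from \<open>smoothed_log\<close>; in the plane it also makes the mass independent of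
  \<open>d\<close>.\<close>

definition kernel :: "real \<Rightarrow> R2 \<Rightarrow> R2 \<Rightarrow> real" where
  "kernel d x y = 4 / d\<^sup>2 * bump ((norm (y - x))\<^sup>2 / d\<^sup>2)"

lemma kernel_nonneg: "kernel d x y \<ge> 0"
  by (simp add: kernel_def bump_props)

lemma kernel_outside: "d > 0 \<Longrightarrow> norm (y - x) \<ge> d \<Longrightarrow> kernel d x y = 0"
  unfolding kernel_def by (subst bump_props(3)) (auto simp: divide_simps intro: power_mono)

lemma kernel_pos:
  assumes "d > 0" "d / 2 < norm (y - x)" "norm (y - x) < d"
  shows "kernel d x y > 0"
proof -
  have "(d / 2)\<^sup>2 < (norm (y - x))\<^sup>2" "(norm (y - x))\<^sup>2 < d\<^sup>2"
    using assms by (auto intro!: power_strict_mono)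
  then have "bump ((norm (y - x))\<^sup>2 / d\<^sup>2) > 0"
    using assms(1) by (intro bump_props(4)) (auto simp: field_simps power2_eq_square)
  then show ?thesis using assms(1) by (simp add: kernel_def)
qed

lemma kernel_le: "kernel d x y \<le> 4 / d\<^sup>2"
proof -
  have "4 / d\<^sup>2 * bump ((norm (y - x))\<^sup>2 / d\<^sup>2) \<le> 4 / d\<^sup>2 * 1"
    by (rule mult_left_mono[OF bump_le_1]) simp
  then show ?thesis by (simp add: kernel_def)
qed

lemma kernel_continuous: "continuous_on UNIV (kernel d x)" "continuous_on UNIV (\<lambda>x. kernel d x y)"
  unfolding kernel_def[abs_def]
  by (auto simp: divide_inverse intro!: continuous_intros continuous_on_compose2[OF bump_continuous])

lemma kernel_measurable [measurable]: "kernel d x \<in> borel_measurable borel"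
  by (rule borel_measurable_continuous_onI[OF kernel_continuous(1)])

definition kmass :: real where "kmass = (\<integral>y. 4 * bump ((norm (y::R2))\<^sup>2) \<partial>lborel)"

lemma kernel_integral:
  assumes "d > 0"
  shows "integrable lborel (kernel d x)" "(\<integral>y. kernel d x y \<partial>lborel) = kmass"
proof -
  show "integrable lborel (kernel d x)"
  proof (rule integrable_if_continuous_bounded_support[OF kernel_continuous(1)])
    show "kernel d x y = 0" if "norm y > norm x + d" for y
      using that norm_triangle_sub[of y x] assms by (intro kernel_outside) auto
  qed
  have "(\<integral>y. kernel d x y \<partial>lborel) = (\<integral>y. d\<^sup>2 * kernel d x (x + d *\<^sub>R y) \<partial>lborel)"
    by (rule integral_lborel_affine) (use assms in auto)
  also have "\<dots> = kmass"
    unfolding kmass_def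
    by (rule Bochner_Integration.integral_cong) (use assms in \<open>auto simp: kernel_def power_mult_distrib\<close>)
  finally show "(\<integral>y. kernel d x y \<partial>lborel) = kmass" .
qed

lemma measure_ball_pos: "r > 0 \<Longrightarrow> measure lborel (ball (x::R2) r) > 0"
  using content_ball_pos[of r x] by (simp add: measure_def)

lemma integral_pos_if_ge_on_ball:
  fixes f :: "R2 \<Rightarrow> real"
  assumes "integrable lborel f" "\<And>y. f y \<ge> 0" "r > 0" "c > 0" "\<And>y. y \<in> ball x r \<Longrightarrow> f y \<ge> c"
  shows "(\<integral>y. f y \<partial>lborel) > 0"
proof -
  have "0 < c * measure lborel (ball x r)" using measure_ball_pos assms(3,4) by simp
  also have "\<dots> = (\<integral>y. c * indicator (ball x r) y \<partial>lborel)" by simp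
  also have "\<dots> \<le> (\<integral>y. f y \<partial>lborel)"
  proof (rule integral_mono[OF _ assms(1)])
    show "integrable lborel (\<lambda>y. c * indicat_real (ball x r) y)"
      using emeasure_lborel_ball_finite[of x r]
      by (intro integrable_mult_right integrable_real_indicator) (auto simp: less_top)
    show "c * indicat_real (ball x r) y \<le> f y" for y
      using assms(2,5)[of y] by (auto simp: indicator_def)
  qed
  finally show ?thesis .
qed

lemma integral_pos_continuous:
  fixes f :: "R2 \<Rightarrow> real"
  assumes "integrable lborel f" "\<And>y. f y \<ge> 0" "open U" "x \<in> U" "continuous_on U f" "f x > 0"
  shows "(\<integral>y. f y \<partial>lborel) > 0"
proof -
  have "isCont f x" using assms(3-5) continuous_on_eq_continuous_at by blast
  then obtain r where r: "r > 0" "\<And>y. dist y x < r \<Longrightarrow> \<bar>f y - f x\<bar> < f x / 2"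
    using assms(6) unfolding continuous_at_eps_delta by (metis dist_real_def half_gt_zero)
  show ?thesis
  proof (rule integral_pos_if_ge_on_ball[OF assms(1,2) r(1), of "f x / 2"])
    show "f x / 2 \<le> f y" if "y \<in> ball x r" for y
      using r(2)[of y] that abs_ge_minus_self[of "f y - f x"] by (simp add: dist_commute field_simps)
  qed (use assms(6) in simp)
qed

lemma kmass_pos: "kmass > 0"
proof -
  have "(\<integral>y. kernel 1 0 y \<partial>lborel) > 0"
    by (rule integral_pos_continuous[OF kernel_integral(1) _ open_UNIV, of _ _ "(3/4, 0)"])
      (auto simp: kernel_nonneg kernel_continuous norm_Pair intro!: kernel_pos)
  then show ?thesis using kernel_integral(2)[of 1 0] by simp
qed

lemma laplacian_radial:
  fixes N n n' :: "real \<Rightarrow> real"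
  assumes N: "\<And>s. (N has_real_derivative n s) (at s)" and n: "\<And>s. (n has_real_derivative n' s) (at s)"
  shows "laplacian (\<lambda>y::R2. N (c * ((y - x) \<bullet> (y - x)))) y =
    4 * c * (n (c * ((y - x) \<bullet> (y - x))) + (c * ((y - x) \<bullet> (y - x))) * n' (c * ((y - x) \<bullet> (y - x))))"
proof -
  define q where "q y = c * ((y - x) \<bullet> (y - x))" for y :: R2
  have q: "GDERIV q y :> (2 * c) *\<^sub>R (y - x)" for y
    unfolding q_def[abs_def]
    using GDERIV_mult[OF GDERIV_const[of c y] GDERIV_norm_squared[of x 0 y]] by (simp add: mult.commute)
  have gN: "grad (\<lambda>y. N (q y)) y = n (q y) *\<^sub>R ((2 * c) *\<^sub>R (y - x))" for y
    by (rule grad_eq, rule GDERIV_DERIV_compose[OF q N])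
  have "b \<bullet> grad (\<lambda>y. b \<bullet> grad (\<lambda>y. N (q y)) y) y = 2 * c * (n (q y) * (b \<bullet> b) + 2 * c * n' (q y) * (b \<bullet> (y - x))\<^sup>2)" for b
  proof -
    have eq: "(\<lambda>y. b \<bullet> grad (\<lambda>y. N (q y)) y) = (\<lambda>y. n (q y) * (2 * c * (b \<bullet> (y - x))))"
      by (simp add: gN mult.assoc)
    have "GDERIV (\<lambda>y. n (q y) * (2 * c * (b \<bullet> (y - x)))) y :>
      n (q y) *\<^sub>R ((2 * c) *\<^sub>R b + (b \<bullet> (y - x)) *\<^sub>R 0) + (2 * c * (b \<bullet> (y - x))) *\<^sub>R (n' (q y) *\<^sub>R ((2 * c) *\<^sub>R (y - x)))"
      by (intro GDERIV_mult GDERIV_const GDERIV_DERIV_compose[OF q n] GDERIV_inner_diff)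
    note g = grad_eq[OF this]
    show ?thesis
      unfolding eq g by (simp add: inner_add_right algebra_simps power2_eq_square)
  qed
  then have "laplacian (\<lambda>y. N (q y)) y = (\<Sum>b\<in>Basis. 2 * c * (n (q y) * (b \<bullet> b) + 2 * c * n' (q y) * (b \<bullet> (y - x))\<^sup>2))"
    by (simp add: laplacian_def)
  also have "\<dots> = 2 * c * (n (q y) * (\<Sum>b\<in>(Basis::R2 set). b \<bullet> b) + 2 * c * n' (q y) * (\<Sum>b\<in>Basis. (b \<bullet> (y - x))\<^sup>2))"
    by (simp add: sum_distrib_left sum.distrib distrib_left)
  also have "(\<Sum>b\<in>Basis. (b \<bullet> (y - x))\<^sup>2) = (y - x) \<bullet> (y - x)"
    by (subst euclidean_inner) (simp add: power2_eq_square inner_commute)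
  also have "(\<Sum>b\<in>(Basis::R2 set). b \<bullet> b) = 2" by simp
  finally show ?thesis by (simp add: q_def algebra_simps)
qed

text \<open>The difference of two kernels with the same centre is the Laplacian of a test function,
  so their averages of a harmonic distribution agree.\<close>

lemma kernel_average_scale:
  fixes v :: "R2 \<Rightarrow> real"
  assumes v: "distr_laplace_eq S v (\<lambda>_. 0)" and ball: "cball x d \<subseteq> S" and d: "0 < d'" "d' < d"
  shows "(LINT y:cball x d|lborel. v y * kernel d x y) = (LINT y:cball x d|lborel. v y * kernel d' x y)"
    and "\<And>e z. set_integrable lborel (cball x d) (\<lambda>y. v y * kernel e z y)"
proof -
  have vi: "integrable lborel (\<lambda>y. indicator (cball x d) y *\<^sub>R v y)"
    using v ball compact_cball unfolding distr_laplace_eq_def locally_integrable_def set_integrable_def by blast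
  show ki: "set_integrable lborel (cball x d) (\<lambda>y. v y * kernel e z y)" for e z
    unfolding set_integrable_def
  proof (rule Bochner_Integration.integrable_bound)
    show "integrable lborel (\<lambda>y. (4 / e\<^sup>2) * (indicator (cball x d) y *\<^sub>R v y))"
      by (intro integrable_mult_right vi)
    have "(\<lambda>y. (indicat_real (cball x d) y *\<^sub>R v y) * kernel e z y) \<in> borel_measurable lborel"
      using borel_measurable_integrable[OF vi] by (intro borel_measurable_times) auto
    then show "(\<lambda>y. indicat_real (cball x d) y *\<^sub>R (v y * kernel e z y)) \<in> borel_measurable lborel"
      by (simp add: mult.assoc)
    have "\<bar>v y\<bar> * kernel e z y \<le> \<bar>v y\<bar> * (4 / e\<^sup>2)" for y
      by (intro mult_left_mono kernel_le) auto
    then show "AE y in lborel. norm (indicat_real (cball x d) y *\<^sub>R (v y * kernel e z y)) \<le> norm (4 / e\<^sup>2 * (indicat_real (cball x d) y *\<^sub>R v y))"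
      by (intro AE_I2) (auto simp: indicator_def abs_mult kernel_nonneg mult.commute)
  qed
  obtain N n n' :: "real \<Rightarrow> real" and m where N: "\<And>k. Ck_on k N UNIV"
    "\<And>s. (N has_real_derivative n s) (at s)" "\<And>s. (n has_real_derivative n' s) (at s)"
    "\<And>s. n s + s * n' s = bump s" "\<And>s. s \<ge> 1 \<Longrightarrow> N s = N 1 + m * ln s"
    using smoothed_log by metis
  define p where "p e y = N (inverse (e\<^sup>2) * ((y - x) \<bullet> (y - x)))" for e and y :: R2
  \<comment> \<open>Beyond distance \<open>d\<close> both terms are the same multiple of a logarithm
    up to constants; the added constant makes the difference vanish there.\<close>
  define \<psi> where "\<psi> y = p d y - p d' y + (m * ln (d\<^sup>2) - m * ln (d'\<^sup>2))" for y
  have Cp: "Ck_on k (p e) UNIV" for k e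
  proof -
    have "Ck_on k (\<lambda>y. inverse (e\<^sup>2) * ((y - x) \<bullet> (y - x))) UNIV"
      using Ck_on_cmult[OF open_UNIV Ck_on_norm_squared[of k x 0]] by simp
    then show ?thesis
      unfolding p_def[abs_def] by (intro Ck_on_compose[OF open_UNIV open_UNIV _ N(1)]) auto
  qed
  have C\<psi>: "Ck_on k \<psi> UNIV" for k
    unfolding \<psi>_def[abs_def] by (intro Ck_on_add Ck_on_diff Cp Ck_on_const open_UNIV)
  have far: "p e y = N 1 + m * ln ((y - x) \<bullet> (y - x)) - m * ln (e\<^sup>2)" if "e > 0" "norm (y - x) \<ge> e" for e y
  proof -
    have "(y - x) \<bullet> (y - x) \<ge> e\<^sup>2" using that by (simp add: dot_square_norm power_mono)
    moreover have e2: "e\<^sup>2 > 0" using that by simp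
    ultimately have ge: "inverse (e\<^sup>2) * ((y - x) \<bullet> (y - x)) \<ge> 1" and p: "(y - x) \<bullet> (y - x) > 0"
      by (simp add: field_simps, linarith)
    have "ln (inverse (e\<^sup>2) * ((y - x) \<bullet> (y - x))) = ln ((y - x) \<bullet> (y - x)) - ln (e\<^sup>2)"
      using e2 p by (subst ln_mult_pos) (auto simp: ln_inverse simp del: inverse_eq_divide)
    then show ?thesis unfolding p_def using N(5)[OF ge] by (simp add: right_diff_distrib)
  qed
  have \<psi>0: "\<psi> y = 0" if "norm (y - x) \<ge> d" for y
    using that d far[of d y] far[of d' y] by (simp add: \<psi>_def)
  have "{y. \<psi> y \<noteq> 0} \<subseteq> cball x d"
    using \<psi>0 by (force simp: dist_norm norm_minus_commute)
  then have cl: "closure {y. \<psi> y \<noteq> 0} \<subseteq> cball x d"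
    by (rule closure_minimal) simp
  then have "compact (closure {y. \<psi> y \<noteq> 0})"
    using compact_Int_closed[OF compact_cball closed_closure] by (metis inf.absorb_iff2)
  then have tf: "\<psi> \<in> test_functions S"
    using cl ball C\<psi> unfolding test_functions_def by blast
  have lp: "laplacian (p e) y = kernel e x y" for e y
    unfolding p_def[abs_def] laplacian_radial[OF N(2,3)] N(4)
    by (simp add: kernel_def dot_square_norm divide_inverse mult.commute)
  have gp: "GDERIV (p e) y :> grad (p e) y" "GDERIV (\<lambda>y. b \<bullet> grad (p e) y) y :> grad (\<lambda>y. b \<bullet> grad (p e) y) y"
    if "b \<in> Basis" for e y b
    using Cp[of "Suc (Suc 0)" e] that by (auto intro!: GDERIV_grad simp del: split_paired_All)
  have l\<psi>: "laplacian \<psi> y = kernel d x y - kernel d' x y" for y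
  proof -
    have g1: "GDERIV \<psi> y :> grad (p d) y - grad (p d') y" for y
      unfolding \<psi>_def[abs_def]
      using GDERIV_add[OF GDERIV_diff[OF gp(1) gp(1)] GDERIV_const] SOME_Basis by fastforce
    have "b \<bullet> grad (\<lambda>y. b \<bullet> grad \<psi> y) y = b \<bullet> grad (\<lambda>y. b \<bullet> grad (p d) y) y - b \<bullet> grad (\<lambda>y. b \<bullet> grad (p d') y) y"
      if "b \<in> Basis" for b
    proof -
      have "(\<lambda>y. b \<bullet> grad \<psi> y) = (\<lambda>y. b \<bullet> grad (p d) y - b \<bullet> grad (p d') y)"
        by (simp add: grad_eq[OF g1] inner_diff_right)
      then show ?thesis
        using grad_eq[OF GDERIV_diff[OF gp(2)[OF that, of d y] gp(2)[OF that, of d' y]]] by (simp add: inner_diff_right)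
    qed
    then have "laplacian \<psi> y = laplacian (p d) y - laplacian (p d') y"
      by (simp add: laplacian_def sum_subtractf)
    then show ?thesis by (simp add: lp)
  qed
  have "0 = (LINT y:S|lborel. v y * laplacian \<psi> y)"
    using v tf unfolding distr_laplace_eq_def by simp
  also have "\<dots> = (LINT y:cball x d|lborel. v y * kernel d x y - v y * kernel d' x y)"
    unfolding set_lebesgue_integral_def
  proof (rule Bochner_Integration.integral_cong[OF refl])
    fix y
    show "indicat_real S y *\<^sub>R (v y * laplacian \<psi> y) = indicat_real (cball x d) y *\<^sub>R (v y * kernel d x y - v y * kernel d' x y)"
    proof (cases "y \<in> cball x d")
      case True
      then show ?thesis using ball by (auto simp: l\<psi> right_diff_distrib)
    next
      case False
      then have "norm (y - x) \<ge> d" by (simp add: dist_norm norm_minus_commute)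
      then show ?thesis using False d by (simp add: l\<psi> kernel_outside)
    qed
  qed
  also have "\<dots> = (LINT y:cball x d|lborel. v y * kernel d x y) - (LINT y:cball x d|lborel. v y * kernel d' x y)"
    by (rule set_integral_diff[OF ki ki])
  finally show "(LINT y:cball x d|lborel. v y * kernel d x y) = (LINT y:cball x d|lborel. v y * kernel d' x y)"
    by simp
qed

text \<open>By \<open>kernel_average_scale\<close> the average may be taken at an arbitrarily small
  scale, where \<open>v\<close> is close to \<open>v x\<close>. Continuity is asked at
  \<open>x\<close> only, so the ball may contain points where \<open>v\<close> is not known to be
  continuous; the removal of the singularity at the emitter relies on this.\<close>

theorem kernel_mean_value:
  fixes v :: "R2 \<Rightarrow> real"
  assumes v: "distr_laplace_eq S v (\<lambda>_. 0)" and ball: "cball x d \<subseteq> S" and d: "0 < d" and c: "isCont v x"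
  shows "(LINT y:cball x d|lborel. v y * kernel d x y) = v x * kmass"
proof -
  define I where "I = (LINT y:cball x d|lborel. v y * kernel d x y)"
  have "\<bar>I - v x * kmass\<bar> \<le> e" if e: "e > 0" for e
  proof -
    define e' where "e' = e / kmass"
    have e': "e' > 0" using e kmass_pos by (simp add: e'_def)
    obtain r where r: "r > 0" "\<And>y. dist y x < r \<Longrightarrow> \<bar>v y - v x\<bar> < e'"
      using c e' unfolding continuous_at_eps_delta by (metis dist_real_def)
    define d' where "d' = min r d / 2"
    have d': "0 < d'" "d' < d" "d' < r" using r d by (auto simp: d'_def min_def)
    note K = kernel_average_scale[OF v ball d'(1,2)]
    have k: "integrable lborel (\<lambda>y. v x * kernel d' x y)" by (intro integrable_mult_right kernel_integral d')
    have vk: "integrable lborel (\<lambda>y. indicator (cball x d) y *\<^sub>R (v y * kernel d' x y))"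
      using K(2) unfolding set_integrable_def .
    have "I - v x * kmass = (\<integral>y. indicator (cball x d) y *\<^sub>R (v y * kernel d' x y) - v x * kernel d' x y \<partial>lborel)"
      using K(1) kernel_integral[OF d'(1)] unfolding I_def
      by (subst Bochner_Integration.integral_diff[OF vk k]) (simp add: set_lebesgue_integral_def)
    also have "\<bar>\<dots>\<bar> \<le> (\<integral>y. e' * kernel d' x y \<partial>lborel)"
    proof (rule order_trans[OF integral_abs_bound integral_mono])
      show "integrable lborel (\<lambda>y. \<bar>indicat_real (cball x d) y *\<^sub>R (v y * kernel d' x y) - v x * kernel d' x y\<bar>)"
        by (intro integrable_abs Bochner_Integration.integrable_diff vk k)
      show "integrable lborel (\<lambda>y. e' * kernel d' x y)" by (intro integrable_mult_right kernel_integral d')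
      show "\<bar>indicat_real (cball x d) y *\<^sub>R (v y * kernel d' x y) - v x * kernel d' x y\<bar> \<le> e' * kernel d' x y" for y
      proof (cases "norm (y - x) < d'")
        case True
        then have "y \<in> cball x d" "\<bar>v y - v x\<bar> \<le> e'"
          using d' r(2)[of y] by (auto simp: dist_norm norm_minus_commute)
        then have "\<bar>(v y - v x) * kernel d' x y\<bar> \<le> e' * kernel d' x y"
          by (simp add: abs_mult kernel_nonneg mult_right_mono)
        then show ?thesis using \<open>y \<in> cball x d\<close> by (simp add: left_diff_distrib)
      next
        case False
        then show ?thesis using d' by (simp add: kernel_outside)
      qed
    qed
    also have "\<dots> = e" using kernel_integral(2)[OF d'(1)] kmass_pos by (simp add: e'_def)
    finally show ?thesis .
  qed
  note small = this
  have "I - v x * kmass = 0"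
  proof (rule ccontr)
    assume "I - v x * kmass \<noteq> 0"
    then have "\<bar>I - v x * kmass\<bar> / 2 > 0" by simp
    moreover have False if "T \<le> T / 2" "0 < T / 2" for T :: real using that by simp
    ultimately show False using small by blast
  qed
  then show ?thesis by (simp add: I_def)
qed

text \<open>The integral of v x - v y against the kernel is 0, while the integrand is nonnegative
  and continuous, so it vanishes where the kernel is positive. That is an annulus rather than the
  ball, which is enough to move from one maximum point to others.\<close>

lemma kernel_mean_value_max:
  fixes v :: "R2 \<Rightarrow> real"
  assumes v: "distr_laplace_eq S v (\<lambda>_. 0)" "open S" "continuous_on S v"
    and ball: "cball x d \<subseteq> S" and d: "0 < d"
    and max: "\<And>y. y \<in> cball x d \<Longrightarrow> v y \<le> v x"
    and y: "d / 2 < norm (y - x)" "norm (y - x) < d"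
  shows "v y = v x"
proof (rule ccontr)
  assume "v y \<noteq> v x"
  have yb: "y \<in> ball x d" using y by (simp add: dist_norm norm_minus_commute)
  then have yc: "y \<in> cball x d" by (simp add: less_imp_le)
  with \<open>v y \<noteq> v x\<close> max have less: "v y < v x" by fastforce
  have "x \<in> S" using ball d by (meson centre_in_cball less_imp_le subsetD)
  then have c: "isCont v x" using v(2,3) continuous_on_eq_continuous_at by blast
  have vk: "integrable lborel (\<lambda>y. indicator (cball x d) y *\<^sub>R (v y * kernel d x y))"
    using kernel_average_scale(2)[OF v(1) ball, of "d/2"] d unfolding set_integrable_def by simp
  have k: "integrable lborel (\<lambda>y. v x * kernel d x y)" by (intro integrable_mult_right kernel_integral d)
  define f where "f y = v x * kernel d x y - indicator (cball x d) y *\<^sub>R (v y * kernel d x y)" for y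
  have f: "f y = indicator (cball x d) y * ((v x - v y) * kernel d x y)" for y
  proof (cases "y \<in> cball x d")
    case False
    then have "norm (y - x) \<ge> d" by (simp add: dist_norm norm_minus_commute)
    with False d show ?thesis by (simp add: f_def kernel_outside)
  qed (simp add: f_def left_diff_distrib)
  have "(\<integral>y. f y \<partial>lborel) > 0"
  proof (rule integral_pos_continuous)
    show "integrable lborel f" unfolding f_def[abs_def] by (intro Bochner_Integration.integrable_diff k vk)
    show "f y \<ge> 0" for y using max[of y] by (auto simp: f indicator_def kernel_nonneg)
    have "continuous_on (ball x d) (\<lambda>y. (v x - v y) * kernel d x y)"
      by (intro continuous_intros continuous_on_subset[OF kernel_continuous(1)] continuous_on_subset[OF v(3)]
          order_trans[OF ball_subset_cball ball]) auto
    then show "continuous_on (ball x d) f"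
      by (rule continuous_on_eq) (auto simp: f)
    show "f y > 0" using kernel_pos[OF d y] less yc by (simp add: f)
  qed (use yb in auto)
  moreover have "(\<integral>y. f y \<partial>lborel) = 0"
    unfolding f_def using kernel_mean_value[OF v(1) ball d c] kernel_integral[OF d]
    by (subst Bochner_Integration.integral_diff[OF k vk]) (simp add: set_lebesgue_integral_def)
  ultimately show False by simp
qed

text \<open>Near \<open>P\<close> the function coincides with its own averages
  \<open>J / kmass\<close> at a fixed scale, and by dominated convergence these depend continuously
  on the centre, also at \<open>P\<close>.\<close>

lemma kernel_mean_value_removable:
  fixes v :: "R2 \<Rightarrow> real"
  assumes v: "distr_laplace_eq S v (\<lambda>_. 0)" and S: "open S" "P \<in> S" and c: "continuous_on (S - {P}) v"
  obtains val where "continuous_on S (v(P := val))" "distr_laplace_eq S (v(P := val)) (\<lambda>_. 0)"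
proof -
  obtain r where r: "r > 0" "cball P r \<subseteq> S" using S open_contains_cball by blast
  \<comment> \<open>Half the radius, so that the ball of radius \<open>d\<close> about any point of
    \<open>ball P d\<close> stays in the common domain of integration
    \<open>cball P r\<close>.\<close>
  define d where "d = r / 2"
  have d: "d > 0" using r by (simp add: d_def)
  have vi: "integrable lborel (\<lambda>y. indicator (cball P r) y *\<^sub>R v y)"
    using v r(2) compact_cball unfolding distr_laplace_eq_def locally_integrable_def set_integrable_def by blast
  define J where "J x = (LINT y:cball P r|lborel. v y * kernel d x y)" for x
  have mJ: "(\<lambda>y. indicat_real (cball P r) y *\<^sub>R (v y * kernel d x y)) \<in> borel_measurable lborel" for x
  proof -
    have "(\<lambda>y. (indicat_real (cball P r) y *\<^sub>R v y) * kernel d x y) \<in> borel_measurable lborel"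
      using borel_measurable_integrable[OF vi] by (intro borel_measurable_times) auto
    then show ?thesis by (simp add: mult.assoc)
  qed
  have cJ: "isCont J P"
    unfolding continuous_at_sequentially
  proof (intro allI impI)
    fix X :: "nat \<Rightarrow> R2" assume X: "X \<longlonglongrightarrow> P"
    show "(J \<circ> X) \<longlonglongrightarrow> J P"
      unfolding J_def[abs_def] set_lebesgue_integral_def o_def
    proof (rule integral_dominated_convergence[OF mJ mJ])
      show "integrable lborel (\<lambda>y. norm ((4 / d\<^sup>2) * (indicator (cball P r) y *\<^sub>R v y)))"
        by (intro integrable_norm integrable_mult_right vi)
      show "AE y in lborel. (\<lambda>n. indicat_real (cball P r) y *\<^sub>R (v y * kernel d (X n) y)) \<longlonglongrightarrow> indicat_real (cball P r) y *\<^sub>R (v y * kernel d P y)"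
      proof (rule AE_I2)
        fix y
        have "isCont (\<lambda>x. kernel d x y) P"
          using kernel_continuous(2)[of d y] continuous_on_eq_continuous_at[OF open_UNIV] by blast
        from isCont_tendsto_compose[OF this X] have "(\<lambda>n. kernel d (X n) y) \<longlonglongrightarrow> kernel d P y" .
        then show "(\<lambda>n. indicat_real (cball P r) y *\<^sub>R (v y * kernel d (X n) y)) \<longlonglongrightarrow> indicat_real (cball P r) y *\<^sub>R (v y * kernel d P y)"
          by (intro tendsto_intros)
      qed
      have "\<bar>v y\<bar> * kernel d z y \<le> \<bar>v y\<bar> * (4 / d\<^sup>2)" for y z
        by (intro mult_left_mono kernel_le) auto
      then show "AE y in lborel. norm (indicat_real (cball P r) y *\<^sub>R (v y * kernel d (X n) y)) \<le> norm ((4 / d\<^sup>2) * (indicator (cball P r) y *\<^sub>R v y))" for n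
        by (intro AE_I2) (auto simp: indicator_def abs_mult kernel_nonneg mult.commute)
    qed
  qed
  define val where "val = J P / kmass"
  have vJ: "v x = J x / kmass" if x: "x \<in> ball P d" "x \<noteq> P" for x
  proof -
    have sub: "cball x d \<subseteq> cball P r"
    proof
      fix y assume "y \<in> cball x d"
      then show "y \<in> cball P r"
        using x dist_triangle[of P y x] unfolding mem_ball mem_cball d_def by linarith
    qed
    have xS: "x \<in> S" using x r by (auto simp: d_def)
    have "open (S - {P})" using S by auto
    then have "isCont v x" using c x xS continuous_on_eq_continuous_at by blast
    from kernel_mean_value[OF v order_trans[OF sub r(2)] d this]
    have "(LINT y:cball x d|lborel. v y * kernel d x y) = v x * kmass" .
    moreover have "J x = (LINT y:cball x d|lborel. v y * kernel d x y)"
      unfolding J_def set_lebesgue_integral_def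
    proof (rule Bochner_Integration.integral_cong[OF refl])
      fix y
      show "indicat_real (cball P r) y *\<^sub>R (v y * kernel d x y) = indicat_real (cball x d) y *\<^sub>R (v y * kernel d x y)"
      proof (cases "y \<in> cball x d")
        case True
        then show ?thesis using sub by auto
      next
        case False
        then have "norm (y - x) \<ge> d" by (simp add: dist_norm norm_minus_commute)
        then show ?thesis using d by (simp add: kernel_outside)
      qed
    qed
    ultimately show ?thesis using kmass_pos by simp
  qed
  have "isCont (\<lambda>x. J x / kmass) P" using cJ kmass_pos by (intro continuous_intros) auto
  moreover have "\<forall>\<^sub>F x in nhds P. J x / kmass = (v(P := val)) x"
    unfolding eventually_nhds_metric using vJ d by (auto simp: val_def dist_commute intro!: exI[of _ d])
  ultimately have cP: "isCont (v(P := val)) P"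
    using isCont_cong[of "\<lambda>x. J x / kmass" "v(P := val)" P] by blast
  have "isCont (v(P := val)) x" if "x \<in> S" for x
  proof (cases "x = P")
    case False
    have "open (S - {P})" using S by auto
    moreover have "continuous_on (S - {P}) (v(P := val))"
      by (rule continuous_on_eq[OF c]) auto
    ultimately show ?thesis using that False continuous_on_eq_continuous_at by blast
  qed (simp add: cP)
  then have "continuous_on S (v(P := val))" by (intro continuous_at_imp_continuous_on ballI)
  moreover have "distr_laplace_eq S (v(P := val)) (\<lambda>_. 0)"
    by (rule distr_laplace_eq_cong_except[OF v, of P]) auto
  ultimately show ?thesis by (rule that)
qed

text \<open>Among the maximum points, one with largest second coordinate cannot be interior: the mean
  value property produces maximum points above it.\<close>

lemma weak_max_principle:
  fixes v :: "R2 \<Rightarrow> real"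
  assumes v: "distr_laplace_eq S v (\<lambda>_. 0)" "open S" "continuous_on K v"
    and K: "compact K" "S \<subseteq> K" and bd: "\<And>x. x \<in> K - S \<Longrightarrow> v x \<le> B" and x: "x \<in> K"
  shows "v x \<le> B"
proof -
  obtain z where z: "z \<in> K" "\<And>y. y \<in> K \<Longrightarrow> v y \<le> v z"
    using continuous_attains_sup[OF K(1) _ v(3)] x by blast
  define Z where "Z = {y \<in> K. v y = v z}"
  have "closed Z"
  proof -
    have "Z = K \<inter> v -` {v z}" by (auto simp: Z_def)
    then show ?thesis
      using continuous_closed_preimage[OF v(3) compact_imp_closed[OF K(1)] closed_singleton] by simp
  qed
  with K(1) have "compact (K \<inter> Z)" by (rule compact_Int_closed)
  moreover have "K \<inter> Z = Z" unfolding Z_def by blast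
  ultimately have "compact Z" by simp
  have "z \<in> Z" using z(1) by (simp add: Z_def)
  then have "Z \<noteq> {}" by blast
  obtain y where y: "y \<in> Z" "\<And>y'. y' \<in> Z \<Longrightarrow> snd y' \<le> snd y"
    using continuous_attains_sup[OF \<open>compact Z\<close> \<open>Z \<noteq> {}\<close> continuous_on_snd[OF continuous_on_id]] by blast
  have "y \<notin> S"
  proof
    assume "y \<in> S"
    then obtain d where d: "d > 0" "cball y d \<subseteq> S" using v(2) open_contains_cball by blast
    \<comment> \<open>A point above \<open>y\<close> at a distance between d / 2 and d, where the
      kernel is positive.\<close>
    define y' where "y' = y + (0, 3/4 * d)"
    have n: "norm (y' - y) = 3/4 * d" using d by (simp add: y'_def norm_Pair)
    have "v y' = v y"
    proof (rule kernel_mean_value_max[OF v(1,2) continuous_on_subset[OF v(3) K(2)] d(2,1)])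
      show "v u \<le> v y" if "u \<in> cball y d" for u
      proof -
        have "u \<in> K" using that d(2) K(2) by blast
        then show ?thesis using z(2) y(1) by (simp add: Z_def)
      qed
    qed (use n d in auto)
    moreover have "y' \<in> cball y d" using n d(1) by (simp add: dist_norm norm_minus_commute)
    then have "y' \<in> K" using d(2) K(2) by blast
    ultimately have "y' \<in> Z" using y(1) by (auto simp: Z_def)
    from y(2)[OF this] d show False by (simp add: y'_def)
  qed
  then have "v z \<le> B" using y(1) bd[of y] by (auto simp: Z_def)
  with z(2)[OF x] show ?thesis by simp
qed

section \<open>Uniqueness for the exterior problem\<close>

definition cx :: "R2 \<Rightarrow> complex" where "cx x = Complex (fst x) (snd x)"

lemma cx_simps [simp]: "Re (cx x) = fst x" "Im (cx x) = snd x"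
  by (simp_all add: cx_def)

lemma bounded_linear_cx: "bounded_linear cx"
proof (rule bounded_linear_intro[where K = 1])
  show "norm (cx x) \<le> norm x * 1" for x
    by (cases x) (simp add: cx_def norm_complex_def norm_Pair)
qed (auto simp: complex_eq_iff)

lemma norm_cx: "norm (cx x) = norm x"
  by (cases x) (simp add: cx_def norm_complex_def norm_Pair)

lemma cx_diff: "cx (x - y) = cx x - cx y" and cx_add: "cx (x + y) = cx x + cx y"
  and cx_scaleR: "cx (t *\<^sub>R x) = of_real t * cx x"
  by (auto simp: complex_eq_iff)

lemma inj_cx: "cx x = cx y \<longleftrightarrow> x = y"
  by (auto simp: complex_eq_iff prod_eq_iff)

lemma cx_pair [simp]: "cx (Re z, Im z) = z"
  by (simp add: complex_eq_iff)

lemma continuous_on_cx [continuous_intros]: "continuous_on S cx"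
  by (rule linear_continuous_on[OF bounded_linear_cx])

lemma open_cx_image: "open S \<Longrightarrow> open (cx ` S)"
proof -
  assume S: "open S"
  have "cx ` S = (\<lambda>z. (Re z, Im z)) -` S"
  proof (intro equalityI subsetI)
    fix z assume "z \<in> (\<lambda>z. (Re z, Im z)) -` S"
    then show "z \<in> cx ` S" by (intro image_eqI[of _ _ "(Re z, Im z)"]) auto
  qed auto
  moreover have "open ((\<lambda>z. (Re z, Im z)) -` S)"
    by (rule open_vimage[OF S]) (intro continuous_intros)
  ultimately show ?thesis by simp
qed

lemma GDERIV_Re_holomorphic:
  assumes "(f has_field_derivative f') (at (cx x))"
  shows "GDERIV (\<lambda>x. Re (f (cx x))) x :> (Re f', - Im f')"
proof -
  have "(cx has_derivative cx) (at x)"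
    by (rule bounded_linear_imp_has_derivative[OF bounded_linear_cx])
  from has_derivative_compose[OF this, of f "(*) f'"] assms
  have "((\<lambda>x. f (cx x)) has_derivative (\<lambda>h. f' * cx h)) (at x)"
    by (simp add: has_field_derivative_def)
  then have "((\<lambda>x. Re (f (cx x))) has_derivative (\<lambda>h. Re (f' * cx h))) (at x)"
    by (rule bounded_linear.has_derivative[OF bounded_linear_Re])
  moreover have "(\<lambda>h. Re (f' * cx h)) = (\<lambda>h. h \<bullet> (Re f', - Im f'))"
    by (auto simp: inner_prod_def)
  ultimately show ?thesis by (simp add: gderiv_def)
qed

lemma Basis_R2: "(Basis :: R2 set) = {(1, 0), (0, 1)}"
  by (simp add: Basis_prod_def insert_commute)

text \<open>The hypothesis on \<open>g\<close> says that locally \<open>g\<close> is the real part of a primitive of \<open>h\<close>.\<close>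

lemma holomorphic_gradient_comps:
  assumes S: "open S" and h: "h holomorphic_on cx ` S"
    and g: "\<And>x. x \<in> S \<Longrightarrow> GDERIV g x :> (Re (h (cx x)), - Im (h (cx x)))" and x: "x \<in> S"
  shows "GDERIV (\<lambda>x. (1, 0) \<bullet> grad g x) x :> (Re (deriv h (cx x)), - Im (deriv h (cx x)))"
    and "GDERIV (\<lambda>x. (0, 1) \<bullet> grad g x) x :> (Re (\<i> * deriv h (cx x)), - Im (\<i> * deriv h (cx x)))"
proof -
  have d: "(h has_field_derivative deriv h (cx x)) (at (cx x))"
    using holomorphic_derivI[OF h open_cx_image[OF S]] x by blast
  then have d': "((\<lambda>z. \<i> * h z) has_field_derivative \<i> * deriv h (cx x)) (at (cx x))"
    by (rule DERIV_cmult)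
  show "GDERIV (\<lambda>x. (1, 0) \<bullet> grad g x) x :> (Re (deriv h (cx x)), - Im (deriv h (cx x)))"
    by (rule GDERIV_transform_open[OF GDERIV_Re_holomorphic[OF d] S x]) (simp add: grad_eq[OF g])
  show "GDERIV (\<lambda>x. (0, 1) \<bullet> grad g x) x :> (Re (\<i> * deriv h (cx x)), - Im (\<i> * deriv h (cx x)))"
    by (rule GDERIV_transform_open[OF GDERIV_Re_holomorphic[OF d'] S x]) (simp add: grad_eq[OF g])
qed

text \<open>The two components of the gradient satisfy the hypothesis again, with
  \<open>deriv h\<close> and \<open>\<i> * deriv h\<close> in place of \<open>h\<close>, so the
  induction closes. Prescribing the gradient rather than a primitive admits log |x - c|, which has
  no single-valued conjugate.\<close>

lemma holomorphic_gradient_Ck: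
  assumes S: "open S" and h: "h holomorphic_on cx ` S"
    and g: "\<And>x. x \<in> S \<Longrightarrow> GDERIV g x :> (Re (h (cx x)), - Im (h (cx x)))"
  shows "Ck_on k g S"
  using h g
proof (induction k arbitrary: g h)
  case 0
  then show ?case
    by (auto simp: gderiv_def intro!: continuous_at_imp_continuous_on has_derivative_continuous)
next
  case (Suc k)
  note c = holomorphic_gradient_comps[OF S Suc.prems]
  have hd: "deriv h holomorphic_on cx ` S"
    by (rule holomorphic_deriv[OF Suc.prems(1) open_cx_image[OF S]])
  have hd': "(\<lambda>z. \<i> * deriv h z) holomorphic_on cx ` S"
    by (rule holomorphic_on_mult[OF holomorphic_on_const hd])
  have "Ck_on k (\<lambda>x. (1, 0) \<bullet> grad g x) S" "Ck_on k (\<lambda>x. (0, 1) \<bullet> grad g x) S"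
    using Suc.IH[OF hd c(1)] Suc.IH[OF hd' c(2)] by auto
  moreover have "g differentiable (at x)" if "x \<in> S" for x
    using GDERIV_differentiable[OF Suc.prems(2)[OF that]] .
  ultimately show ?case by (simp add: Basis_R2)
qed

lemma holomorphic_gradient_harmonic:
  assumes S: "open S" and h: "h holomorphic_on cx ` S"
    and g: "\<And>x. x \<in> S \<Longrightarrow> GDERIV g x :> (Re (h (cx x)), - Im (h (cx x)))"
  shows "harmonic_in g S"
  unfolding harmonic_in_def
proof (intro conjI ballI holomorphic_gradient_Ck[OF assms])
  fix x assume x: "x \<in> S"
  note c = holomorphic_gradient_comps[OF assms x]
  show "laplacian g x = 0"
    unfolding laplacian_def Basis_R2
    by (subst sum.insert) (simp_all add: grad_eq[OF c(1)] grad_eq[OF c(2)])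
qed

lemma GDERIV_ln_norm:
  assumes "x \<noteq> c"
  shows "GDERIV (\<lambda>x. ln (norm (x - c))) x :> (Re (1 / (cx x - cx c)), - Im (1 / (cx x - cx c)))"
proof -
  have n: "GDERIV (\<lambda>x. norm (x - c)) x :> sgn (x - c)"
  proof -
    have "((\<lambda>x. x - c) has_derivative (\<lambda>h. h)) (at x)" by (auto intro!: derivative_eq_intros)
    moreover have "(norm has_derivative (\<lambda>h. h \<bullet> sgn (x - c))) (at (x - c))"
      using GDERIV_norm[of "x - c"] assms by (simp add: gderiv_def)
    ultimately have "((\<lambda>x. norm (x - c)) has_derivative (\<lambda>h. h \<bullet> sgn (x - c))) (at x)"
      by (rule has_derivative_compose)
    then show ?thesis by (simp add: gderiv_def)
  qed
  have p: "norm (x - c) > 0" using assms by simp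
  have "GDERIV (\<lambda>x. ln (norm (x - c))) x :> (1 / norm (x - c)) *\<^sub>R sgn (x - c)"
    by (rule GDERIV_DERIV_compose[OF n DERIV_ln_divide[OF p]])
  moreover have "(1 / norm (x - c)) *\<^sub>R sgn (x - c) = (Re (1 / (cx x - cx c)), - Im (1 / (cx x - cx c)))"
  proof -
    have "(norm (x - c))\<^sup>2 = (Re (cx x - cx c))\<^sup>2 + (Im (cx x - cx c))\<^sup>2"
      by (simp add: norm_R2_squared)
    then have "inverse (norm (x - c)) * inverse (norm (x - c)) =
        inverse ((fst x - fst c) * (fst x - fst c) + (snd x - snd c) * (snd x - snd c))"
      by (simp add: power2_eq_square flip: inverse_mult_distrib)
    then show ?thesis
      by (simp add: prod_eq_iff sgn_div_norm Re_divide Im_divide power2_eq_square divide_inverse)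
        (simp add: algebra_simps)
  qed
  ultimately show ?thesis by simp
qed

lemma harmonic_ln_norm:
  fixes S :: "R2 set"
  assumes "open S" "c \<notin> S"
  shows "harmonic_in (\<lambda>x. ln (norm (x - c))) S"
proof (rule holomorphic_gradient_harmonic[OF assms(1)])
  show "(\<lambda>z. 1 / (z - cx c)) holomorphic_on cx ` S"
    using assms(2) by (auto intro!: holomorphic_intros simp: inj_cx)
  fix x assume "x \<in> S"
  then have "x \<noteq> c" using assms(2) by auto
  from GDERIV_ln_norm[OF this]
  show "GDERIV (\<lambda>x. ln (norm (x - c))) x :> (Re (1 / (cx x - cx c)), - Im (1 / (cx x - cx c)))" .
qed

lemma distr_laplace_eq_subset:
  assumes "distr_laplace_eq S v T" "S' \<subseteq> S"
  shows "distr_laplace_eq S' v T"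
proof -
  have "(LINT x:S'|lborel. v x * laplacian \<phi> x) = T \<phi>" if \<phi>: "\<phi> \<in> test_functions S'" for \<phi>
  proof -
    note tf = test_functions_props[OF \<phi>]
    have "indicat_real S' x *\<^sub>R (v x * laplacian \<phi> x) = indicat_real S x *\<^sub>R (v x * laplacian \<phi> x)" for x
      using tf(2) tf(7)[of x] assms(2) by (auto simp: indicator_def)
    then have "(LINT x:S'|lborel. v x * laplacian \<phi> x) = (LINT x:S|lborel. v x * laplacian \<phi> x)"
      by (simp only: set_lebesgue_integral_def)
    moreover have "\<phi> \<in> test_functions S" using \<phi> assms(2) by (auto simp: test_functions_def)
    ultimately show ?thesis using assms(1) by (simp add: distr_laplace_eq_def)
  qed
  moreover have "locally_integrable v S'"
    using assms unfolding distr_laplace_eq_def locally_integrable_def by blast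
  ultimately show ?thesis by (simp add: distr_laplace_eq_def)
qed

section \<open>Geometry of the exterior domain\<close>

definition closed_ext :: "real \<Rightarrow> R2 set" where
  "closed_ext \<epsilon> = {x. norm (x - center \<epsilon> 1) \<ge> 1 \<and> norm (x - center \<epsilon> 2) \<ge> 1}"

lemma frontier_D: "frontier (D \<epsilon> j) = sphere (center \<epsilon> j) 1"
  by (simp add: D_def)

lemma exterior_dom_iff: "x \<in> exterior_dom \<epsilon> \<longleftrightarrow> norm (x - center \<epsilon> 1) > 1 \<and> norm (x - center \<epsilon> 2) > 1"
  by (auto simp: exterior_dom_def D_def closure_Un dist_norm norm_minus_commute)

lemma open_exterior_dom: "open (exterior_dom \<epsilon>)"
  unfolding exterior_dom_def by (intro open_Diff open_UNIV closed_closure)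

lemma closed_closed_ext: "closed (closed_ext \<epsilon>)"
  unfolding closed_ext_def
  by (intro closed_Collect_conj closed_Collect_le continuous_intros)

lemma exterior_subset_closed_ext: "exterior_dom \<epsilon> \<subseteq> closed_ext \<epsilon>"
  by (auto simp: exterior_dom_iff closed_ext_def)

lemma dist_centers:
  assumes "\<epsilon> > 0" "j \<in> {1, 2}" "k \<in> {1, 2}" "j \<noteq> k"
  shows "norm (center \<epsilon> j - center \<epsilon> k) = 2 + \<epsilon>"
  using assms by (auto simp: center_def norm_Pair abs_if)

text \<open>The centres are 2 + \<epsilon> apart, so a point at distance less than 1 + \<epsilon>
  from one of them is more than 1 away from the other: the gap leaves room for an annulus around
  each disk.\<close>

lemma annulus_subset:
  assumes "\<epsilon> > 0" "j \<in> {1, 2}" "norm (x - center \<epsilon> j) \<ge> 1" "norm (x - center \<epsilon> j) < 1 + \<epsilon>"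
  shows "x \<in> closed_ext \<epsilon>" "norm (x - center \<epsilon> j) > 1 \<Longrightarrow> x \<in> exterior_dom \<epsilon>"
proof -
  define k :: nat where "k = 3 - j"
  have k: "k \<in> {1, 2}" "k \<noteq> j" using assms(2) by (auto simp: k_def)
  have "norm (center \<epsilon> j - center \<epsilon> k) \<le> norm (x - center \<epsilon> k) + norm (x - center \<epsilon> j)"
    using norm_triangle_ineq4[of "x - center \<epsilon> k" "x - center \<epsilon> j"] by simp
  then have "norm (x - center \<epsilon> k) > 1"
    using dist_centers[OF assms(1,2) k(1)] k(2) assms(4) by simp
  then show "x \<in> closed_ext \<epsilon>" "norm (x - center \<epsilon> j) > 1 \<Longrightarrow> x \<in> exterior_dom \<epsilon>"
    using assms(2,3) by (auto simp: k_def closed_ext_def exterior_dom_iff)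
qed

lemma closure_exterior_dom:
  assumes "\<epsilon> > 0"
  shows "closure (exterior_dom \<epsilon>) = closed_ext \<epsilon>"
proof
  show "closure (exterior_dom \<epsilon>) \<subseteq> closed_ext \<epsilon>"
    by (rule closure_minimal[OF exterior_subset_closed_ext closed_closed_ext])
  show "closed_ext \<epsilon> \<subseteq> closure (exterior_dom \<epsilon>)"
  proof
    fix x assume x: "x \<in> closed_ext \<epsilon>"
    show "x \<in> closure (exterior_dom \<epsilon>)"
    proof (cases "x \<in> exterior_dom \<epsilon>")
      case True
      then show ?thesis using closure_subset by blast
    next
      case False
      then have "norm (x - center \<epsilon> 1) = 1 \<or> norm (x - center \<epsilon> 2) = 1"
        using x by (auto simp: exterior_dom_iff closed_ext_def)
      then obtain j where j: "j \<in> {1, 2}" "norm (x - center \<epsilon> j) = 1"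
        using insertI1 insertI2 by metis
      show ?thesis
        unfolding closure_approachable
      proof (intro allI impI)
        fix e :: real assume e: "e > 0"
        define t where "t = min e \<epsilon> / 2"
        have t: "t > 0" "t < e" "t < \<epsilon>" using e assms by (auto simp: t_def min_def)
        define y where "y = x + t *\<^sub>R (x - center \<epsilon> j)"
        have "y - center \<epsilon> j = (1 + t) *\<^sub>R (x - center \<epsilon> j)" by (simp add: y_def algebra_simps)
        then have "norm (y - center \<epsilon> j) = 1 + t" using j(2) t by simp
        then have "y \<in> exterior_dom \<epsilon>" using annulus_subset[OF assms j(1), of y] t by simp
        moreover have "dist y x < e" using j(2) t by (simp add: y_def dist_norm)
        ultimately show "\<exists>y\<in>exterior_dom \<epsilon>. dist y x < e" by blast
      qed
    qed
  qed
qed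

text \<open>Both centres lie on the horizontal axis, so moving vertically away from this axis cannot
  decrease either distance.\<close>

lemma vertical_ray:
  assumes x: "x \<in> exterior_dom \<epsilon>" and s: "s = (if snd x \<ge> 0 then 1 else - 1)" and t: "t \<ge> 0"
  shows "x + t *\<^sub>R (0, s) \<in> exterior_dom \<epsilon>"
proof -
  have "(snd x)\<^sup>2 \<le> (snd x + t * s)\<^sup>2"
    using s t by (intro abs_le_square_iff[THEN iffD1]) (auto simp: abs_if)
  then have "(norm (x - center \<epsilon> j))\<^sup>2 \<le> (norm (x + t *\<^sub>R (0, s) - center \<epsilon> j))\<^sup>2" for j
    by (simp add: norm_R2_squared center_def)
  then have "norm (x - center \<epsilon> j) \<le> norm (x + t *\<^sub>R (0, s) - center \<epsilon> j)" for j
    by (rule power2_le_imp_le) simp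
  then show ?thesis using x unfolding exterior_dom_iff by (meson less_le_trans)
qed

text \<open>A maximum point would spread along a vertical ray to infinity; this replaces the
  connectedness of the exterior domain.\<close>

lemma strict_max_interior:
  fixes v :: "R2 \<Rightarrow> real"
  assumes v: "distr_laplace_eq (exterior_dom \<epsilon>) v (\<lambda>_. 0)" "continuous_on (exterior_dom \<epsilon>) v"
    and le: "\<And>x. x \<in> exterior_dom \<epsilon> \<Longrightarrow> v x \<le> d" and R: "\<And>x. norm x \<ge> R \<Longrightarrow> v x < d"
    and x: "x \<in> exterior_dom \<epsilon>"
  shows "v x < d"
proof (rule ccontr)
  assume "\<not> v x < d"
  then have vx: "v x = d" using le[OF x] by simp
  define s :: real where "s = (if snd x \<ge> 0 then 1 else - 1)"
  have s: "\<bar>s\<bar> = 1" by (simp add: s_def)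
  define e :: R2 where "e = (0, s)"
  have ne: "norm e = 1" using s by (simp add: e_def norm_Pair)
  have ray: "x + t *\<^sub>R e \<in> exterior_dom \<epsilon>" if "t \<ge> 0" for t
    using vertical_ray[OF x s_def that] by (simp add: e_def)
  \<comment> \<open>Parameters of the maximum points on the ray. From |R| + |x| on, the ray is
    outside the ball of radius |R|, where \<open>v\<close> is below \<open>d\<close>. A kernel
    centred at the point with the largest parameter yields a maximum point further along.\<close>
  define T where "T = {t \<in> {0..\<bar>R\<bar> + norm x}. v (x + t *\<^sub>R e) = d}"
  have "continuous_on {0..\<bar>R\<bar> + norm x} (\<lambda>t. v (x + t *\<^sub>R e))"
    by (rule continuous_on_compose2[OF v(2)]) (auto intro!: continuous_intros ray)
  from continuous_closed_preimage[OF this closed_atLeastAtMost closed_singleton]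
  have "closed ({0..\<bar>R\<bar> + norm x} \<inter> (\<lambda>t. v (x + t *\<^sub>R e)) -` {d})" .
  moreover have "T = {0..\<bar>R\<bar> + norm x} \<inter> (\<lambda>t. v (x + t *\<^sub>R e)) -` {d}" by (auto simp: T_def)
  ultimately have "closed T" by simp
  moreover have "bounded T" by (rule bounded_subset[of "{0..\<bar>R\<bar> + norm x}"]) (auto simp: T_def)
  ultimately have "compact T" by (simp add: compact_eq_bounded_closed)
  moreover have "0 \<in> T" using vx by (simp add: T_def)
  ultimately obtain t where t: "t \<in> T" "\<And>t'. t' \<in> T \<Longrightarrow> t' \<le> t"
    using compact_attains_sup[of T] by blast
  define y where "y = x + t *\<^sub>R e"
  have t0: "t \<ge> 0" using t(1) by (simp add: T_def)
  have y: "y \<in> exterior_dom \<epsilon>" "v y = d" using t(1) ray[OF t0] by (auto simp: y_def T_def)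
  obtain r where r: "r > 0" "cball y r \<subseteq> exterior_dom \<epsilon>"
    using y(1) open_exterior_dom open_contains_cball by blast
  define t' where "t' = t + 3/4 * r"
  have n: "norm ((x + t' *\<^sub>R e) - y) = 3/4 * r"
    using r ne by (simp add: y_def t'_def scaleR_left_distrib)
  have "v (x + t' *\<^sub>R e) = v y"
    by (rule kernel_mean_value_max[OF v(1) open_exterior_dom v(2) r(2,1)])
      (use y le r n in auto)
  then have vt: "v (x + t' *\<^sub>R e) = d" using y by simp
  then have "norm (x + t' *\<^sub>R e) < R" using R by (meson not_le less_irrefl)
  moreover have "norm (t' *\<^sub>R e) \<le> norm (x + t' *\<^sub>R e) + norm x"
    using norm_triangle_ineq4[of "x + t' *\<^sub>R e" x] by simp
  moreover have "t' \<ge> 0" using t0 r by (simp add: t'_def)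
  ultimately have "t' \<in> T" using vt ne by (auto simp: T_def)
  from t(2)[OF this] r show False by (simp add: t'_def)
qed

text \<open>Hopf's lemma: a positive maximum is attained on one of the circles only, and comparison with
  \<open>d - t log|x - c|\<close> in an annulus makes the normal derivative at least \<open>t/2\<close> on that circle.\<close>

lemma exterior_solution_nonpos:
  fixes w :: "R2 \<Rightarrow> real"
  assumes \<epsilon>: "\<epsilon> > 0" and P: "P \<in> exterior_dom \<epsilon>"
    and w: "continuous_on (closed_ext \<epsilon> - {P}) w" "distr_laplace_eq (exterior_dom \<epsilon>) w (\<lambda>_. 0)"
    and bd: "\<And>j x. j \<in> {1, 2} \<Longrightarrow> x \<in> sphere (center \<epsilon> j) 1 \<Longrightarrow> w x = d j"
    and flux: "\<And>j. j \<in> {1, 2} \<Longrightarrow> zero_flux w (center \<epsilon> j)"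
    and inf: "(w \<longlongrightarrow> 0) at_infinity" and x: "x \<in> closed_ext \<epsilon> - {P}"
  shows "w x \<le> 0"
proof (rule ccontr)
  assume "\<not> w x \<le> 0"
  then have wx: "w x > 0" by simp
  define X where "X = exterior_dom \<epsilon>"
  have X: "open X" "X \<subseteq> closed_ext \<epsilon>" "P \<in> X"
    using open_exterior_dom exterior_subset_closed_ext P by (auto simp: X_def)
  have "continuous_on (X - {P}) w" using w(1) X(2) by (rule continuous_on_subset[OF _ Diff_mono]) simp
  \<comment> \<open>The behaviour of \<open>w\<close> at \<open>P\<close> is uncontrolled; once the
    singularity is removed, compactness and the mean value property apply across
    \<open>P\<close>.\<close>
  from kernel_mean_value_removable[OF w(2)[folded X_def] X(1,3) this]
  obtain val where val: "continuous_on X (w(P := val))" "distr_laplace_eq X (w(P := val)) (\<lambda>_. 0)" .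
  define v where "v = w(P := val)"
  have vw: "v y = w y" if "y \<noteq> P" for y using that by (simp add: v_def)
  note v = val[folded v_def]
  have vE: "continuous_on (closed_ext \<epsilon>) v"
  proof -
    have u: "X \<union> (closed_ext \<epsilon> - {P}) = closed_ext \<epsilon>" using X by auto
    have "continuous_on (X \<union> (closed_ext \<epsilon> - {P})) v"
    proof (rule continuous_on_Un_local_open)
      show "openin (top_of_set (X \<union> (closed_ext \<epsilon> - {P}))) X"
        using X unfolding u by (intro open_subset) auto
      show "openin (top_of_set (X \<union> (closed_ext \<epsilon> - {P}))) (closed_ext \<epsilon> - {P})"
        unfolding u by (intro openin_delete) auto
      show "continuous_on (closed_ext \<epsilon> - {P}) v"
        by (rule continuous_on_eq[OF w(1)]) (auto simp: vw)
    qed (rule v(1))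
    then show ?thesis unfolding u .
  qed
  have "eventually (\<lambda>y. dist (w y) 0 < w x) at_infinity" using inf wx by (rule tendstoD)
  then obtain R0 where R0: "\<And>y. norm y \<ge> R0 \<Longrightarrow> \<bar>w y\<bar> < w x"
    unfolding eventually_at_infinity by auto
  define R where "R = max R0 (norm P + 1)"
  have R: "v y < w x" "y \<noteq> P" if "norm y \<ge> R" for y
  proof -
    show "y \<noteq> P" using that by (auto simp: R_def)
    then show "v y < w x" using R0[of y] that vw[of y] by (auto simp: R_def abs_less_iff)
  qed
  have xv: "v x = w x" "x \<in> closed_ext \<epsilon>" "norm x < R" using x vw[of x] R(1)[of x] by (auto simp: not_le[symmetric])
  define K where "K = closed_ext \<epsilon> \<inter> cball 0 R"
  have "compact K" unfolding K_def by (simp add: closed_Int_compact closed_closed_ext)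
  moreover have "x \<in> K" using xv by (simp add: K_def)
  moreover have "continuous_on K v" by (rule continuous_on_subset[OF vE]) (simp add: K_def)
  ultimately obtain z where z: "z \<in> K" "\<And>y. y \<in> K \<Longrightarrow> v y \<le> v z"
    using continuous_attains_sup[of K v] by blast
  have vz: "v z \<ge> w x" using z(2)[OF \<open>x \<in> K\<close>] xv by simp
  have zmax: "v y \<le> v z" if "y \<in> closed_ext \<epsilon>" for y
    using z(2)[of y] R(1)[of y] vz that by (cases "norm y \<ge> R") (auto simp: K_def)
  have strict: "v y < v z" if "y \<in> X" for y
    by (rule strict_max_interior[OF v(2,1)[unfolded X_def], of _ R])
      (use zmax X R(1) vz that in \<open>fastforce simp: X_def\<close>)+
  have "z \<notin> X" using strict by blast
  then have "z \<in> sphere (center \<epsilon> 1) 1 \<or> z \<in> sphere (center \<epsilon> 2) 1"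
    using z(1) by (auto simp: K_def X_def exterior_dom_iff closed_ext_def dist_norm norm_minus_commute not_less)
  then obtain j where j: "j \<in> {1, 2}" "z \<in> sphere (center \<epsilon> j) 1"
    using insertI1 insertI2 by metis
  define c where "c = center \<epsilon> j"
  have zP: "z \<noteq> P" using \<open>z \<notin> X\<close> X by auto
  have dj: "v z = d j" using bd[OF j] vw[OF zP] by simp
  have Pc: "norm (P - c) > 1" using P j(1) by (auto simp: exterior_dom_iff c_def)
  obtain \<rho> where \<rho>: "\<rho> > 1" "\<rho> < 1 + \<epsilon>" "\<rho> < norm (P - c)"
    using dense[of 1 "min (1 + \<epsilon>) (norm (P - c))"] \<epsilon> Pc by auto
  define A where "A = {y. 1 \<le> norm (y - c) \<and> norm (y - c) \<le> \<rho>}"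
  define S where "S = {y. 1 < norm (y - c) \<and> norm (y - c) < \<rho>}"
  have AE: "A \<subseteq> closed_ext \<epsilon>" "P \<notin> A" and SX: "S \<subseteq> X" and SA: "S \<subseteq> A"
    using annulus_subset[OF \<epsilon> j(1)] \<rho> by (auto simp: A_def S_def c_def X_def)
  have oS: "open S" unfolding S_def by (intro open_Collect_conj open_Collect_less continuous_intros)
  have "closed A" unfolding A_def by (intro closed_Collect_conj closed_Collect_le continuous_intros)
  moreover have "bounded A" by (rule bounded_subset[of "cball c \<rho>"]) (auto simp: A_def dist_norm norm_minus_commute)
  ultimately have cA: "compact A" by (simp add: compact_eq_bounded_closed)
  have sX: "sphere c \<rho> \<subseteq> X"
    using annulus_subset(2)[OF \<epsilon> j(1)] \<rho> by (auto simp: c_def X_def dist_norm norm_minus_commute)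
  have "sphere c \<rho> \<noteq> {}" using \<rho> by (simp add: sphere_eq_empty)
  moreover have "continuous_on (sphere c \<rho>) v" by (rule continuous_on_subset[OF v(1) sX])
  ultimately obtain y0 where y0: "y0 \<in> sphere c \<rho>" "\<And>y. y \<in> sphere c \<rho> \<Longrightarrow> v y \<le> v y0"
    using continuous_attains_sup[OF compact_sphere] by blast
  have less: "v y0 < v z" using strict y0(1) sX by blast
  \<comment> \<open>The largest slope for which v + t log |x - c| is at most \<open>v z\<close> on
    the outer circle; positive because values in the interior are strictly below the
    maximum.\<close>
  define t where "t = (v z - v y0) / ln \<rho>"
  have t: "t > 0" using less \<rho> by (simp add: t_def)
  have harm: "distr_laplace_eq S (\<lambda>y. v y + t * ln (norm (y - c))) (\<lambda>_. 0)"
  proof -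
    have "c \<notin> S" by (simp add: S_def)
    from distr_laplace_eq_cmult[OF harmonic_in_distr[OF oS harmonic_ln_norm[OF oS this]], of t]
    have "distr_laplace_eq S (\<lambda>y. t * ln (norm (y - c))) (\<lambda>_. 0)" by simp
    from distr_laplace_eq_add[OF distr_laplace_eq_subset[OF v(2) SX] this] show ?thesis by simp
  qed
  have barrier: "v y + t * ln (norm (y - c)) \<le> v z" if "y \<in> A" for y
  proof (rule weak_max_principle[OF harm oS _ cA SA _ that])
    show "continuous_on A (\<lambda>y. v y + t * ln (norm (y - c)))"
      using continuous_on_subset[OF vE AE(1)] by (intro continuous_intros) (auto simp: A_def)
    fix y assume y: "y \<in> A - S"
    then consider "norm (y - c) = 1" | "norm (y - c) = \<rho>" by (force simp: A_def S_def)
    then show "v y + t * ln (norm (y - c)) \<le> v z"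
    proof cases
      case 1
      then show ?thesis using zmax[of y] y AE by auto
    next
      case 2
      then have "v y \<le> v y0" by (intro y0(2)) (simp add: dist_norm norm_minus_commute)
      moreover have "t * ln \<rho> = v z - v y0" using \<rho> by (simp add: t_def)
      ultimately show ?thesis using 2 by simp
    qed
  qed
  obtain g where g: "\<And>\<theta>. \<theta> \<in> {0..2*pi} \<Longrightarrow> has_normal_deriv w c (c + (cos \<theta>, sin \<theta>)) (g \<theta>)"
    "(g has_integral 0) {0..2*pi}"
    using flux[OF j(1)] unfolding zero_flux_def c_def by blast
  \<comment> \<open>As \<open>w\<close> is constant on the circle, every point of it is a maximum
    point, so the lower bound holds for all angles and contradicts the vanishing of the integral of
    \<open>g\<close>.\<close>
  have "t / 2 \<le> g \<theta>" if "\<theta> \<in> {0..2*pi}" for \<theta>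
  proof -
    define y where "y = c + (cos \<theta>, sin \<theta>)"
    have ny: "norm (y - c) = 1" by (simp add: y_def norm_Pair)
    define f where "f s = w (y + s *\<^sub>R (c - y))" for s
    have "(f has_real_derivative g \<theta>) (at 0 within {..0})"
      using g(1)[OF that] unfolding has_normal_deriv_def f_def y_def .
    then have lim: "((\<lambda>s. (f s - f 0) / (s - 0)) \<longlongrightarrow> g \<theta>) (at 0 within {..0})"
      by (simp add: has_field_derivative_iff)
    have f0: "f 0 = v z" using bd[OF j(1), of y] ny dj by (simp add: f_def c_def dist_norm norm_minus_commute)
    \<comment> \<open>Negative s means a point outside the disk, as c - y points inward. The
      restriction s > - 1/2 is for log (1 - s) \<ge> - s - s^2 \<ge> - s / 2, and s > 1 - \<rho>
      keeps the point in the annulus.\<close>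
    have low: "t / 2 \<le> (f s - f 0) / (s - 0)" if s: "s < 0" "s > - min (1/2) (\<rho> - 1)" for s
    proof -
      have "y + s *\<^sub>R (c - y) - c = (1 - s) *\<^sub>R (y - c)" by (simp add: algebra_simps)
      then have n: "norm (y + s *\<^sub>R (c - y) - c) = 1 - s" using ny s by simp
      then have inA: "y + s *\<^sub>R (c - y) \<in> A" using s by (auto simp: A_def)
      then have "f s + t * ln (1 - s) \<le> v z"
        using barrier[OF inA] n vw AE(2) by (metis f_def)
      moreover have "(- s) - (- s)\<^sup>2 \<le> ln (1 + (- s))"
        by (rule ln_one_plus_pos_lower_bound) (use s in auto)
      moreover have "(- s) / 2 \<le> (- s) - (- s)\<^sup>2"
      proof -
        have "(- s) * (- s) \<le> (- s) * (1/2)" using s by (intro mult_left_mono) auto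
        then show ?thesis by (simp add: power2_eq_square)
      qed
      ultimately have "f s + t * ((- s) / 2) \<le> v z"
        using t mult_left_mono[of "(- s) / 2" "ln (1 - s)" t] by simp
      then show ?thesis using s f0 by (simp add: field_simps)
    qed
    show ?thesis
    proof (rule tendsto_lowerbound[OF lim])
      show "\<forall>\<^sub>F s in at 0 within {..0}. t / 2 \<le> (f s - f 0) / (s - 0)"
        unfolding eventually_at
        by (rule exI[of _ "min (1/2) (\<rho> - 1)"]) (use low \<rho> in \<open>auto simp: dist_real_def\<close>)
      show "at (0::real) within {..0} \<noteq> bot" by (simp add: at_within_Iic_at_left)
    qed
  qed
  from has_integral_le[OF has_integral_const_real g(2) this]
  have "(2 * pi) * (t / 2) \<le> 0" by simp
  then show False using t pi_gt_zero by (simp add: mult_le_0_iff)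
qed

lemma has_normal_deriv_cmult:
  "has_normal_deriv u c y g \<Longrightarrow> has_normal_deriv (\<lambda>x. k * u x) c y (k * g)"
  unfolding has_normal_deriv_def by (rule DERIV_cmult)

lemma zero_flux_cmult:
  assumes "zero_flux u c"
  shows "zero_flux (\<lambda>x. k * u x) c"
proof -
  obtain g where g: "\<And>\<theta>. \<theta> \<in> {0..2*pi} \<Longrightarrow> has_normal_deriv u c (c + (cos \<theta>, sin \<theta>)) (g \<theta>)"
    "(g has_integral 0) {0..2*pi}" using assms unfolding zero_flux_def by blast
  then show ?thesis unfolding zero_flux_def
    using has_normal_deriv_cmult has_integral_mult_right[OF g(2), of k]
    by (intro exI[of _ "\<lambda>\<theta>. k * g \<theta>"]) auto
qed

lemma zero_flux_diff:
  assumes "zero_flux u c" "zero_flux v c"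
  shows "zero_flux (\<lambda>x. u x - v x) c"
proof -
  obtain g where g: "\<And>\<theta>. \<theta> \<in> {0..2*pi} \<Longrightarrow> has_normal_deriv u c (c + (cos \<theta>, sin \<theta>)) (g \<theta>)"
    "(g has_integral 0) {0..2*pi}" using assms unfolding zero_flux_def by blast
  obtain h where h: "\<And>\<theta>. \<theta> \<in> {0..2*pi} \<Longrightarrow> has_normal_deriv v c (c + (cos \<theta>, sin \<theta>)) (h \<theta>)"
    "(h has_integral 0) {0..2*pi}" using assms unfolding zero_flux_def by blast
  show ?thesis unfolding zero_flux_def
    using g(1) h(1) has_integral_diff[OF g(2) h(2)]
    by (intro exI[of _ "\<lambda>\<theta>. g \<theta> - h \<theta>"]) (auto simp: has_normal_deriv_def intro: DERIV_diff)
qed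

theorem exterior_solution_zero:
  fixes w :: "R2 \<Rightarrow> real"
  assumes \<epsilon>: "\<epsilon> > 0" and P: "P \<in> exterior_dom \<epsilon>"
    and w: "continuous_on (closed_ext \<epsilon> - {P}) w" "distr_laplace_eq (exterior_dom \<epsilon>) w (\<lambda>_. 0)"
    and bd: "\<And>j x. j \<in> {1, 2} \<Longrightarrow> x \<in> sphere (center \<epsilon> j) 1 \<Longrightarrow> w x = d j"
    and flux: "\<And>j. j \<in> {1, 2} \<Longrightarrow> zero_flux w (center \<epsilon> j)"
    and inf: "(w \<longlongrightarrow> 0) at_infinity" and x: "x \<in> closed_ext \<epsilon> - {P}"
  shows "w x = 0"
proof -
  have "w x \<le> 0" by (rule exterior_solution_nonpos[OF assms])
  moreover have "- 1 * w x \<le> 0"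
  proof (rule exterior_solution_nonpos[OF \<epsilon> P _ _ _ _ _ x, of _ "\<lambda>j. - 1 * d j"])
    show "continuous_on (closed_ext \<epsilon> - {P}) (\<lambda>x. - 1 * w x)" by (intro continuous_intros w)
    show "distr_laplace_eq (exterior_dom \<epsilon>) (\<lambda>x. - 1 * w x) (\<lambda>_. 0)"
      using distr_laplace_eq_cmult[OF w(2), of "- 1"] by simp
    show "((\<lambda>x. - 1 * w x) \<longlongrightarrow> 0) at_infinity" using tendsto_mult_left[OF inf, of "- 1"] by simp
  qed (use bd zero_flux_cmult[OF flux, of _ "- 1"] in auto)
  ultimately show ?thesis by simp
qed

section \<open>Dipoles in a strip\<close>

lemma norm_cos_sq: "(norm (cos z))\<^sup>2 = (cos (Re z))\<^sup>2 + (sinh (Im z))\<^sup>2"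
  unfolding norm_cos_squared by (simp add: sinh_def exp_minus power2_eq_square)

lemma norm_sin_sq: "(norm (sin z))\<^sup>2 = (sin (Re z))\<^sup>2 + (sinh (Im z))\<^sup>2"
proof -
  have "(norm (sin z))\<^sup>2 = (norm (cos (of_real pi / 2 - z)))\<^sup>2" by (simp add: sin_cos_eq)
  also have "\<dots> = (cos (pi / 2 - Re z))\<^sup>2 + (sinh (Im z))\<^sup>2" by (simp add: norm_cos_sq)
  finally show ?thesis by (simp add: sin_cos_eq)
qed

lemma sin_lower: "\<bar>x\<bar> \<le> pi / 4 \<Longrightarrow> \<bar>x\<bar> / 2 \<le> \<bar>sin x\<bar>"
proof -
  have main: "x / 2 \<le> sin x" if "0 \<le> x" "x \<le> pi / 4" for x
  proof -
    have "sin 0 - 0 / 2 \<le> sin x - x / 2"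
    proof (rule DERIV_nonneg_imp_nondecreasing[OF that(1)])
      fix y assume y: "0 \<le> y" "y \<le> x"
      have "cos (pi / 3) \<le> cos y"
        using y that pi_gt_zero by (intro cos_monotone_0_pi_le) auto
      then have "cos y - 1 / 2 \<ge> 0" by (simp add: cos_60)
      moreover have "((\<lambda>y. sin y - y / 2) has_real_derivative cos y - 1 / 2) (at y)"
        by (auto intro!: derivative_eq_intros)
      ultimately show "\<exists>d. ((\<lambda>y. sin y - y / 2) has_real_derivative d) (at y) \<and> 0 \<le> d" by blast
    qed
    then show ?thesis by simp
  qed
  assume "\<bar>x\<bar> \<le> pi / 4"
  then show ?thesis
    using main[of "\<bar>x\<bar>"] by (cases "x \<ge> 0") auto
qed

lemma sinh_lower: "(y::real)\<^sup>2 \<le> (sinh y)\<^sup>2"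
proof -
  have main: "y \<le> sinh y" if "0 \<le> y" for y :: real
  proof -
    have "sinh 0 - 0 \<le> sinh y - y"
    proof (rule DERIV_nonneg_imp_nondecreasing[OF that])
      fix t :: real
      have "((\<lambda>y. sinh y - y) has_real_derivative cosh t - 1) (at t)"
        by (auto intro!: derivative_eq_intros)
      moreover have "cosh t - 1 \<ge> 0" using cosh_real_ge_1[of t] by simp
      ultimately show "\<exists>d. ((\<lambda>y. sinh y - y) has_real_derivative d) (at t) \<and> 0 \<le> d" by blast
    qed
    then show ?thesis by simp
  qed
  have "\<bar>y\<bar> \<le> \<bar>sinh y\<bar>" using main[of "\<bar>y\<bar>"] by (cases "y \<ge> 0") auto
  then show ?thesis by (simp add: abs_le_square_iff)
qed

text \<open>The square of sinh y grows like exp (2 |y|) / 4. One factor exp |y| is kept and the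
  other absorbs x^2 + y^2 when |y| > 1, the case that costs the constant 64; for |y| \<le> 1 linear
  lower bounds for sine and sinh suffice.\<close>

lemma sin_sinh_lower:
  fixes x y :: real
  assumes x: "\<bar>x\<bar> \<le> pi / 4"
  shows "(x\<^sup>2 + y\<^sup>2) * exp \<bar>y\<bar> \<le> 64 * ((sin x)\<^sup>2 + (sinh y)\<^sup>2)"
proof (cases "\<bar>y\<bar> \<le> 1")
  case True
  have "exp \<bar>y\<bar> \<le> exp 1" using True by simp
  then have e: "exp \<bar>y\<bar> \<le> 3" using exp_le by linarith
  have "(\<bar>x\<bar> / 2)\<^sup>2 \<le> \<bar>sin x\<bar>\<^sup>2" by (rule power_mono[OF sin_lower[OF x]]) simp
  then have "x\<^sup>2 \<le> 4 * (sin x)\<^sup>2" by (simp add: power_divide)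
  then have 1: "x\<^sup>2 + y\<^sup>2 \<le> 4 * ((sin x)\<^sup>2 + (sinh y)\<^sup>2)" 
    using add_mono[OF _ order_trans[OF sinh_lower[of y], of "4 * (sinh y)\<^sup>2"]] by simp
  have "(x\<^sup>2 + y\<^sup>2) * exp \<bar>y\<bar> \<le> (4 * ((sin x)\<^sup>2 + (sinh y)\<^sup>2)) * 3"
    by (rule mult_mono[OF 1 e]) auto
  also have "\<dots> \<le> 64 * ((sin x)\<^sup>2 + (sinh y)\<^sup>2)" by simp
  finally show ?thesis .
next
  case False
  define t where "t = \<bar>y\<bar>"
  have t: "t > 1" "y\<^sup>2 = t\<^sup>2" "(sinh y)\<^sup>2 = (sinh t)\<^sup>2" using False by (auto simp: t_def abs_if)
  have "x\<^sup>2 \<le> 1"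
  proof -
    have "\<bar>x\<bar> \<le> 1" using x pi_less_4 by linarith
    then show ?thesis by (simp add: abs_square_le_1)
  qed
  also have "1 \<le> t\<^sup>2" using t(1) by (simp add: one_le_power)
  finally have "x\<^sup>2 + y\<^sup>2 \<le> 2 * t\<^sup>2" using t by simp
  also have "t\<^sup>2 \<le> 2 * exp t" using exp_lower_Taylor_quadratic[of t] t(1) by simp
  finally have 1: "x\<^sup>2 + y\<^sup>2 \<le> 4 * exp t" by simp
  have "exp (- t) \<le> exp t / 2"
  proof -
    have "2 \<le> exp t" using exp_ge_add_one_self[of t] t(1) by linarith
    moreover have "exp (- t) \<le> 1" using t(1) by simp
    ultimately show ?thesis by linarith
  qed
  then have s: "exp t / 4 \<le> sinh t" by (simp add: sinh_def)
  have "(exp t / 4)\<^sup>2 \<le> (sinh t)\<^sup>2" by (rule power_mono[OF s]) simp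
  then have "exp t * exp t \<le> 16 * (sinh t)\<^sup>2" by (simp add: power2_eq_square)
  then have "4 * exp t * exp t \<le> 64 * (sinh y)\<^sup>2" using t by simp
  moreover have "(x\<^sup>2 + y\<^sup>2) * exp t \<le> 4 * exp t * exp t" by (rule mult_right_mono[OF 1]) simp
  moreover have "64 * (sinh y)\<^sup>2 \<le> 64 * ((sin x)\<^sup>2 + (sinh y)\<^sup>2)" by simp
  ultimately show ?thesis unfolding t_def by linarith
qed

locale strip =
  fixes s0 :: real and b :: complex
  assumes s0: "s0 > 0"
begin

text \<open>With this scale the cotangent of \<kappa> t has period 4 s0, the translation composed of
  the reflections in the two boundary lines. The poles of the tangent, at odd multiples of 2 s0, are
  the mirror images of the dipole, of strength \<open>cnj b\<close>.\<close>

definition \<kappa> :: real where "\<kappa> = pi / (4 * s0)"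

lemma \<kappa>_pos: "\<kappa> > 0" using s0 by (simp add: \<kappa>_def)

abbreviation kc :: complex where "kc \<equiv> complex_of_real \<kappa>"

text \<open>\<open>Re F\<close> is the dipole of strength \<open>b\<close> at \<open>0\<close> in the strip \<open>\<bar>Re t\<bar> < s0\<close> with zero
  boundary values.\<close>

definition F :: "complex \<Rightarrow> complex" where
  "F t = kc * (b * (cos (kc * t) / sin (kc * t)) - cnj b * (sin (kc * t) / cos (kc * t)))"

definition F' :: "complex \<Rightarrow> complex" where
  "F' t = - kc\<^sup>2 * (b / (sin (kc * t))\<^sup>2 + cnj b / (cos (kc * t))\<^sup>2)"

lemma F_deriv:
  assumes "sin (kc * t) \<noteq> 0" "cos (kc * t) \<noteq> 0"
  shows "(F has_field_derivative F' t) (at t)"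
proof -
  have s: "((\<lambda>t. sin (kc * t)) has_field_derivative kc * cos (kc * t)) (at t)"
    and c: "((\<lambda>t. cos (kc * t)) has_field_derivative - kc * sin (kc * t)) (at t)"
    by (auto intro!: derivative_eq_intros)
  have "((\<lambda>t. cos (kc * t) / sin (kc * t)) has_field_derivative - kc / (sin (kc * t))\<^sup>2) (at t)"
  proof (rule DERIV_cong[OF DERIV_divide[OF c s assms(1)]])
    have "- k * S * S - C * (k * C) = - k * (C * C + S * S)" for k S C :: complex
      by (simp add: algebra_simps)
    then have "- kc * sin (kc * t) * sin (kc * t) - cos (kc * t) * (kc * cos (kc * t))
        = - kc * (cos (kc * t) * cos (kc * t) + sin (kc * t) * sin (kc * t))" .
    also have "\<dots> = - kc" by (simp only: sin_cos_squared_add3 mult_1_right)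
    finally show "(- kc * sin (kc * t) * sin (kc * t) - cos (kc * t) * (kc * cos (kc * t))) / (sin (kc * t) * sin (kc * t))
        = - kc / (sin (kc * t))\<^sup>2"
      by (simp only: power2_eq_square)
  qed
  moreover have "((\<lambda>t. sin (kc * t) / cos (kc * t)) has_field_derivative kc / (cos (kc * t))\<^sup>2) (at t)"
  proof (rule DERIV_cong[OF DERIV_divide[OF s c assms(2)]])
    have "k * C * C - S * (- k * S) = k * (C * C + S * S)" for k S C :: complex
      by (simp add: algebra_simps)
    then have "kc * cos (kc * t) * cos (kc * t) - sin (kc * t) * (- kc * sin (kc * t))
        = kc * (cos (kc * t) * cos (kc * t) + sin (kc * t) * sin (kc * t))" .
    also have "\<dots> = kc" by (simp only: sin_cos_squared_add3 mult_1_right)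
    finally show "(kc * cos (kc * t) * cos (kc * t) - sin (kc * t) * (- kc * sin (kc * t))) / (cos (kc * t) * cos (kc * t))
        = kc / (cos (kc * t))\<^sup>2"
      by (simp only: power2_eq_square)
  qed
  ultimately have "((\<lambda>t. kc * (b * (cos (kc * t) / sin (kc * t)) - cnj b * (sin (kc * t) / cos (kc * t)))) has_field_derivative
      kc * (b * (- kc / (sin (kc * t))\<^sup>2) - cnj b * (kc / (cos (kc * t))\<^sup>2))) (at t)"
    by (intro DERIV_cmult DERIV_diff)
  moreover have "kc * (b * (- kc / (sin (kc * t))\<^sup>2) - cnj b * (kc / (cos (kc * t))\<^sup>2)) = F' t"
    by (simp add: F'_def power2_eq_square algebra_simps)
  ultimately show ?thesis unfolding F_def[abs_def] by simp
qed

lemma Re_\<kappa>: "\<bar>Re t\<bar> < 2 * s0 \<Longrightarrow> \<bar>Re (kc * t)\<bar> < pi / 2" "\<bar>Re t\<bar> \<le> s0 \<Longrightarrow> \<bar>Re (kc * t)\<bar> \<le> pi / 4"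
  using s0 pi_gt_zero by (auto simp: \<kappa>_def abs_mult field_simps)

lemma cos_nonzero:
  assumes "\<bar>Re t\<bar> < 2 * s0"
  shows "cos (kc * t) \<noteq> 0"
proof -
  have "cos (Re (kc * t)) > 0" using Re_\<kappa>(1)[OF assms] by (intro cos_gt_zero_pi; linarith)
  then have "(norm (cos (kc * t)))\<^sup>2 > 0" unfolding norm_cos_sq by (intro add_pos_nonneg) auto
  then show ?thesis by auto
qed

lemma sin_nonzero:
  assumes "\<bar>Re t\<bar> < 2 * s0" "t \<noteq> 0"
  shows "sin (kc * t) \<noteq> 0"
proof (cases "Im t = 0")
  case False
  then have "sinh (Im (kc * t)) \<noteq> 0" using \<kappa>_pos by simp
  then have "(norm (sin (kc * t)))\<^sup>2 > 0" unfolding norm_sin_sq by (intro add_nonneg_pos) auto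
  then show ?thesis by auto
next
  case True
  then have "Re t \<noteq> 0" using assms(2) by (simp add: complex_eq_iff)
  then have x: "Re (kc * t) \<noteq> 0" using \<kappa>_pos by simp
  have "sin (Re (kc * t)) \<noteq> 0"
  proof
    assume "sin (Re (kc * t)) = 0"
    moreover have "- pi < Re (kc * t)" "Re (kc * t) < pi"
      using Re_\<kappa>(1)[OF assms(1)] pi_gt_zero by linarith+
    ultimately have "Re (kc * t) = 0" using sin_eq_0_pi by blast
    with x show False by simp
  qed
  then have "(norm (sin (kc * t)))\<^sup>2 > 0" unfolding norm_sin_sq by (intro add_pos_nonneg) auto
  then show ?thesis by auto
qed

text \<open>In the strip |Re (\<kappa> t)| \<le> \<pi>/4, so |sin| \<le> |cos| and the tangent
  contributes no more than the cotangent. The rate \<kappa> is half of the true one; the other half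
  pays for the factor 1 / |t|^2.\<close>

lemma F'_bound:
  assumes "\<bar>Re t\<bar> \<le> s0" "t \<noteq> 0"
  shows "norm (F' t) \<le> 128 * norm b / (norm t)\<^sup>2 * exp (- \<kappa> * \<bar>Im t\<bar>)"
proof -
  define x where "x = Re (kc * t)"
  define y where "y = Im (kc * t)"
  have x4: "\<bar>x\<bar> \<le> pi / 4" using Re_\<kappa>(2)[OF assms(1)] by (simp add: x_def)
  define N where "N = (norm (sin (kc * t)))\<^sup>2"
  have N: "N = (sin x)\<^sup>2 + (sinh y)\<^sup>2" by (simp add: N_def norm_sin_sq x_def y_def)
  have "sin (kc * t) \<noteq> 0" using assms s0 by (intro sin_nonzero) auto
  then have Npos: "N > 0" by (simp add: N_def)
  have sc: "(sin x)\<^sup>2 \<le> (cos x)\<^sup>2"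
  proof -
    have "cos (2 * x) \<ge> 0" using x4 by (intro cos_ge_zero) auto
    then show ?thesis by (simp add: cos_double)
  qed
  then have NC: "N \<le> (norm (cos (kc * t)))\<^sup>2" by (simp add: N norm_cos_sq x_def y_def)
  have "(x\<^sup>2 + y\<^sup>2) * exp \<bar>y\<bar> \<le> 64 * N" unfolding N by (rule sin_sinh_lower[OF x4])
  moreover have "x\<^sup>2 + y\<^sup>2 = \<kappa>\<^sup>2 * (norm t)\<^sup>2"
    by (simp add: x_def y_def cmod_power2 power_mult_distrib distrib_left)
  moreover have y: "\<bar>y\<bar> = \<kappa> * \<bar>Im t\<bar>" using \<kappa>_pos by (simp add: y_def abs_mult)
  ultimately have key: "\<kappa>\<^sup>2 * (norm t)\<^sup>2 * exp (\<kappa> * \<bar>Im t\<bar>) \<le> 64 * N" by simp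
  have "norm (F' t) = \<kappa>\<^sup>2 * norm (b / (sin (kc * t))\<^sup>2 + cnj b / (cos (kc * t))\<^sup>2)"
    unfolding F'_def by (simp add: norm_mult norm_power)
  also have "\<dots> \<le> \<kappa>\<^sup>2 * (norm b / N + norm b / N)"
  proof (intro mult_left_mono)
    have "norm (cnj b / (cos (kc * t))\<^sup>2) \<le> norm b / N"
      using NC Npos by (simp add: norm_divide norm_power frac_le)
    moreover have "norm (b / (sin (kc * t))\<^sup>2) = norm b / N" by (simp add: norm_divide norm_power N_def)
    ultimately show "norm (b / (sin (kc * t))\<^sup>2 + cnj b / (cos (kc * t))\<^sup>2) \<le> norm b / N + norm b / N"
      using norm_triangle_ineq[of "b / (sin (kc * t))\<^sup>2" "cnj b / (cos (kc * t))\<^sup>2"] by linarith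
  qed simp
  also have "\<dots> = 2 * norm b * (\<kappa>\<^sup>2 / N)" by simp
  also have "\<dots> \<le> 2 * norm b * (64 / ((norm t)\<^sup>2 * exp (\<kappa> * \<bar>Im t\<bar>)))"
  proof (intro mult_left_mono)
    have "(norm t)\<^sup>2 * exp (\<kappa> * \<bar>Im t\<bar>) > 0" using assms(2) by simp
    then show "\<kappa>\<^sup>2 / N \<le> 64 / ((norm t)\<^sup>2 * exp (\<kappa> * \<bar>Im t\<bar>))"
      using key Npos by (simp add: divide_le_eq le_divide_eq mult_ac)
  qed simp
  finally show ?thesis by (simp add: exp_minus divide_inverse mult.assoc)
qed

lemma F_odd: "F (- t) = - F t"
  by (simp add: F_def algebra_simps)

text \<open>In terms of E = exp (2 i \<kappa> w), which is small for large Im w, cotangent and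
  tangent are rational functions close to -i and i. Hence the limit - 2 i \<kappa> Re b, with an
  error of the order of E.\<close>

lemma F_near_infinity:
  assumes h: "h > 0" and w: "Im w \<ge> h"
  shows "norm (F w + 2 * \<i> * \<kappa> * Re b) \<le> 4 * \<kappa> * norm b * (exp (- 2 * \<kappa> * h) / (1 - exp (- 2 * \<kappa> * h)))"
proof -
  define u where "u = exp (\<i> * (kc * w))"
  define E where "E = u * u"
  define q where "q = exp (- 2 * \<kappa> * h)"
  have q1: "0 < q" "q < 1" using \<kappa>_pos h by (auto simp: q_def)
  have u0: "u \<noteq> 0" by (simp add: u_def)
  have "norm u = exp (- (\<kappa> * Im w))" by (simp add: u_def)
  then have nE: "norm E = exp (- 2 * \<kappa> * Im w)" by (simp add: E_def norm_mult flip: exp_add)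
  have Eq: "norm E \<le> q" unfolding nE q_def using w \<kappa>_pos by simp
  then have E1: "E - 1 \<noteq> 0" "E + 1 \<noteq> 0"
    using q1 by (auto simp: eq_neg_iff_add_eq_0[symmetric])
  have lo: "1 - q \<le> norm (E - 1)" "1 - q \<le> norm (E + 1)"
    using Eq norm_triangle_ineq3[of E 1] norm_triangle_ineq3[of "-1" E] norm_triangle_sub[of 1 "- E"] norm_triangle_sub[of 1 E]
    by (auto simp: norm_minus_commute add.commute)
  have eu: "exp (- (\<i> * (kc * w))) = 1 / u" unfolding u_def exp_minus by (rule inverse_eq_divide)
  have sn: "sin (kc * w) = - \<i> * ((E - 1) / u) / 2" and csn: "cos (kc * w) = ((E + 1) / u) / 2"
    unfolding sin_exp_eq' cos_exp_eq eu u_def[symmetric] using u0 by (simp_all add: E_def field_simps)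
  have nz: "sin (kc * w) \<noteq> 0" "cos (kc * w) \<noteq> 0" unfolding sn csn using u0 E1 by auto
  have "cos (kc * w) = \<i> * ((E + 1) / (E - 1)) * sin (kc * w)"
    "sin (kc * w) = - \<i> * ((E - 1) / (E + 1)) * cos (kc * w)"
  proof -
    have "B / u / 2 = \<i> * (B / A) * (- \<i> * (A / u) / 2)" if "A \<noteq> 0" for A B :: complex
      using that u0 by (simp add: field_simps)
    then show "cos (kc * w) = \<i> * ((E + 1) / (E - 1)) * sin (kc * w)" unfolding sn csn using E1 by blast
    have "- \<i> * (A / u) / 2 = - \<i> * (A / B) * (B / u / 2)" if "B \<noteq> 0" for A B :: complex
      using that by simp
    then show "sin (kc * w) = - \<i> * ((E - 1) / (E + 1)) * cos (kc * w)" unfolding sn csn using E1 by blast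
  qed
  then have cs: "cos (kc * w) / sin (kc * w) = \<i> * ((E + 1) / (E - 1))"
    "sin (kc * w) / cos (kc * w) = - \<i> * ((E - 1) / (E + 1))"
    using nz by (metis nonzero_mult_div_cancel_right)+
  have 2: "2 * complex_of_real (Re b) = b + cnj b" by (simp add: complex_add_cnj)
  have "F w + 2 * \<i> * \<kappa> * Re b = F w + \<i> * \<kappa> * (b + cnj b)" using 2 by (simp add: mult_ac)
  also have "\<dots> = \<i> * kc * (b * ((E + 1) / (E - 1) + 1) + cnj b * ((E - 1) / (E + 1) + 1))"
  proof -
    have "kc * (b * (\<i> * X) - cnj b * (- \<i> * Y)) + \<i> * kc * (b + cnj b) = \<i> * kc * (b * (X + 1) + cnj b * (Y + 1))"
      for X Y by (simp add: algebra_simps)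
    then show ?thesis unfolding F_def cs by blast
  qed
  also have "\<dots> = \<i> * kc * (b * (2 * E / (E - 1)) + cnj b * (2 * E / (E + 1)))"
  proof -
    have "(E + 1) / (E - 1) + 1 = 2 * E / (E - 1)" "(E - 1) / (E + 1) + 1 = 2 * E / (E + 1)"
      using E1 by (simp_all add: field_simps)
    then show ?thesis by simp
  qed
  finally have eq: "F w + 2 * \<i> * \<kappa> * Re b = \<i> * kc * (b * (2 * E / (E - 1)) + cnj b * (2 * E / (E + 1)))" .
  have t: "norm (2 * E / (E - 1)) \<le> 2 * (q / (1 - q))" "norm (2 * E / (E + 1)) \<le> 2 * (q / (1 - q))"
    using frac_le[OF _ Eq _ lo(1)] frac_le[OF _ Eq _ lo(2)] q1 by (simp_all add: norm_divide norm_mult)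
  have "norm (b * (2 * E / (E - 1)) + cnj b * (2 * E / (E + 1))) \<le> norm b * (2 * (q / (1 - q))) + norm b * (2 * (q / (1 - q)))"
    by (rule order_trans[OF norm_triangle_ineq add_mono])
      (auto simp only: norm_mult complex_mod_cnj intro!: mult_left_mono t norm_ge_zero)
  then have "norm (F w + 2 * \<i> * \<kappa> * Re b) \<le> \<kappa> * (norm b * (2 * (q / (1 - q))) + norm b * (2 * (q / (1 - q))))"
  proof -
    have n: "norm (\<i> * kc * X) = \<kappa> * norm X" for X using \<kappa>_pos by (simp add: norm_mult)
    show ?thesis
      unfolding eq n using \<kappa>_pos \<open>norm (b * (2 * E / (E - 1)) + cnj b * (2 * E / (E + 1))) \<le> _\<close>
      by (intro mult_left_mono) auto
  qed
  then show ?thesis by (simp add: q_def mult_ac)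
qed

section \<open>Summation over the periods 2\<pi>i\<close>

definition img :: "nat \<Rightarrow> complex" where "img k = \<i> * of_real (2 * pi * real (Suc k))"

text \<open>\<open>F\<close> need not tend to 0 at the ends of the strip, so its translates are not
  summed one by one. The limits at the two ends are opposite, and the images above and below are
  taken in pairs. The unshifted \<open>F\<close> is not among the terms, as \<open>img k\<close>
  uses \<open>Suc k\<close>.\<close>

definition tm where "tm k t = F (t - img k) + F (t + img k)"
definition tm' where "tm' k t = F' (t - img k) + F' (t + img k)"

text \<open>\<open>F\<close> is holomorphic for |Re t| < 2 s0 apart from 0, so the closed strip lies
  in an open domain and one-sided derivatives are avoided on its boundary. \<open>Dom\<close> omits
  all translates of the pole; \<open>Dom0\<close> keeps t = 0, where the sum without
  \<open>F\<close> is regular.\<close>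

definition Dom :: "complex set" where "Dom = {t. \<bar>Re t\<bar> < 2 * s0 \<and> exp t \<noteq> 1}"
definition Dom0 :: "complex set" where "Dom0 = {t. \<bar>Re t\<bar> < 2 * s0 \<and> (exp t \<noteq> 1 \<or> \<bar>Im t\<bar> < 2 * pi)}"

lemma open_Dom: "open Dom" "open Dom0"
proof -
  have 1: "open {t. \<bar>Re t\<bar> < 2 * s0}" "open {t::complex. \<bar>Im t\<bar> < 2 * pi}"
    by (intro open_Collect_less continuous_intros)+
  have 2: "open {t::complex. exp t \<noteq> 1}" by (intro open_Collect_neq continuous_intros)
  have "Dom = {t. \<bar>Re t\<bar> < 2 * s0} \<inter> {t. exp t \<noteq> 1}" by (auto simp: Dom_def)
  then show "open Dom" using 1 2 by auto
  have "Dom0 = {t. \<bar>Re t\<bar> < 2 * s0} \<inter> ({t. exp t \<noteq> 1} \<union> {t. \<bar>Im t\<bar> < 2 * pi})" by (auto simp: Dom0_def)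
  then show "open Dom0" using 1 2 by auto
qed

lemma exp_img: "exp (t - img k) = exp t" "exp (t + img k) = exp t"
proof -
  have "exp (img k) = 1"
    using exp_integer_2pi[of "of_int (int (Suc k))"] by (simp add: img_def mult_ac)
  then show "exp (t - img k) = exp t" "exp (t + img k) = exp t" by (simp_all add: exp_diff exp_add)
qed

lemma Im_img: "Im (img k) = 2 * pi * real (Suc k)" "Re (img k) = 0" "Im (img k) \<ge> 2 * pi"
proof -
  show "Im (img k) = 2 * pi * real (Suc k)" "Re (img k) = 0" by (simp_all add: img_def)
  have "2 * pi * 1 \<le> 2 * pi * real (Suc k)" by (intro mult_left_mono) auto
  then show "Im (img k) \<ge> 2 * pi" by (simp add: img_def)
qed

lemma img_nonzero: "t \<in> Dom0 \<Longrightarrow> t - img k \<noteq> 0 \<and> t + img k \<noteq> 0"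
proof -
  assume t: "t \<in> Dom0"
  have False if "t = img k \<or> t = - img k"
  proof -
    have "exp t = 1" using that exp_img[of 0 k] by auto
    moreover have "\<bar>Im t\<bar> \<ge> 2 * pi" using that Im_img(3)[of k] by auto
    ultimately show False using t by (simp add: Dom0_def)
  qed
  then show ?thesis by (auto simp: eq_neg_iff_add_eq_0)
qed

lemma tm_deriv:
  assumes "t \<in> Dom0"
  shows "(tm k has_field_derivative tm' k t) (at t)"
proof -
  have r: "\<bar>Re (t - img k)\<bar> < 2 * s0" "\<bar>Re (t + img k)\<bar> < 2 * s0"
    using assms by (auto simp: Dom0_def Im_img)
  have "(F has_field_derivative F' (t - img k)) (at (t - img k))" "(F has_field_derivative F' (t + img k)) (at (t + img k))"
    using img_nonzero[OF assms, of k] F_deriv[OF sin_nonzero[OF r(1)] cos_nonzero[OF r(1)]]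
      F_deriv[OF sin_nonzero[OF r(2)] cos_nonzero[OF r(2)]] by blast+
  note Fd = this
  have id: "((\<lambda>t. t - img k) has_field_derivative 1) (at t)" "((\<lambda>t. t + img k) has_field_derivative 1) (at t)"
    by (auto intro!: derivative_eq_intros)
  from DERIV_add[OF DERIV_chain2[OF Fd(1) id(1)] DERIV_chain2[OF Fd(2) id(2)]] show ?thesis by (simp add: tm_def[abs_def] tm'_def)
qed

text \<open>By oddness the pair is a difference of two values of \<open>F\<close> high in the upper
  half plane. Both are close to the same limit, which cancels and leaves geometric decay in
  \<open>k\<close>.\<close>

lemma tm_bound:
  assumes R: "\<bar>Im t\<bar> \<le> R" "2 * pi * real (Suc k) - R \<ge> 1"
  shows "norm (tm k t) \<le> 8 * \<kappa> * norm b * (exp (2 * \<kappa> * R - 4 * pi * \<kappa>) / (1 - exp (- 2 * \<kappa>))) * exp (- 4 * pi * \<kappa>) ^ k"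
proof -
  define h where "h = 2 * pi * real (Suc k) - R"
  define q where "q = exp (- 2 * \<kappa> * h)"
  have h: "h \<ge> 1" using R by (simp add: h_def)
  have qe: "q = exp (2 * \<kappa> * R - 4 * pi * \<kappa>) * exp (- 4 * pi * \<kappa>) ^ k"
    unfolding q_def h_def exp_of_nat_mult[symmetric] exp_add[symmetric] by (simp add: algebra_simps)
  have q1: "q \<le> exp (- 2 * \<kappa>)" "exp (- 2 * \<kappa>) < 1" using h \<kappa>_pos by (auto simp: q_def)
  have "tm k t = (F (t + img k) + 2 * \<i> * \<kappa> * Re b) - (F (- t + img k) + 2 * \<i> * \<kappa> * Re b)"
    using F_odd[of "- t + img k"] by (simp add: tm_def)
  then have "norm (tm k t) \<le> norm (F (t + img k) + 2 * \<i> * \<kappa> * Re b) + norm (F (- t + img k) + 2 * \<i> * \<kappa> * Re b)"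
    by (simp only: norm_triangle_ineq4)
  also have "\<dots> \<le> 4 * \<kappa> * norm b * (q / (1 - q)) + 4 * \<kappa> * norm b * (q / (1 - q))"
    unfolding q_def
  proof (intro add_mono F_near_infinity)
    show "Im (t + img k) \<ge> h" "Im (- t + img k) \<ge> h"
      unfolding plus_complex.sel uminus_complex.sel Im_img h_def using R by linarith+
  qed (use h in auto)
  also have "\<dots> = 8 * \<kappa> * norm b * (q / (1 - q))" by simp
  also have "\<dots> \<le> 8 * \<kappa> * norm b * (q / (1 - exp (- 2 * \<kappa>)))"
    using q1 \<kappa>_pos by (intro mult_left_mono frac_le) (auto simp: q_def)
  finally show ?thesis unfolding qe by (simp add: mult_ac)
qed

definition Gs where "Gs t = (\<Sum>k. tm k t)"
definition Gs' where "Gs' t = (\<Sum>k. tm' k t)"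

lemma Gs:
  assumes "t \<in> Dom0"
  shows "(\<lambda>k. tm k t) sums Gs t" "(\<lambda>k. tm' k t) sums Gs' t" "(Gs has_field_derivative Gs' t) (at t)"
proof -
  have "\<exists>g g'. \<forall>x\<in>Dom0. (\<lambda>n. tm n x) sums g x \<and> (\<lambda>n. tm' n x) sums g' x \<and> (g has_field_derivative g' x) (at x)"
  proof (rule series_and_derivative_comparison_local[OF open_Dom(2) tm_deriv])
    fix x assume "x \<in> Dom0"
    define R where "R = \<bar>Im x\<bar> + 1"
    define h where "h k = 8 * \<kappa> * norm b * (exp (2 * \<kappa> * R - 4 * pi * \<kappa>) / (1 - exp (- 2 * \<kappa>))) * exp (- 4 * pi * \<kappa>) ^ k" for k :: nat
    have "summable h"
      unfolding h_def by (intro summable_mult summable_geometric) (use \<kappa>_pos in simp)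
    moreover have "\<forall>\<^sub>F k in sequentially. \<forall>y\<in>ball x 1 \<inter> Dom0. norm (tm k y) \<le> h k"
    proof -
      have "\<forall>\<^sub>F k in sequentially. k \<ge> nat \<lceil>R + 1\<rceil>" by (rule eventually_ge_at_top)
      then show ?thesis
      proof eventually_elim
        case (elim k)
        have "R + 1 \<le> real k" using elim by linarith
        also have "\<dots> \<le> real (Suc k)" by simp
        also have "\<dots> \<le> 2 * pi * real (Suc k)"
          using pi_gt3 mult_right_mono[of 1 "2 * pi" "real (Suc k)"] by simp
        finally have "2 * pi * real (Suc k) - R \<ge> 1" by simp
        moreover have "\<bar>Im y\<bar> \<le> R" if "y \<in> ball x 1" for y
        proof -
          have "\<bar>Im y - Im x\<bar> \<le> dist x y" using abs_Im_le_cmod[of "y - x"] by (simp add: dist_norm norm_minus_commute)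
          then show ?thesis using that by (simp add: R_def)
        qed
        ultimately show ?case unfolding h_def using tm_bound by blast
      qed
    qed
    ultimately show "\<exists>d h. 0 < d \<and> summable h \<and> (\<forall>\<^sub>F n in sequentially. \<forall>y\<in>ball x d \<inter> Dom0. norm (tm n y) \<le> h n)"
      using zero_less_one by blast
  qed
  then obtain g g' where g: "\<And>x. x \<in> Dom0 \<Longrightarrow> (\<lambda>n. tm n x) sums g x"
    "\<And>x. x \<in> Dom0 \<Longrightarrow> (\<lambda>n. tm' n x) sums g' x"
    "\<And>x. x \<in> Dom0 \<Longrightarrow> (g has_field_derivative g' x) (at x)" by blast
  have eq: "g x = Gs x" "g' x = Gs' x" if "x \<in> Dom0" for x
    using g(1,2)[OF that] unfolding Gs_def Gs'_def by (simp_all add: sums_iff)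
  show "(\<lambda>k. tm k t) sums Gs t" "(\<lambda>k. tm' k t) sums Gs' t"
    using g(1,2)[OF assms] eq[OF assms] by simp_all
  show "(Gs has_field_derivative Gs' t) (at t)"
    using has_field_derivative_transform_within_open[OF g(3)[OF assms] open_Dom(2) assms eq(1)] eq(2)[OF assms] by simp
qed

definition G where "G t = F t + Gs t"
definition G' where "G' t = F' t + Gs' t"

lemma Dom_props: "t \<in> Dom \<Longrightarrow> t \<in> Dom0 \<and> t \<noteq> 0 \<and> \<bar>Re t\<bar> < 2 * s0"
  by (auto simp: Dom_def Dom0_def)

lemma G_deriv:
  assumes "t \<in> Dom"
  shows "(G has_field_derivative G' t) (at t)"
  unfolding G_def[abs_def] G'_def
  using Dom_props[OF assms] by (intro DERIV_add F_deriv Gs sin_nonzero cos_nonzero) auto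

lemma G_partial_sums:
  assumes "t \<in> Dom"
  shows "(\<lambda>N. F t + (\<Sum>k<N. tm k t)) \<longlonglongrightarrow> G t"
  unfolding G_def using Gs(1)[of t] Dom_props[OF assms] by (intro tendsto_intros) (auto simp: sums_def)

lemma F_limit: "(\<lambda>N. F (t + \<i> * of_real (2 * pi * real N))) \<longlonglongrightarrow> - 2 * \<i> * \<kappa> * Re b"
proof -
  define h where "h N = 2 * pi * real N - \<bar>Im t\<bar>" for N
  have inf: "filterlim h at_top sequentially" unfolding h_def by real_asymp
  have "(\<lambda>N. F (t + \<i> * of_real (2 * pi * real N)) + 2 * \<i> * \<kappa> * Re b) \<longlonglongrightarrow> 0"
  proof (rule Lim_null_comparison)
    have "\<forall>\<^sub>F N in sequentially. h N > 0" using inf filterlim_at_top_dense by blast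
    then show "\<forall>\<^sub>F N in sequentially. norm (F (t + \<i> * of_real (2 * pi * real N)) + 2 * \<i> * \<kappa> * Re b)
        \<le> 4 * \<kappa> * norm b * (exp (- 2 * \<kappa> * h N) / (1 - exp (- 2 * \<kappa> * h N)))"
      by eventually_elim (intro F_near_infinity, auto simp: h_def)
    have "filterlim (\<lambda>N. - 2 * \<kappa> * h N) at_bot sequentially"
      by (rule filterlim_tendsto_neg_mult_at_bot[OF tendsto_const _ inf]) (use \<kappa>_pos in simp)
    then have e: "(\<lambda>N. exp (- 2 * \<kappa> * h N)) \<longlonglongrightarrow> 0" by (rule filterlim_compose[OF exp_at_bot])
    have "(\<lambda>N. 4 * \<kappa> * norm b * (exp (- 2 * \<kappa> * h N) / (1 - exp (- 2 * \<kappa> * h N)))) \<longlonglongrightarrow> 4 * \<kappa> * norm b * (0 / (1 - 0))"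
      by (intro tendsto_intros e) auto
    then show "(\<lambda>N. 4 * \<kappa> * norm b * (exp (- 2 * \<kappa> * h N) / (1 - exp (- 2 * \<kappa> * h N)))) \<longlonglongrightarrow> 0" by simp
  qed
  from tendsto_diff[OF this tendsto_const[of "2 * \<i> * \<kappa> * Re b"]] show ?thesis by simp
qed

text \<open>Shifting the symmetric partial sums by one period telescopes to one value of
  \<open>F\<close> far above and one far below. The increment is imaginary, so \<open>Re G\<close>
  is periodic and only the conjugate has a period.\<close>

lemma G_shift:
  fixes t :: complex
  assumes t: "t \<in> Dom"
  shows "G (t + 2 * pi * \<i>) = G t - 4 * \<i> * \<kappa> * Re b"
proof -
  define p :: complex where "p = 2 * pi * \<i>"
  have ep: "exp (t + p) = exp t" by (simp add: exp_add p_def)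
  have tp: "t + p \<in> Dom" using t ep by (auto simp: Dom_def p_def)
  have img: "img k = of_nat (Suc k) * p" for k by (simp add: img_def p_def)
  have diff: "(F (t + p) + (\<Sum>k<N. tm k (t + p))) - (F t + (\<Sum>k<N. tm k t)) = F (t + of_nat (Suc N) * p) - F (t - of_nat N * p)" for N
  proof (induction N)
    case (Suc N)
    have "tm N (t + p) = F (t - of_nat N * p) + F (t + of_nat (Suc (Suc N)) * p)"
      "tm N t = F (t - of_nat (Suc N) * p) + F (t + of_nat (Suc N) * p)"
      unfolding tm_def img by (simp_all add: algebra_simps)
    then show ?case using Suc by (simp add: algebra_simps)
  qed simp
  have "(\<lambda>N. F (t + of_nat (Suc N) * p)) \<longlonglongrightarrow> - 2 * \<i> * \<kappa> * Re b"
    using LIMSEQ_Suc[OF F_limit[of t]] by (simp add: p_def mult_ac)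
  moreover have "(\<lambda>N. F (t - of_nat N * p)) \<longlonglongrightarrow> - (- 2 * \<i> * \<kappa> * Re b)"
  proof -
    have "F (t - of_nat N * p) = - F (- t + \<i> * of_real (2 * pi * real N))" for N
      using F_odd[of "- t + \<i> * of_real (2 * pi * real N)"] by (simp add: p_def mult_ac)
    then show ?thesis using tendsto_minus[OF F_limit[of "- t"]] by (simp only:)
  qed
  ultimately have "(\<lambda>N. F (t + of_nat (Suc N) * p) - F (t - of_nat N * p)) \<longlonglongrightarrow> - 2 * \<i> * \<kappa> * Re b - - (- 2 * \<i> * \<kappa> * Re b)"
    by (rule tendsto_diff)
  moreover have "(\<lambda>N. F (t + of_nat (Suc N) * p) - F (t - of_nat N * p)) \<longlonglongrightarrow> G (t + p) - G t"
    unfolding diff[symmetric] by (intro tendsto_diff G_partial_sums tp t)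
  ultimately have "G (t + p) - G t = - 2 * \<i> * \<kappa> * Re b - - (- 2 * \<i> * \<kappa> * Re b)"
    by (rule LIMSEQ_unique[rotated])
  then show ?thesis by (simp add: p_def algebra_simps)
qed

text \<open>On the boundary Re (\<kappa> t) = \<plusminus>\<pi>/4, hence |sin| = |cos| and the
  cotangent is the conjugate of the tangent. This makes \<open>F t\<close> equal to \<kappa> times a
  difference of two conjugate numbers.\<close>

lemma Re_F_boundary:
  assumes "\<bar>Re t\<bar> = s0"
  shows "Re (F t) = 0"
proof -
  define x where "x = Re (kc * t)"
  have x: "x = pi / 4 \<or> x = - (pi / 4)"
    using assms s0 by (auto simp: x_def \<kappa>_def abs_if field_simps split: if_splits)
  have eq: "(norm (sin (kc * t)))\<^sup>2 = (norm (cos (kc * t)))\<^sup>2"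
    unfolding norm_sin_sq norm_cos_sq x_def[symmetric] using x
    by (elim disjE) (simp_all only: sin_45 cos_45 sin_minus cos_minus power2_minus)
  have nz: "sin (kc * t) \<noteq> 0" "cos (kc * t) \<noteq> 0"
  proof -
    have "\<bar>Re t\<bar> < 2 * s0" "t \<noteq> 0" using assms s0 by auto
    then show "sin (kc * t) \<noteq> 0" "cos (kc * t) \<noteq> 0" by (simp_all only: sin_nonzero cos_nonzero not_False_eq_True)
  qed
  have "sin (kc * t) * cnj (sin (kc * t)) = cos (kc * t) * cnj (cos (kc * t))"
    using eq by (simp only: complex_norm_square[symmetric])
  then have "cos (kc * t) / sin (kc * t) = cnj (sin (kc * t)) / cnj (cos (kc * t))"
    using nz by (simp add: field_simps)
  then have "cos (kc * t) / sin (kc * t) = cnj (sin (kc * t) / cos (kc * t))" by simp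
  then have "F t = kc * (b * cnj (sin (kc * t) / cos (kc * t)) - cnj (b * cnj (sin (kc * t) / cos (kc * t))))"
    unfolding F_def by simp
  moreover have "Re (kc * (w - cnj w)) = 0" for w by simp
  ultimately show ?thesis by (simp only:)
qed

lemma Re_G_boundary:
  assumes "\<bar>Re t\<bar> = s0"
  shows "Re (G t) = 0"
proof -
  have "norm (exp t) \<noteq> 1" using assms s0 by auto
  then have "exp t \<noteq> 1" by (metis norm_one)
  then have t: "t \<in> Dom" using assms s0 by (simp add: Dom_def)
  have "Re (tm k t) = 0" for k
    unfolding tm_def using assms by (simp add: Re_F_boundary Im_img)
  then have "Re (F t + (\<Sum>k<N. tm k t)) = 0" for N
    using Re_F_boundary[OF assms] by simp
  then have "(\<lambda>N. 0) \<longlonglongrightarrow> Re (G t)"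
    using tendsto_Re[OF G_partial_sums[OF t]] by simp
  from LIMSEQ_unique[OF this tendsto_const] show ?thesis by simp
qed

text \<open>As |Im t| \<le> \<pi>, the images with index k have |Im| at least |Im t| + 2\<pi>k, so
  their bounds form a geometric series of ratio exp (- 2 \<pi> \<kappa>) relative to the bound for
  the nearest one.\<close>

lemma G'_bound:
  assumes "\<bar>Re t\<bar> \<le> s0" "\<bar>Im t\<bar> \<le> pi" "t \<noteq> 0"
  shows "norm (G' t) \<le> 128 * norm b / (norm t)\<^sup>2 * exp (- \<kappa> * \<bar>Im t\<bar>) * (1 + 2 / (1 - exp (- 2 * pi * \<kappa>)))"
proof -
  define B where "B = 128 * norm b / (norm t)\<^sup>2 * exp (- \<kappa> * \<bar>Im t\<bar>)"
  define q where "q = exp (- 2 * pi * \<kappa>)"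
  have q: "0 < q" "q < 1" using \<kappa>_pos by (auto simp: q_def)
  have "\<bar>Im t\<bar> < 2 * pi" using assms(2) pi_gt_zero by linarith
  then have t: "t \<in> Dom0" using assms(1) s0 by (simp add: Dom0_def)
  have one: "norm (F' w) \<le> B * q ^ k" if w: "Re w = Re t" "\<bar>Im w\<bar> \<ge> 2 * pi * real (Suc k) - \<bar>Im t\<bar>" for w k
  proof -
    have i: "\<bar>Im w\<bar> \<ge> \<bar>Im t\<bar> + 2 * pi * real k" using w(2) assms(2) by (simp add: algebra_simps)
    have "2 * pi * real k \<ge> 0" by simp
    then have "\<bar>Im w\<bar> \<ge> \<bar>Im t\<bar>" using i by linarith
    then have "(Re t)\<^sup>2 + (Im t)\<^sup>2 \<le> (Re w)\<^sup>2 + (Im w)\<^sup>2" using w(1) by (simp add: abs_le_square_iff)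
    then have n: "(norm t)\<^sup>2 \<le> (norm w)\<^sup>2" by (simp add: cmod_power2)
    have tpos: "(norm t)\<^sup>2 > 0" using assms(3) by simp
    then have "w \<noteq> 0" using n by auto
    then have "norm (F' w) \<le> 128 * norm b / (norm w)\<^sup>2 * exp (- \<kappa> * \<bar>Im w\<bar>)"
      using assms(1) w(1) by (intro F'_bound) auto
    also have "\<dots> \<le> 128 * norm b / (norm t)\<^sup>2 * exp (- \<kappa> * (\<bar>Im t\<bar> + 2 * pi * real k))"
      using n tpos i \<kappa>_pos by (intro mult_mono frac_le) auto
    also have "exp (- \<kappa> * (\<bar>Im t\<bar> + 2 * pi * real k)) = exp (- \<kappa> * \<bar>Im t\<bar>) * q ^ k"
      unfolding q_def exp_of_nat_mult[symmetric] exp_add[symmetric] by (simp add: algebra_simps)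
    finally show ?thesis by (simp add: B_def)
  qed
  have tm: "norm (tm' k t) \<le> (2 * B) * q ^ k" for k
  proof -
    have y: "2 * pi * real (Suc k) \<ge> 0" by simp
    have "norm (F' (t - img k)) \<le> B * q ^ k" "norm (F' (t + img k)) \<le> B * q ^ k"
      by (rule one; use y in \<open>simp only: minus_complex.sel plus_complex.sel Im_img; linarith\<close>)+
    then show ?thesis unfolding tm'_def
      using norm_triangle_ineq[of "F' (t - img k)" "F' (t + img k)"] by linarith
  qed
  have geo: "(\<lambda>k. (2 * B) * q ^ k) sums ((2 * B) * (1 / (1 - q)))"
    by (intro sums_mult geometric_sums) (use q in auto)
  have "norm (Gs' t) \<le> (2 * B) * (1 / (1 - q))"
    using norm_suminf_le[of "\<lambda>k. tm' k t" "\<lambda>k. (2 * B) * q ^ k"] tm geo Gs(2)[OF t]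
    by (simp add: sums_iff)
  moreover have "norm (F' t) \<le> B" unfolding B_def by (rule F'_bound[OF assms(1,3)])
  ultimately have "norm (G' t) \<le> B + (2 * B) * (1 / (1 - q))"
    unfolding G'_def using norm_triangle_ineq[of "F' t" "Gs' t"] by linarith
  then show ?thesis by (simp add: B_def q_def distrib_left)
qed

lemma G_pole: "((\<lambda>t. t * G t) \<longlongrightarrow> b) (at 0)"
proof -
  have "((\<lambda>t. sin (kc * t)) has_field_derivative kc * cos (kc * 0)) (at 0)"
    by (auto intro!: derivative_eq_intros)
  then have "((\<lambda>t. sin (kc * t) / t) \<longlongrightarrow> kc) (at 0)"
    by (simp add: has_field_derivative_iff)
  from tendsto_inverse[OF this] have s: "((\<lambda>t. t / sin (kc * t)) \<longlongrightarrow> 1 / kc) (at 0)"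
    using \<kappa>_pos by (simp add: inverse_eq_divide)
  have c: "((\<lambda>t. cos (kc * t)) \<longlongrightarrow> cos (kc * 0)) (at (0::complex))"
    and s': "((\<lambda>t. sin (kc * t)) \<longlongrightarrow> sin (kc * 0)) (at (0::complex))"
    by (intro tendsto_intros)+
  have g: "(Gs \<longlongrightarrow> Gs 0) (at 0)"
    using DERIV_isCont[OF Gs(3)[of 0]] s0 by (simp add: Dom0_def isCont_def)
  have "((\<lambda>t. kc * (b * (cos (kc * t) * (t / sin (kc * t))) - cnj b * (t * (sin (kc * t) / cos (kc * t)))) + t * Gs t)
      \<longlongrightarrow> kc * (b * (cos (kc * 0) * (1 / kc)) - cnj b * (0 * (sin (kc * 0) / cos (kc * 0)))) + 0 * Gs 0) (at 0)"
    by (intro tendsto_intros c s s' g) auto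
  then have "((\<lambda>t. kc * (b * (cos (kc * t) * (t / sin (kc * t))) - cnj b * (t * (sin (kc * t) / cos (kc * t)))) + t * Gs t)
      \<longlongrightarrow> b) (at 0)" using \<kappa>_pos by simp
  moreover have "kc * (b * (cos (kc * t) * (t / sin (kc * t))) - cnj b * (t * (sin (kc * t) / cos (kc * t)))) + t * Gs t = t * G t" for t
    by (simp add: G_def F_def algebra_simps)
  ultimately show ?thesis by simp
qed

text \<open>Determined by 2\<pi>i Aq = 4 i \<kappa> Re b, the increment in \<open>G_shift\<close>,
  so that \<open>G t + Aq * t\<close> is periodic. It becomes the coefficient of log |M| in
  Q.\<close>

definition Aq :: real where "Aq = 2 * \<kappa> * Re b / pi"

definition Hhat where "Hhat \<mu> = G (Ln \<mu>) + Aq * Ln \<mu>"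

lemma H_periodic:
  fixes t :: complex
  assumes "t \<in> Dom"
  shows "G (t + 2 * pi * \<i>) + Aq * (t + 2 * pi * \<i>) = G t + Aq * t"
  unfolding G_shift[OF assms] using pi_gt_zero by (simp add: Aq_def field_simps)

lemma Ln_Dom: "\<mu> \<noteq> 0 \<Longrightarrow> \<mu> \<noteq> 1 \<Longrightarrow> \<bar>ln (norm \<mu>)\<bar> < 2 * s0 \<Longrightarrow> Ln \<mu> \<in> Dom"
  by (simp add: Dom_def)

text \<open>Across the branch cut of \<open>Ln\<close> the function \<open>Hhat\<close> is continued by periodicity.\<close>

lemma Hhat_deriv:
  assumes \<mu>: "\<mu> \<noteq> 0" "\<mu> \<noteq> 1" "\<bar>ln (norm \<mu>)\<bar> < 2 * s0"
  shows "(Hhat has_field_derivative (G' (Ln \<mu>) + Aq) / \<mu>) (at \<mu>)"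
proof (cases "\<mu> \<in> \<real>\<^sub>\<le>\<^sub>0")
  case False
  have L: "(Ln has_field_derivative 1 / \<mu>) (at \<mu>)" using has_field_derivative_Ln[OF False] by (simp add: inverse_eq_divide)
  have "((\<lambda>\<mu>. G (Ln \<mu>) + Aq * Ln \<mu>) has_field_derivative G' (Ln \<mu>) * (1 / \<mu>) + Aq * (1 / \<mu>)) (at \<mu>)"
    by (intro DERIV_add DERIV_chain2[OF G_deriv[OF Ln_Dom[OF \<mu>]] L] DERIV_cmult L)
  then show ?thesis by (simp add: Hhat_def[abs_def] add_divide_distrib)
next
  case True
  then have re: "Re \<mu> < 0" "Im \<mu> = 0" using \<mu>(1) by (auto simp: complex_nonpos_Reals_iff complex_eq_iff)
  \<comment> \<open>The function Ln (- \<mu>) + i \<pi> is holomorphic near the negative axis; it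
    agrees with \<open>Ln\<close> on the axis and on one side of it, and exceeds it by 2\<pi>i on
    the other.\<close>
  have m: "Ln (- \<mu>) + \<i> * pi = Ln \<mu>" using re \<mu>(1) by (subst Ln_minus) auto
  have nm: "- \<mu> \<notin> \<real>\<^sub>\<le>\<^sub>0" using re by (auto simp: complex_nonpos_Reals_iff)
  have "(uminus has_field_derivative - 1) (at \<mu>)" by (auto intro!: derivative_eq_intros)
  from DERIV_chain2[OF has_field_derivative_Ln[OF nm] this]
  have L: "((\<lambda>\<mu>. Ln (- \<mu>) + \<i> * pi) has_field_derivative 1 / \<mu>) (at \<mu>)"
    using DERIV_add[OF _ DERIV_const[of "\<i> * pi"]] \<mu>(1) by (fastforce simp: inverse_eq_divide)
  have g: "(G has_field_derivative G' (Ln \<mu>)) (at (Ln (- \<mu>) + \<i> * pi))"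
    unfolding m by (rule G_deriv[OF Ln_Dom[OF \<mu>]])
  have d: "((\<lambda>\<mu>. G (Ln (- \<mu>) + \<i> * pi) + Aq * (Ln (- \<mu>) + \<i> * pi)) has_field_derivative G' (Ln \<mu>) * (1 / \<mu>) + Aq * (1 / \<mu>)) (at \<mu>)"
    by (intro DERIV_add DERIV_chain2[OF g L] DERIV_cmult L)
  define U where "U = {\<nu>. Re \<nu> < 0} \<inter> {\<nu>. norm \<nu> < exp (2 * s0)} \<inter> {\<nu>. exp (- 2 * s0) < norm \<nu>}"
  have oU: "open U" unfolding U_def
    by (intro open_Int open_Collect_less continuous_intros)
  have lnU: "\<bar>ln (norm \<nu>)\<bar> < 2 * s0 \<longleftrightarrow> norm \<nu> < exp (2 * s0) \<and> exp (- 2 * s0) < norm \<nu>" if "\<nu> \<noteq> 0" for \<nu> :: complex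
  proof -
    have "norm \<nu> > 0" using that by simp
    then have "ln (norm \<nu>) < 2 * s0 \<longleftrightarrow> norm \<nu> < exp (2 * s0)" "- 2 * s0 < ln (norm \<nu>) \<longleftrightarrow> exp (- 2 * s0) < norm \<nu>"
      by (metis exp_ln exp_less_cancel_iff)+
    then show ?thesis by (auto simp: abs_less_iff)
  qed
  have "\<mu> \<in> U" using re \<mu> lnU[OF \<mu>(1)] by (simp add: U_def)
  have "((\<lambda>\<mu>. G (Ln \<mu>) + Aq * Ln \<mu>) has_field_derivative G' (Ln \<mu>) * (1 / \<mu>) + Aq * (1 / \<mu>)) (at \<mu>)"
  proof (rule has_field_derivative_transform_within_open[OF d oU \<open>\<mu> \<in> U\<close>])
    fix \<nu> assume \<nu>: "\<nu> \<in> U"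
    then have n: "\<nu> \<noteq> 0" "\<nu> \<noteq> 1" by (auto simp: U_def)
    then have D: "Ln \<nu> \<in> Dom" using \<nu> lnU[OF n(1)] by (intro Ln_Dom) (auto simp: U_def)
    have "Ln (- \<nu>) + \<i> * pi = Ln \<nu> \<or> Ln (- \<nu>) + \<i> * pi = Ln \<nu> + 2 * pi * \<i>"
      using n(1) by (subst (1 2) Ln_minus) auto
    then show "G (Ln (- \<nu>) + \<i> * pi) + Aq * (Ln (- \<nu>) + \<i> * pi) = G (Ln \<nu>) + Aq * Ln \<nu>"
    proof
      assume e: "Ln (- \<nu>) + \<i> * pi = Ln \<nu>"
      show ?thesis unfolding e ..
    next
      assume e: "Ln (- \<nu>) + \<i> * pi = Ln \<nu> + 2 * pi * \<i>"
      show ?thesis unfolding e by (rule H_periodic[OF D])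
    qed
  qed
  then show ?thesis by (simp add: Hhat_def[abs_def] add_divide_distrib)
qed

end

section \<open>The explicit solution\<close>

lemma GDERIV_cmult:
  assumes "GDERIV f x :> v"
  shows "GDERIV (\<lambda>x. k * f x) x :> k *\<^sub>R v"
  using GDERIV_mult[OF GDERIV_const[of k x] assms] by simp

locale two_disks =
  fixes \<epsilon> p :: real and a :: R2
  assumes eps: "\<epsilon> > 0"
begin

definition cc :: real where "cc = 1 + \<epsilon> / 2"
definition al :: real where "al = sqrt (cc\<^sup>2 - 1)"
text \<open>On the left circle |z - al| = lam |z + al|, and on the right one the two distances
  exchange roles: both are circles of Apollonius for the points \<plusminus>al.\<close>

definition lam :: real where "lam = cc + al"
definition s0 :: real where "s0 = ln lam"
definition zP :: complex where "zP = Complex 0 p"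

abbreviation ca :: complex where "ca \<equiv> complex_of_real al"

definition mP :: complex where "mP = (zP - ca) / (zP + ca)"

text \<open>A Moebius map onto an annulus, normalized by \<open>M zP = 1\<close>; \<open>ca\<close> and \<open>- ca\<close> are the
  common reflection points of the two circles.\<close>

definition M :: "complex \<Rightarrow> complex" where "M z = (z - ca) / (z + ca) / mP"

text \<open>The derivative of Ln (M z) at the emitter; real because the emitter lies on the vertical
  axis, equidistant from the two disks.\<close>

definition dP :: real where "dP = - (2 * al / (p\<^sup>2 + al\<^sup>2))"
text \<open>Near the emitter t is about dP (z - zP), so the dipole with complex potential
  \<open>cx a\<close> / (2\<pi>(z - zP)) becomes b / t.\<close>

definition b :: complex where "b = cx a * dP / (2 * pi)"
text \<open>The logarithmic derivative of \<open>M\<close>.\<close>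

definition zeta :: "complex \<Rightarrow> complex" where "zeta z = 1 / (z - ca) - 1 / (z + ca)"

lemma cc_gt: "cc > 1" and al2: "al\<^sup>2 = cc\<^sup>2 - 1" and al2_eps: "al\<^sup>2 = \<epsilon> + \<epsilon>\<^sup>2 / 4" and al_pos: "al > 0"
proof -
  show 1: "cc > 1" using eps by (simp add: cc_def)
  then have "cc\<^sup>2 > 1" by (simp add: one_less_power)
  then show 2: "al\<^sup>2 = cc\<^sup>2 - 1" and "al > 0" by (simp_all add: al_def)
  show "al\<^sup>2 = \<epsilon> + \<epsilon>\<^sup>2 / 4" unfolding 2 cc_def by (simp add: power2_eq_square algebra_simps)
qed

lemma lam_gt: "lam > 1" using cc_gt al_pos by (simp add: lam_def)

lemma lam_inverse: "(cc - al) * lam = 1"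
  using al2 by (simp add: lam_def power2_eq_square algebra_simps)

lemma s0_pos: "s0 > 0" using lam_gt by (simp add: s0_def)

lemma exp_s0: "exp s0 = lam" using lam_gt by (simp add: s0_def)

lemma sinh_s0: "sinh s0 = al"
proof -
  have "exp (- s0) = cc - al"
    using lam_inverse lam_gt by (simp add: exp_minus exp_s0 field_simps)
  then show ?thesis by (simp add: sinh_def exp_s0 lam_def)
qed

lemma s0_le_al: "s0 \<le> al"
  using sinh_lower[of s0] s0_pos al_pos by (simp add: sinh_s0 power2_le_iff_abs_le)

sublocale S: strip s0 b
  by unfold_locales (rule s0_pos)

lemma zP_simps: "zP - ca \<noteq> 0" "zP + ca \<noteq> 0" "norm (zP - ca) = norm (zP + ca)" "(norm (zP + ca))\<^sup>2 = p\<^sup>2 + al\<^sup>2"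
  using al_pos by (auto simp: zP_def complex_eq_iff cmod_def)

lemma mP: "mP \<noteq> 0" "mP \<noteq> 1" "norm mP = 1"
  using zP_simps al_pos by (auto simp: mP_def norm_divide)

text \<open>Both sides are quadratic polynomials vanishing on the same circle, hence proportional;
  the computation rests on lam^2 - 1 = 2 al lam and lam^2 + 1 = 2 cc lam. Lying outside a disk thus
  becomes a bound on the ratio of |z - al| and |z + al|.\<close>

lemma mobius_identity:
  "lam\<^sup>2 * (norm (z - ca))\<^sup>2 - (norm (z + ca))\<^sup>2 = (lam\<^sup>2 - 1) * ((norm (z - of_real cc))\<^sup>2 - 1)"
  "lam\<^sup>2 * (norm (z + ca))\<^sup>2 - (norm (z - ca))\<^sup>2 = (lam\<^sup>2 - 1) * ((norm (z + of_real cc))\<^sup>2 - 1)"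
proof -
  define x y where "x = Re z" and "y = Im z"
  have n: "(norm (z - of_real t))\<^sup>2 = (x - t)\<^sup>2 + y\<^sup>2" "(norm (z + of_real t))\<^sup>2 = (x + t)\<^sup>2 + y\<^sup>2" for t
    by (simp_all add: x_def y_def cmod_power2)
  have l1: "lam\<^sup>2 - 1 = 2 * al * lam" and l2: "lam\<^sup>2 + 1 = 2 * cc * lam"
    using al2 by (simp_all add: lam_def power2_eq_square algebra_simps)
  have "lam\<^sup>2 * ((x - al)\<^sup>2 + y\<^sup>2) - ((x + al)\<^sup>2 + y\<^sup>2) = (lam\<^sup>2 - 1) * (x\<^sup>2 + y\<^sup>2 + al\<^sup>2) - 2 * x * al * (lam\<^sup>2 + 1)"
    by (simp add: power2_eq_square algebra_simps)
  also have "\<dots> = (lam\<^sup>2 - 1) * (x\<^sup>2 + y\<^sup>2 + al\<^sup>2 - 2 * x * cc)"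
    unfolding l1 l2 by (simp add: algebra_simps)
  also have "x\<^sup>2 + y\<^sup>2 + al\<^sup>2 - 2 * x * cc = (x - cc)\<^sup>2 + y\<^sup>2 - 1" unfolding al2 by (simp add: power2_diff)
  finally show "lam\<^sup>2 * (norm (z - ca))\<^sup>2 - (norm (z + ca))\<^sup>2 = (lam\<^sup>2 - 1) * ((norm (z - of_real cc))\<^sup>2 - 1)"
    unfolding n .
  have "lam\<^sup>2 * ((x + al)\<^sup>2 + y\<^sup>2) - ((x - al)\<^sup>2 + y\<^sup>2) = (lam\<^sup>2 - 1) * (x\<^sup>2 + y\<^sup>2 + al\<^sup>2) + 2 * x * al * (lam\<^sup>2 + 1)"
    by (simp add: power2_eq_square algebra_simps)
  also have "\<dots> = (lam\<^sup>2 - 1) * (x\<^sup>2 + y\<^sup>2 + al\<^sup>2 + 2 * x * cc)"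
    unfolding l1 l2 by (simp add: algebra_simps)
  also have "x\<^sup>2 + y\<^sup>2 + al\<^sup>2 + 2 * x * cc = (x + cc)\<^sup>2 + y\<^sup>2 - 1" unfolding al2 by (simp add: power2_sum)
  finally show "lam\<^sup>2 * (norm (z + ca))\<^sup>2 - (norm (z - ca))\<^sup>2 = (lam\<^sup>2 - 1) * ((norm (z + of_real cc))\<^sup>2 - 1)"
    unfolding n .
qed

lemma cx_center: "cx (center \<epsilon> 1) = - of_real cc" "cx (center \<epsilon> 2) = of_real cc"
  by (auto simp: complex_eq_iff center_def cc_def)

lemma norm_center: "norm (x - center \<epsilon> 1) = norm (cx x + of_real cc)" "norm (x - center \<epsilon> 2) = norm (cx x - of_real cc)"
  unfolding norm_cx[symmetric] cx_diff cx_center by simp_all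

lemma closed_ext_bounds:
  assumes "x \<in> closed_ext \<epsilon>"
  shows "norm (cx x + ca) \<le> lam * norm (cx x - ca)" "norm (cx x - ca) \<le> lam * norm (cx x + ca)"
proof -
  have l: "lam\<^sup>2 - 1 \<ge> 0" using lam_gt by (simp add: one_le_power less_imp_le)
  have "(norm (cx x - of_real cc))\<^sup>2 - 1 \<ge> 0" "(norm (cx x + of_real cc))\<^sup>2 - 1 \<ge> 0"
    using assms norm_center[of x] by (simp_all add: closed_ext_def one_le_power)
  then have "(norm (cx x + ca))\<^sup>2 \<le> (lam * norm (cx x - ca))\<^sup>2" "(norm (cx x - ca))\<^sup>2 \<le> (lam * norm (cx x + ca))\<^sup>2"
    using mobius_identity[of "cx x"] mult_nonneg_nonneg[OF l] unfolding power_mult_distrib by (smt (verit))+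
  then show "norm (cx x + ca) \<le> lam * norm (cx x - ca)" "norm (cx x - ca) \<le> lam * norm (cx x + ca)"
    using lam_gt by (auto intro!: power2_le_imp_le)
qed

text \<open>The preimage of |Re t| < 2 s0 under Ln (M z), an open neighbourhood of the closed
  exterior domain, so that two-sided derivatives exist at the circles. Without quotients, the
  inequalities also exclude the points \<plusminus>al.\<close>

definition T :: "complex set" where
  "T = {z. norm (z - ca) < exp (2 * s0) * norm (z + ca) \<and> norm (z + ca) < exp (2 * s0) * norm (z - ca)}"

lemma open_T: "open T"
  unfolding T_def by (intro open_Collect_conj open_Collect_less continuous_intros)

lemma T_nonzero: "z \<in> T \<Longrightarrow> z - ca \<noteq> 0" "z \<in> T \<Longrightarrow> z + ca \<noteq> 0"
proof -
  assume z: "z \<in> T"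
  have "\<not> norm (z + ca) < exp (2 * s0) * norm (z - ca)" if "z - ca = 0" unfolding that by simp
  then show "z - ca \<noteq> 0" using z by (auto simp: T_def)
  have "\<not> norm (z - ca) < exp (2 * s0) * norm (z + ca)" if "z + ca = 0" unfolding that by simp
  then show "z + ca \<noteq> 0" using z by (auto simp: T_def)
qed

lemma cx_closed_ext_T: "x \<in> closed_ext \<epsilon> \<Longrightarrow> cx x \<in> T"
proof -
  assume x: "x \<in> closed_ext \<epsilon>"
  note bd = closed_ext_bounds[OF x]
  have ne: "norm (cx x - ca) > 0 \<or> norm (cx x + ca) > 0"
    using al_pos by (auto simp: complex_eq_iff)
  have pos: "norm (cx x - ca) > 0" "norm (cx x + ca) > 0"
    using ne bd lam_gt by (auto simp: zero_less_mult_iff dest: order.strict_trans2)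
  have "lam < lam * lam" using lam_gt by simp
  also have "\<dots> = exp (2 * s0)" by (simp add: exp_double exp_s0 power2_eq_square)
  finally have l: "lam < exp (2 * s0)" .
  show ?thesis
    using bd mult_strict_right_mono[OF l pos(1)] mult_strict_right_mono[OF l pos(2)] by (auto simp: T_def)
qed

lemma zP_T: "zP \<in> T"
proof -
  have "1 < exp (2 * s0)" using s0_pos by simp
  then have "norm (zP + ca) < exp (2 * s0) * norm (zP + ca)" using zP_simps(2) by simp
  then show ?thesis by (simp add: T_def zP_simps(3))
qed

definition lm :: "complex \<Rightarrow> real" where "lm z = ln (norm (z - ca)) - ln (norm (z + ca))"

lemma M_props:
  assumes z: "z \<in> T"
  shows "M z \<noteq> 0" "ln (norm (M z)) = lm z" "\<bar>ln (norm (M z))\<bar> < 2 * s0"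
    "M z = 1 \<longleftrightarrow> z = zP" "(M has_field_derivative M z * zeta z) (at z)" "Re (Ln (M z)) = lm z"
proof -
  note nz = T_nonzero[OF z]
  show M0: "M z \<noteq> 0" using nz mP by (simp add: M_def)
  show l: "ln (norm (M z)) = lm z" using nz mP by (simp add: M_def lm_def norm_divide norm_mult ln_div)
  show "Re (Ln (M z)) = lm z" using l M0 by simp
  have p: "norm (z - ca) > 0" "norm (z + ca) > 0" using nz by simp_all
  have "ln (norm (z - ca)) < ln (exp (2 * s0) * norm (z + ca))" "ln (norm (z + ca)) < ln (exp (2 * s0) * norm (z - ca))"
    using z p by (auto simp: T_def)
  then have "ln (norm (z - ca)) < 2 * s0 + ln (norm (z + ca))" "ln (norm (z + ca)) < 2 * s0 + ln (norm (z - ca))"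
    using p by (simp_all add: ln_mult_pos)
  then show "\<bar>ln (norm (M z))\<bar> < 2 * s0" unfolding l lm_def by linarith
  show "M z = 1 \<longleftrightarrow> z = zP"
  proof -
    have "M z = 1 \<longleftrightarrow> (z - ca) / (z + ca) = mP"
      unfolding M_def using mP(1) by (simp only: divide_eq_1_iff) simp
    also have "\<dots> \<longleftrightarrow> (z - ca) * (zP + ca) = (zP - ca) * (z + ca)"
      using nz zP_simps by (simp add: mP_def frac_eq_eq)
    also have "\<dots> \<longleftrightarrow> 2 * ca * (z - zP) = 0" by (auto simp: algebra_simps)
    finally show ?thesis using al_pos by simp
  qed
  have "((\<lambda>z. z - ca) has_field_derivative 1) (at z)" "((\<lambda>z. z + ca) has_field_derivative 1) (at z)"
    by (auto intro!: derivative_eq_intros)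
  from DERIV_cdivide[OF DERIV_divide[OF this nz(2)], of mP]
  have "(M has_field_derivative (1 * (z + ca) - (z - ca) * 1) / ((z + ca) * (z + ca)) / mP) (at z)"
    by (simp add: M_def[abs_def])
  moreover have "(1 * (z + ca) - (z - ca) * 1) / ((z + ca) * (z + ca)) / mP = M z * zeta z"
    using nz mP(1) by (simp add: M_def zeta_def divide_simps) (simp add: algebra_simps)?
  ultimately show "(M has_field_derivative M z * zeta z) (at z)" by simp
qed

lemma zeta_eq: "z - ca \<noteq> 0 \<Longrightarrow> z + ca \<noteq> 0 \<Longrightarrow> zeta z = 2 * ca / ((z - ca) * (z + ca))"
  by (simp add: zeta_def divide_simps)

lemma zeta_zP: "zeta zP = dP"
proof -
  have "(zP - ca) * (zP + ca) = - of_real (p\<^sup>2 + al\<^sup>2)"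
    by (auto simp: zP_def complex_eq_iff power2_eq_square)
  then show ?thesis
    unfolding zeta_eq[OF zP_simps(1,2)] dP_def
    by (simp only: of_real_minus of_real_divide of_real_mult of_real_numeral minus_divide_right)
qed

text \<open>Single-valued, since \<open>S.Hhat\<close> is; hence the fluxes of \<open>Re U\<close> vanish.\<close>

definition U :: "complex \<Rightarrow> complex" where "U z = S.Hhat (M z)"
definition U' :: "complex \<Rightarrow> complex" where "U' z = (S.G' (Ln (M z)) + S.Aq) * zeta z"

lemma U_deriv:
  assumes "z \<in> T - {zP}"
  shows "(U has_field_derivative U' z) (at z)"
proof -
  have z: "z \<in> T" "z \<noteq> zP" using assms by auto
  note m = M_props[OF z(1)]
  have "(S.Hhat has_field_derivative (S.G' (Ln (M z)) + S.Aq) / M z) (at (M z))"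
    by (rule S.Hhat_deriv) (use m z in auto)
  from DERIV_chain2[OF this m(5)] show ?thesis
    using m(1) by (simp add: U_def[abs_def] U'_def)
qed

text \<open>\<open>M\<close> tends to 1 / mP at infinity, a point where \<open>Hhat\<close> is
  regular; this constant makes Q + r tend to 0 there.\<close>

definition B :: real where "B = - Re (S.Hhat (1 / mP))"
definition Q :: "R2 \<Rightarrow> real" where "Q x = S.Aq * lm (cx x) + B"
text \<open>By \<open>r_eq\<close> this is Re (G (Ln (M z))), the form used on the boundary. The
  detour through the single-valued \<open>U\<close> gives differentiability across the branch cut of
  \<open>Ln\<close>.\<close>

definition r :: "R2 \<Rightarrow> real" where "r x = Re (U (cx x)) - S.Aq * lm (cx x)"

lemma GDERIV_lm:
  assumes "cx x \<in> T"
  shows "GDERIV (\<lambda>x. lm (cx x)) x :> (Re (zeta (cx x)), - Im (zeta (cx x)))"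
proof -
  have c: "cx (al, 0) = ca" "cx (- al, 0) = - ca" by (auto simp: complex_eq_iff)
  have ne: "x \<noteq> (al, 0)" "x \<noteq> (- al, 0)" using T_nonzero[OF assms] c by (auto simp: add_eq_0_iff2)
  have n: "norm (x - (al, 0)) = norm (cx x - ca)" "norm (x - (- al, 0)) = norm (cx x + ca)" for x
    unfolding norm_cx[symmetric] cx_diff c by simp_all
  from GDERIV_diff[OF GDERIV_ln_norm[OF ne(1)] GDERIV_ln_norm[OF ne(2)]]
  show ?thesis unfolding n c by (simp add: lm_def[abs_def] zeta_def)
qed

lemma GDERIV_Q:
  assumes "cx x \<in> T"
  shows "GDERIV Q x :> (Re (S.Aq * zeta (cx x)), - Im (S.Aq * zeta (cx x)))"
  using GDERIV_add[OF GDERIV_cmult[OF GDERIV_lm[OF assms], of S.Aq] GDERIV_const[of B x]]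
  by (simp add: Q_def[abs_def])

lemma GDERIV_r:
  assumes "cx x \<in> T - {zP}"
  shows "GDERIV r x :> (Re (S.G' (Ln (M (cx x))) * zeta (cx x)), - Im (S.G' (Ln (M (cx x))) * zeta (cx x)))"
proof -
  have T: "cx x \<in> T" using assms by simp
  have "GDERIV r x :> (Re (U' (cx x)), - Im (U' (cx x))) - S.Aq *\<^sub>R (Re (zeta (cx x)), - Im (zeta (cx x)))"
    unfolding r_def[abs_def]
    by (rule GDERIV_diff[OF GDERIV_Re_holomorphic[OF U_deriv[OF assms]] GDERIV_cmult[OF GDERIV_lm[OF T]]])
  moreover have "U' (cx x) = S.G' (Ln (M (cx x))) * zeta (cx x) + S.Aq * zeta (cx x)"
    by (simp add: U'_def distrib_right)
  ultimately show ?thesis by simp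
qed

lemma zeta_holomorphic: "zeta holomorphic_on T"
  unfolding zeta_def[abs_def] by (intro holomorphic_intros) (use T_nonzero in auto)

lemma harmonic_Q: "harmonic_in Q (exterior_dom \<epsilon>)"
proof (rule holomorphic_gradient_harmonic[OF open_exterior_dom])
  have sub: "cx ` exterior_dom \<epsilon> \<subseteq> T" using exterior_subset_closed_ext cx_closed_ext_T by blast
  show "(\<lambda>z. S.Aq * zeta z) holomorphic_on cx ` exterior_dom \<epsilon>"
    by (intro holomorphic_intros holomorphic_on_subset[OF zeta_holomorphic sub])
  show "GDERIV Q x :> (Re (S.Aq * zeta (cx x)), - Im (S.Aq * zeta (cx x)))" if "x \<in> exterior_dom \<epsilon>" for x
    by (rule GDERIV_Q) (use that sub in blast)
qed

lemma boundary_lm: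
  "x \<in> sphere (center \<epsilon> 1) 1 \<Longrightarrow> x \<in> closed_ext \<epsilon> \<and> lm (cx x) = s0"
  "x \<in> sphere (center \<epsilon> 2) 1 \<Longrightarrow> x \<in> closed_ext \<epsilon> \<and> lm (cx x) = - s0"
proof -
  have E: "x \<in> closed_ext \<epsilon>" if "norm (x - center \<epsilon> j) = 1" "j \<in> {1, 2}" for j
    using annulus_subset(1)[OF eps that(2), of x] that eps by simp
  have root: "u = lam * v" if "lam\<^sup>2 * v\<^sup>2 - u\<^sup>2 = 0" "u \<ge> 0" "v \<ge> 0" for u v :: real
    using that lam_gt by (auto simp: power_mult_distrib[symmetric] intro: power2_eq_imp_eq)
  {
    assume "x \<in> sphere (center \<epsilon> 1) 1"
    then have n: "norm (x - center \<epsilon> 1) = 1" by (simp add: dist_norm norm_minus_commute)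
    then have x: "x \<in> closed_ext \<epsilon>" using E by blast
    have "norm (cx x - ca) = lam * norm (cx x + ca)"
      using mobius_identity(2)[of "cx x"] n norm_center(1)[of x] by (intro root) auto
    then show "x \<in> closed_ext \<epsilon> \<and> lm (cx x) = s0"
      using x T_nonzero[OF cx_closed_ext_T[OF x]] lam_gt by (simp add: lm_def s0_def ln_mult_pos)
  }
  {
    assume "x \<in> sphere (center \<epsilon> 2) 1"
    then have n: "norm (x - center \<epsilon> 2) = 1" by (simp add: dist_norm norm_minus_commute)
    then have x: "x \<in> closed_ext \<epsilon>" using E by blast
    have "norm (cx x + ca) = lam * norm (cx x - ca)"
      using mobius_identity(1)[of "cx x"] n norm_center(2)[of x] by (intro root) auto
    then show "x \<in> closed_ext \<epsilon> \<and> lm (cx x) = - s0"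
      using x T_nonzero[OF cx_closed_ext_T[OF x]] lam_gt by (simp add: lm_def s0_def ln_mult_pos)
  }
qed

lemma r_eq:
  assumes "cx x \<in> T - {zP}"
  shows "r x = Re (S.G (Ln (M (cx x))))"
  using M_props(6)[of "cx x"] assms by (simp add: r_def U_def S.Hhat_def)

lemma cx_P: "cx x = zP \<longleftrightarrow> x = (0, p)"
  by (auto simp: zP_def complex_eq_iff prod_eq_iff)

lemma P_ext: "(0, p) \<in> exterior_dom \<epsilon>"
proof -
  have 1: "1 < (1 + \<epsilon> / 2)\<^sup>2" using eps by (simp add: one_less_power)
  have "(norm ((0, p) - center \<epsilon> 1))\<^sup>2 = (1 + \<epsilon> / 2)\<^sup>2 + p\<^sup>2"
    "(norm ((0, p) - center \<epsilon> 2))\<^sup>2 = (1 + \<epsilon> / 2)\<^sup>2 + p\<^sup>2"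
    unfolding norm_R2_squared by (simp_all add: center_def power2_eq_square algebra_simps)
  then have "1\<^sup>2 < (norm ((0, p) - center \<epsilon> 1))\<^sup>2" "1\<^sup>2 < (norm ((0, p) - center \<epsilon> 2))\<^sup>2"
    using 1 by (simp_all add: add_strict_increasing2 less_le_trans)
  then show ?thesis
    unfolding exterior_dom_iff using power2_less_imp_less[OF _ norm_ge_zero] by blast
qed

lemma r_boundary:
  assumes "j \<in> {1, 2}" "x \<in> sphere (center \<epsilon> j) 1"
  shows "r x = 0"
proof -
  have x: "x \<in> closed_ext \<epsilon>" "\<bar>lm (cx x)\<bar> = s0"
    using assms boundary_lm[of x] s0_pos by auto
  have "x \<notin> exterior_dom \<epsilon>" using assms by (auto simp: exterior_dom_iff dist_norm norm_minus_commute)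
  then have "x \<noteq> (0, p)" using P_ext by auto
  then have T: "cx x \<in> T - {zP}" using cx_closed_ext_T[OF x(1)] cx_P by auto
  have "\<bar>Re (Ln (M (cx x)))\<bar> = s0" using M_props(6)[of "cx x"] T x(2) by simp
  from S.Re_G_boundary[OF this] show ?thesis using r_eq[OF T] by simp
qed

definition cst :: "nat \<Rightarrow> real" where "cst j = (if j = 1 then S.Aq * s0 + B else B - S.Aq * s0)"

lemma Q_boundary: "j \<in> {1, 2} \<Longrightarrow> x \<in> sphere (center \<epsilon> j) 1 \<Longrightarrow> Q x = cst j"
  using boundary_lm[of x] by (auto simp: Q_def cst_def)

lemma continuous_Q: "continuous_on (closed_ext \<epsilon>) Q"
proof (intro continuous_at_imp_continuous_on ballI)
  fix x assume "x \<in> closed_ext \<epsilon>"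
  from GDERIV_Q[OF cx_closed_ext_T[OF this]] show "isCont Q x"
    unfolding gderiv_def by (rule has_derivative_continuous)
qed

lemma continuous_r: "continuous_on (closed_ext \<epsilon> - {(0, p)}) r"
proof (intro continuous_at_imp_continuous_on ballI)
  fix x assume "x \<in> closed_ext \<epsilon> - {(0, p)}"
  then have "cx x \<in> T - {zP}" using cx_closed_ext_T cx_P by auto
  from GDERIV_r[OF this] show "isCont r x"
    unfolding gderiv_def by (rule has_derivative_continuous)
qed

lemma Qr: "Q x + r x = Re (U (cx x)) + B"
  by (simp add: Q_def r_def)

lemma zero_flux_Qr:
  assumes "j \<in> {1, 2}"
  shows "zero_flux (\<lambda>x. Q x + r x) (center \<epsilon> j)"
proof -
  define c where "c = center \<epsilon> j"
  define y where "y \<theta> = c + (cos \<theta>, sin \<theta>)" for \<theta>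
  have cy: "cx (y \<theta>) = cx c + cis \<theta>" for \<theta> by (simp add: y_def complex_eq_iff)
  have yT: "cx (y \<theta>) \<in> T - {zP}" for \<theta>
  proof -
    have s: "y \<theta> \<in> sphere (center \<epsilon> j) 1" by (simp add: y_def c_def dist_norm norm_Pair)
    then have "y \<theta> \<in> closed_ext \<epsilon>" using boundary_lm[of "y \<theta>"] assms by auto
    moreover have "y \<theta> \<notin> exterior_dom \<epsilon>" using s assms by (auto simp: exterior_dom_iff dist_norm norm_minus_commute)
    then have "y \<theta> \<noteq> (0, p)" using P_ext by auto
    ultimately show ?thesis using cx_closed_ext_T cx_P by auto
  qed
  define g where "g \<theta> = Re (U' (cx (y \<theta>)) * - cis \<theta>)" for \<theta>
  have 1: "has_normal_deriv (\<lambda>x. Q x + r x) c (y \<theta>) (g \<theta>)" for \<theta>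
  proof -
    have "((\<lambda>t. cx (y \<theta>) + of_real t * - cis \<theta>) has_vector_derivative - cis \<theta>) (at 0)"
      by (auto intro!: derivative_eq_intros simp: has_vector_derivative_def scaleR_conv_of_real)
    moreover have "(U has_field_derivative U' (cx (y \<theta>))) (at (cx (y \<theta>) + of_real 0 * - cis \<theta>))"
      using U_deriv[OF yT] by simp
    ultimately have "((U \<circ> (\<lambda>t. cx (y \<theta>) + of_real t * - cis \<theta>)) has_vector_derivative - cis \<theta> * U' (cx (y \<theta>))) (at 0)"
      by (rule field_vector_diff_chain_at)
    then have "((\<lambda>t. Re (U (cx (y \<theta>) + of_real t * - cis \<theta>))) has_vector_derivative Re (- cis \<theta> * U' (cx (y \<theta>)))) (at 0)"
      unfolding o_def by (rule bounded_linear.has_vector_derivative[OF bounded_linear_Re])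
    then have "((\<lambda>t. Re (U (cx (y \<theta>) + of_real t * - cis \<theta>)) + B) has_real_derivative g \<theta>) (at 0)"
      unfolding has_real_derivative_iff_has_vector_derivative[symmetric] g_def mult.commute[of "- cis \<theta>"]
      using DERIV_add[OF _ DERIV_const[of B]] by fastforce
    moreover have "cx (y \<theta> + t *\<^sub>R (c - y \<theta>)) = cx (y \<theta>) + of_real t * - cis \<theta>" for t
      unfolding cx_add cx_scaleR cx_diff cy by simp
    ultimately show ?thesis
      unfolding has_normal_deriv_def Qr by (simp add: has_field_derivative_at_within)
  qed
  have 2: "(g has_integral 0) {0..2*pi}"
  proof -
    \<comment> \<open>By the Cauchy-Riemann equations the normal derivative is the derivative along
      the circle of a harmonic conjugate, here \<open>Re (\<i> * U)\<close>, which returns to its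
      initial value.\<close>
    define \<Theta> where "\<Theta> \<theta> = Re (\<i> * U (cx (y \<theta>)))" for \<theta>
    have "(\<Theta> has_vector_derivative g \<theta>) (at \<theta>)" for \<theta>
    proof -
      have "((\<lambda>\<theta>. cx (y \<theta>)) has_vector_derivative \<i> * cis \<theta>) (at \<theta>)"
      proof -
        have "((\<lambda>\<theta>. \<i> * complex_of_real \<theta>) has_vector_derivative \<i>) (at \<theta>)"
          by (auto intro!: derivative_eq_intros simp: has_vector_derivative_def scaleR_conv_of_real mult.commute)
        moreover have "((\<lambda>w. cx c + exp w) has_field_derivative exp (\<i> * complex_of_real \<theta>)) (at (\<i> * complex_of_real \<theta>))"
          by (auto intro!: derivative_eq_intros)
        ultimately show ?thesis
          unfolding cy cis_conv_exp using field_vector_diff_chain_at by (fastforce simp: o_def)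
      qed
      from field_vector_diff_chain_at[OF this U_deriv[OF yT]]
      have "((\<lambda>\<theta>. U (cx (y \<theta>))) has_vector_derivative \<i> * cis \<theta> * U' (cx (y \<theta>))) (at \<theta>)" by (simp add: o_def)
      from has_vector_derivative_mult_right[OF this, of \<i>]
      have "((\<lambda>\<theta>. \<i> * U (cx (y \<theta>))) has_vector_derivative \<i> * (\<i> * cis \<theta> * U' (cx (y \<theta>)))) (at \<theta>)" .
      from bounded_linear.has_vector_derivative[OF bounded_linear_Re this]
      have "(\<Theta> has_vector_derivative Re (\<i> * (\<i> * cis \<theta> * U' (cx (y \<theta>))))) (at \<theta>)" by (simp only: \<Theta>_def[abs_def])
      moreover have "\<i> * (\<i> * cis \<theta> * U' (cx (y \<theta>))) = U' (cx (y \<theta>)) * - cis \<theta>" by (simp add: mult.assoc[symmetric])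
      ultimately show ?thesis by (simp only: g_def)
    qed
    then have "(g has_integral (\<Theta> (2 * pi) - \<Theta> 0)) {0..2*pi}"
      by (intro fundamental_theorem_of_calculus) (auto intro: has_vector_derivative_at_within)
    moreover have "\<Theta> (2 * pi) = \<Theta> 0" by (simp add: \<Theta>_def y_def)
    ultimately show ?thesis by simp
  qed
  show ?thesis
    unfolding zero_flux_def using 1 2 by (intro exI[of _ g]) (auto simp: y_def c_def)
qed

lemma Qr_tendsto: "((\<lambda>x. Q x + r x) \<longlongrightarrow> 0) at_infinity"
proof -
  have "filterlim cx at_infinity at_infinity"
    unfolding filterlim_at_infinity_conv_norm_at_top norm_cx by (rule filterlim_norm_at_top)
  moreover have "(M \<longlongrightarrow> 1 / mP) at_infinity"
  proof -
    have "filterlim (\<lambda>z. z + ca) at_infinity at_infinity"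
      by (rule tendsto_add_filterlim_at_infinity'[OF filterlim_ident tendsto_const])
    then have "((\<lambda>z. 1 - 2 * ca * inverse (z + ca)) \<longlongrightarrow> 1 - 2 * ca * 0) at_infinity"
      by (intro tendsto_intros filterlim_compose[OF tendsto_inverse_0])
    moreover have "\<forall>\<^sub>F z in at_infinity. 1 - 2 * ca * inverse (z + ca) = (z - ca) / (z + ca)"
    proof -
      have "\<forall>\<^sub>F z in at_infinity. z \<noteq> - ca" by (rule eventually_not_equal_at_infinity)
      then show ?thesis by eventually_elim (simp add: field_simps add_eq_0_iff2)
    qed
    ultimately have "((\<lambda>z. (z - ca) / (z + ca)) \<longlongrightarrow> 1) at_infinity"
      using Lim_transform_eventually by fastforce
    from tendsto_divide[OF this tendsto_const[of mP] mP(1)] show ?thesis by (simp add: M_def[abs_def])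
  qed
  ultimately have "((\<lambda>x. M (cx x)) \<longlongrightarrow> 1 / mP) at_infinity"
    using filterlim_compose by blast
  moreover have "isCont S.Hhat (1 / mP)"
    by (rule DERIV_isCont[OF S.Hhat_deriv]) (use mP s0_pos in \<open>auto simp: norm_divide\<close>)
  ultimately have "((\<lambda>x. U (cx x)) \<longlongrightarrow> S.Hhat (1 / mP)) at_infinity"
    unfolding U_def by (rule isCont_tendsto_compose[rotated])
  then have "((\<lambda>x. Re (U (cx x)) + B) \<longlongrightarrow> Re (S.Hhat (1 / mP)) + B) at_infinity"
    by (intro tendsto_intros)
  then show ?thesis by (simp add: Qr B_def)
qed

end

section \<open>Decomposition and energy\<close>

text \<open>The majorant is integrable over the whole plane, so a continuous gradient bounded by a
  multiple of 1 / (1 + |x|^2) has finite energy.\<close>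

lemma set_integrable_decay:
  fixes g :: "R2 \<Rightarrow> real"
  assumes S: "open S" and g: "continuous_on S g" and bd: "\<And>x. x \<in> S \<Longrightarrow> \<bar>g x\<bar> \<le> C * (1 / (1 + (norm x)\<^sup>2)\<^sup>2)"
  shows "set_integrable lborel S g"
  unfolding set_integrable_def
proof (rule Bochner_Integration.integrable_bound)
  show "integrable lborel (\<lambda>x::R2. C * (1 / (1 + (norm x)\<^sup>2)\<^sup>2))"
    by (intro integrable_mult_right integral_plane_kernel)
  show "(\<lambda>x. indicat_real S x *\<^sub>R g x) \<in> borel_measurable lborel"
    using borel_measurable_continuous_on_indicator[OF _ g] S by simp
  show "AE x in lborel. norm (indicat_real S x *\<^sub>R g x) \<le> norm (C * (1 / (1 + (norm x)\<^sup>2)\<^sup>2))"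
  proof (rule AE_I2)
    fix x :: R2
    show "norm (indicat_real S x *\<^sub>R g x) \<le> norm (C * (1 / (1 + (norm x)\<^sup>2)\<^sup>2))"
    proof (cases "x \<in> S")
      case True
      have "C / (1 + (norm x)\<^sup>2)\<^sup>2 \<le> \<bar>C\<bar> / (1 + (norm x)\<^sup>2)\<^sup>2" by (intro divide_right_mono) auto
      with bd[OF True] True show ?thesis by simp
    qed simp
  qed
qed

text \<open>Away from w the distance |z - w| controls 1 + |z|; this converts decay measured from
  particular points into the majorant of \<open>set_integrable_decay\<close>.\<close>

lemma far_bound:
  fixes z w :: complex
  assumes "k > 0" "norm (z - w) \<ge> k"
  shows "1 + norm z \<le> norm (z - w) * (1 + (1 + norm w) / k)"
proof -
  have "norm z \<le> norm (z - w) + norm w" using norm_triangle_sub[of z w] by simp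
  moreover have "1 + norm w \<le> norm (z - w) * ((1 + norm w) / k)"
    using assms mult_right_mono[of k "norm (z - w)" "(1 + norm w) / k"] by simp
  ultimately show ?thesis by (simp add: distrib_left)
qed

lemma one_plus_square_le: "0 \<le> t \<Longrightarrow> 1 + t\<^sup>2 \<le> (1 + t)\<^sup>2" for t :: real
  by (simp add: power2_eq_square algebra_simps)

lemma norm_conj_pair: "norm (Re w, - Im w) = norm w"
  by (simp add: norm_Pair cmod_def)

lemma grad_fund_sol: "y \<noteq> P \<Longrightarrow> a \<bullet> grad (fund_sol P) y = dipole a P y"
proof -
  assume y: "y \<noteq> P"
  have "GDERIV (\<lambda>x. ln (norm (x - P))) y :> (1 / (norm (y - P))\<^sup>2) *\<^sub>R (y - P)"
  proof -
    have "(Re (1 / (cx y - cx P)), - Im (1 / (cx y - cx P))) = (1 / (norm (y - P))\<^sup>2) *\<^sub>R (y - P)"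
      by (simp add: prod_eq_iff Re_divide Im_divide norm_R2_squared diff_divide_distrib)
    with GDERIV_ln_norm[OF y] show ?thesis by simp
  qed
  from GDERIV_cmult[OF this, of "1 / (2 * pi)"]
  have "grad (fund_sol P) y = (1 / (2 * pi)) *\<^sub>R ((1 / (norm (y - P))\<^sup>2) *\<^sub>R (y - P))"
    unfolding fund_sol_def[abs_def] by (intro grad_eq) simp
  then show ?thesis by (simp add: dipole_def)
qed

context two_disks
begin

lemma lm_le: "x \<in> closed_ext \<epsilon> \<Longrightarrow> \<bar>lm (cx x)\<bar> \<le> s0"
proof -
  assume x: "x \<in> closed_ext \<epsilon>"
  have p: "norm (cx x - ca) > 0" "norm (cx x + ca) > 0" using T_nonzero[OF cx_closed_ext_T[OF x]] by simp_all
  have "ln (norm (cx x + ca)) \<le> ln (lam * norm (cx x - ca))" "ln (norm (cx x - ca)) \<le> ln (lam * norm (cx x + ca))"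
    using closed_ext_bounds[OF x] p lam_gt by (auto intro!: ln_mono)
  then have "ln (norm (cx x + ca)) \<le> s0 + ln (norm (cx x - ca))" "ln (norm (cx x - ca)) \<le> s0 + ln (norm (cx x + ca))"
    using p lam_gt by (simp_all add: ln_mult_pos s0_def)
  then show ?thesis by (simp add: lm_def abs_le_iff)
qed

lemma dP_nonzero: "dP \<noteq> 0"
  using al_pos by (simp add: dP_def add_nonneg_eq_0_iff)

lemma M_zP: "M zP = 1" using M_props(4)[OF zP_T] by simp

text \<open>Since t = Ln (M z) has derivative \<open>dP\<close> at the emitter and t G(t) tends to
  \<open>b\<close>, the residue is b / dP, which is \<open>cx a / (2 * pi)\<close> by the choice of
  \<open>b\<close>. The term with \<open>Aq\<close> is regular.\<close>

lemma U_residue: "((\<lambda>z. (z - zP) * U z) \<longlongrightarrow> cx a / (2 * pi)) (at zP)"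
proof -
  define L where "L z = Ln (M z)" for z
  have LD: "(L has_field_derivative dP) (at zP)"
  proof -
    have "M zP \<notin> \<real>\<^sub>\<le>\<^sub>0" unfolding M_zP by simp
    from DERIV_chain2[OF has_field_derivative_Ln[OF this] M_props(5)[OF zP_T]]
    show ?thesis by (simp add: L_def[abs_def] M_zP zeta_zP)
  qed
  have L0: "L zP = 0" by (simp add: L_def M_zP)
  have "((\<lambda>z. L z / (z - zP)) \<longlongrightarrow> dP) (at zP)"
    using LD by (simp add: has_field_derivative_iff L0)
  from tendsto_inverse[OF this] have 1: "((\<lambda>z. (z - zP) / L z) \<longlongrightarrow> 1 / dP) (at zP)"
    using dP_nonzero by (simp add: inverse_eq_divide)
  have ev: "\<forall>\<^sub>F z in at zP. L z \<noteq> 0"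
  proof -
    have "\<forall>\<^sub>F z in at zP. z \<in> T - {zP}"
      using open_T zP_T by (auto simp: eventually_at_topological)
    then show ?thesis
    proof eventually_elim
      case (elim z)
      then have "M z \<noteq> 1" "M z \<noteq> 0" using M_props(1,4)[of z] by auto
      then show ?case by (metis L_def exp_Ln exp_zero)
    qed
  qed
  have "(L \<longlongrightarrow> 0) (at zP)" using DERIV_isCont[OF LD] L0 by (simp add: isCont_def)
  then have lim: "filterlim L (at 0) (at zP)" using ev by (simp add: filterlim_at)
  have "((\<lambda>z. L z * S.G (L z)) \<longlongrightarrow> b) (at zP)" by (rule filterlim_compose[OF S.G_pole lim])
  from tendsto_add[OF this tendsto_mult[OF tendsto_mult[OF tendsto_const[of "of_real S.Aq"] \<open>(L \<longlongrightarrow> 0) (at zP)\<close>] \<open>(L \<longlongrightarrow> 0) (at zP)\<close>]]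
  have "((\<lambda>z. L z * S.G (L z) + S.Aq * L z * L z) \<longlongrightarrow> b) (at zP)" by simp
  from tendsto_mult[OF 1 this]
  have "((\<lambda>z. (z - zP) / L z * (L z * S.G (L z) + S.Aq * L z * L z)) \<longlongrightarrow> 1 / dP * b) (at zP)" .
  moreover have "\<forall>\<^sub>F z in at zP. (z - zP) / L z * (L z * S.G (L z) + S.Aq * L z * L z) = (z - zP) * U z"
    using ev by eventually_elim (simp add: U_def S.Hhat_def L_def[symmetric] field_simps)
  moreover have "1 / dP * b = cx a / (2 * pi)" using dP_nonzero by (simp add: b_def)
  ultimately show ?thesis using Lim_transform_eventually by fastforce
qed

definition hN :: "complex \<Rightarrow> complex" where "hN z = cx a / (2 * pi * (z - zP))"

lemma dipole_Re: "dipole a (0, p) x = Re (hN (cx x))"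
proof -
  have "cx x - zP = cx (x - (0, p))" by (simp add: complex_eq_iff zP_def)
  then have "hN (cx x) = cx a / cx (x - (0, p)) / of_real (2 * pi)" by (simp add: hN_def)
  then have "Re (hN (cx x)) = Re (cx a / cx (x - (0, p))) / (2 * pi)" by (simp only: Re_divide_of_real)
  also have "Re (cx a / cx (x - (0, p))) = (a \<bullet> (x - (0, p))) / (norm (x - (0, p)))\<^sup>2"
    by (simp add: Re_divide inner_prod_def norm_R2_squared)
  finally show ?thesis by (simp add: dipole_def)
qed

lemma regular_part:
  obtains V where "V holomorphic_on T" "\<And>z. z \<in> T - {zP} \<Longrightarrow> V z = U z - hN z"
proof -
  have hol: "(\<lambda>z. U z - hN z) holomorphic_on T - {zP}"
  proof (rule holomorphic_on_diff)
    have "open (T - {zP})" using open_T by auto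
    then show "U holomorphic_on T - {zP}"
      using U_deriv by (auto simp: holomorphic_on_open)
    show "hN holomorphic_on T - {zP}" unfolding hN_def[abs_def] by (intro holomorphic_intros) auto
  qed
  have "((\<lambda>z. (z - zP) * U z - cx a / (2 * pi)) \<longlongrightarrow> cx a / (2 * pi) - cx a / (2 * pi)) (at zP)"
    by (intro tendsto_diff U_residue tendsto_const)
  moreover have "\<forall>\<^sub>F z in at zP. (z - zP) * U z - cx a / (2 * pi) = (z - zP) * (U z - hN z)"
  proof -
    have "w * (A / (2 * pi * w)) = A / (2 * pi)" if "w \<noteq> 0" for w A :: complex using that by simp
    then have "(z - zP) * hN z = cx a / (2 * pi)" if "z \<noteq> zP" for z using that unfolding hN_def by simp
    then show ?thesis
      unfolding eventually_at_topological by (intro exI[of _ UNIV]) (simp add: right_diff_distrib)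
  qed
  ultimately have "((\<lambda>z. (z - zP) * (U z - hN z)) \<longlongrightarrow> 0) (at zP)"
    using Lim_transform_eventually by fastforce
  moreover have "zP \<in> interior T" using zP_T open_T by (simp add: interior_open)
  ultimately show ?thesis
    using holomorphic_on_extend_lim[OF hol] that by blast
qed

text \<open>The regular part \<open>e\<close> of r need not be the real part of a holomorphic
  function, because its logarithmic term has no single-valued conjugate; hence it is described by
  its gradient, through \<open>k\<close>. The formula for \<open>k\<close> away from the emitter
  supplies the decay at infinity.\<close>

lemma r_decomposition:
  obtains k e where "k holomorphic_on T" "\<And>x. cx x \<in> T \<Longrightarrow> GDERIV e x :> (Re (k (cx x)), - Im (k (cx x)))"
    "\<And>x. cx x \<in> T - {zP} \<Longrightarrow> r x = dipole a (0, p) x + e x"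
    "\<And>z. z \<in> T - {zP} \<Longrightarrow> k z = S.G' (Ln (M z)) * zeta z + cx a / (2 * pi * (z - zP)\<^sup>2)"
proof -
  obtain V where V: "V holomorphic_on T" "\<And>z. z \<in> T - {zP} \<Longrightarrow> V z = U z - hN z"
    using regular_part by metis
  define k where "k z = deriv V z - S.Aq * zeta z" for z
  define e where "e x = Re (V (cx x)) - S.Aq * lm (cx x)" for x
  have Vd: "(V has_field_derivative deriv V z) (at z)" if "z \<in> T" for z
    by (rule holomorphic_derivI[OF V(1) open_T that])
  show ?thesis
  proof
    show "k holomorphic_on T" unfolding k_def[abs_def]
      by (intro holomorphic_on_diff holomorphic_deriv[OF V(1) open_T] holomorphic_on_mult zeta_holomorphic holomorphic_on_const)
    show "GDERIV e x :> (Re (k (cx x)), - Im (k (cx x)))" if "cx x \<in> T" for x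
      using GDERIV_diff[OF GDERIV_Re_holomorphic[OF Vd[OF that]] GDERIV_cmult[OF GDERIV_lm[OF that], of S.Aq]]
      by (simp add: e_def[abs_def] k_def)
    show "r x = dipole a (0, p) x + e x" if "cx x \<in> T - {zP}" for x
      using V(2)[OF that] by (simp add: r_def e_def dipole_Re)
    show "k z = S.G' (Ln (M z)) * zeta z + cx a / (2 * pi * (z - zP)\<^sup>2)" if z: "z \<in> T - {zP}" for z
    proof -
      have hd: "(hN has_field_derivative - (cx a / (2 * pi * (z - zP)\<^sup>2))) (at z)"
      proof -
        have "((\<lambda>z. cx a / (2 * pi) / (z - zP)) has_field_derivative - (cx a / (2 * pi)) / ((z - zP) * (z - zP))) (at z)"
          using z by (auto intro!: derivative_eq_intros)
        then show ?thesis by (simp add: hN_def[abs_def] power2_eq_square)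
      qed
      have o: "open (T - {zP})" using open_T by auto
      have "(V has_field_derivative U' z - - (cx a / (2 * pi * (z - zP)\<^sup>2))) (at z)"
        by (rule has_field_derivative_transform_within_open[OF DERIV_diff[OF U_deriv[OF z] hd] o z]) (simp add: V(2))
      then have "deriv V z = U' z + cx a / (2 * pi * (z - zP)\<^sup>2)" by (simp add: DERIV_imp_deriv)
      then show ?thesis by (simp add: k_def U'_def distrib_right)
    qed
  qed
qed

definition c0 :: real where "c0 = 1 + 2 / (1 - exp (- 2 * pi * S.\<kappa>))"

lemma c0_pos: "c0 > 0"
  using S.\<kappa>_pos by (simp add: c0_def add_pos_pos)

lemma exp_minus_one_le:
  assumes "Re t \<le> s0"
  shows "norm (exp t - 1) \<le> lam * norm t"
proof -
  have "norm (exp t - exp 0) \<le> lam * norm (t - 0)"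
  proof (rule field_differentiable_bound[of "{w. Re w \<le> s0}" exp exp lam])
    show "(exp has_field_derivative exp z) (at z within {w. Re w \<le> s0})" for z :: complex
      by (rule has_field_derivative_at_within[OF DERIV_exp])
    show "norm (exp z) \<le> lam" if "z \<in> {w. Re w \<le> s0}" for z
      using that exp_s0 by (metis exp_le_cancel_iff mem_Collect_eq norm_exp_eq_Re)
  qed (use assms s0_pos convex_halfspace_Re_le in auto)
  then show ?thesis by simp
qed

text \<open>The last inequality bounds |t| from below: M z - 1 is computed explicitly, and |exp t -
  1| \<le> lam |t| in the half plane Re t \<le> s0.\<close>

lemma Ln_M_bounds:
  assumes x: "x \<in> closed_ext \<epsilon>" "x \<noteq> (0, p)"
  defines "t \<equiv> Ln (M (cx x))"
  shows "\<bar>Re t\<bar> \<le> s0" "\<bar>Im t\<bar> \<le> pi" "t \<noteq> 0"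
    "2 * al * norm (cx x - zP) \<le> lam * norm t * (norm (cx x + ca) * norm (zP + ca))"
proof -
  define z where "z = cx x"
  have z: "z \<in> T" "z \<noteq> zP" using cx_closed_ext_T[OF x(1)] x(2) cx_P by (auto simp: z_def)
  note m = M_props[OF z(1)]
  show re: "\<bar>Re t\<bar> \<le> s0" using m(6) lm_le[OF x(1)] by (simp add: t_def z_def)
  show "\<bar>Im t\<bar> \<le> pi" using Im_Ln_le_pi[OF m(1)] mpi_less_Im_Ln[OF m(1)] by (simp add: t_def z_def)
  have et: "exp t = M z" using m(1) by (simp add: t_def z_def)
  then show "t \<noteq> 0" using m(4) z(2) by auto
  note nz = T_nonzero[OF z(1)]
  have "M z - 1 = 2 * ca * (z - zP) / ((z + ca) * (zP + ca)) / mP"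
  proof -
    have "M z - 1 = ((z - ca) / (z + ca) - mP) / mP" using mP by (simp add: M_def diff_divide_distrib)
    also have "(z - ca) / (z + ca) - mP = ((z - ca) * (zP + ca) - (zP - ca) * (z + ca)) / ((z + ca) * (zP + ca))"
      using nz zP_simps by (simp add: mP_def diff_frac_eq)
    also have "(z - ca) * (zP + ca) - (zP - ca) * (z + ca) = 2 * ca * (z - zP)" by (simp add: algebra_simps)
    finally show ?thesis .
  qed
  then have "norm (M z - 1) = 2 * al * norm (z - zP) / (norm (z + ca) * norm (zP + ca))"
    using al_pos mP by (simp add: norm_divide norm_mult)
  moreover have "norm (M z - 1) \<le> lam * norm t"
    using exp_minus_one_le[of t] re et by simp
  ultimately have "2 * al * norm (z - zP) / (norm (z + ca) * norm (zP + ca)) \<le> lam * norm t" by simp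
  moreover have "norm (z + ca) * norm (zP + ca) > 0" using nz zP_simps by simp
  ultimately show "2 * al * norm (cx x - zP) \<le> lam * norm t * (norm (cx x + ca) * norm (zP + ca))"
    by (simp add: z_def divide_le_eq)
qed

text \<open>The factor \<open>1 / |z - zP|\<^sup>2\<close> comes from \<open>|M'(z) M'(zP)| = |M z - 1|\<^sup>2 / |z - zP|\<^sup>2\<close> for
  Moebius maps with \<open>M zP = 1\<close>.\<close>

lemma r_gradient_estimate:
  assumes x: "x \<in> closed_ext \<epsilon>" "x \<noteq> (0, p)"
  shows "norm (S.G' (Ln (M (cx x))) * zeta (cx x)) \<le>
    64 * norm a * c0 * lam ^ 3 / (norm (cx x - zP))\<^sup>2 * exp (- S.\<kappa> * \<bar>Im (Ln (M (cx x)))\<bar>)"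
proof -
  define z where "z = cx x"
  define t where "t = Ln (M z)"
  note tb = Ln_M_bounds[OF x, folded z_def, folded t_def]
  have z: "z \<in> T" "z \<noteq> zP" using cx_closed_ext_T[OF x(1)] x(2) cx_P by (auto simp: z_def)
  note nz = T_nonzero[OF z(1)]
  define d A A' Bq \<tau> where "d = norm (z - zP)" and "A = norm (z + ca)" and "A' = norm (z - ca)"
    and "Bq = norm (zP + ca)" and "\<tau> = norm t"
  have pos: "d > 0" "A > 0" "A' > 0" "Bq > 0" "\<tau> > 0"
    using nz z zP_simps tb(3) by (auto simp: d_def A_def A'_def Bq_def \<tau>_def)
  have AA: "A \<le> lam * A'" using closed_ext_bounds(1)[OF x(1)] by (simp add: A_def A'_def z_def)
  have key: "2 * al * d \<le> lam * \<tau> * (A * Bq)"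
    using tb(4) by (simp add: d_def A_def Bq_def \<tau>_def)
  have "(2 * al * d)\<^sup>2 \<le> (lam * \<tau> * (A * Bq))\<^sup>2"
    by (rule power_mono[OF key]) (use al_pos pos in simp)
  also have "\<dots> = lam\<^sup>2 * \<tau>\<^sup>2 * Bq\<^sup>2 * A * A" by (simp add: power2_eq_square mult_ac)
  also have "\<dots> \<le> lam\<^sup>2 * \<tau>\<^sup>2 * Bq\<^sup>2 * A * (lam * A')"
    by (rule mult_left_mono[OF AA]) (use pos in simp)
  finally have "(2 * al)\<^sup>2 * d\<^sup>2 \<le> lam ^ 3 * (Bq\<^sup>2 * (A' * A) * \<tau>\<^sup>2)"
    by (simp add: power_mult_distrib power3_eq_cube power2_eq_square mult_ac)
  then have frac: "(2 * al)\<^sup>2 / (Bq\<^sup>2 * (A' * A) * \<tau>\<^sup>2) \<le> lam ^ 3 / d\<^sup>2"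
    using pos by (simp add: divide_le_eq le_divide_eq mult_ac)
  have nb: "norm b = norm a * (2 * al / Bq\<^sup>2) / (2 * pi)"
  proof -
    have "\<bar>dP\<bar> = 2 * al / Bq\<^sup>2"
      using al_pos zP_simps(4) by (simp add: dP_def Bq_def abs_divide)
    then show ?thesis by (simp add: b_def norm_divide norm_mult norm_cx)
  qed
  have nzeta: "norm (zeta z) = 2 * al / (A' * A)"
    using zeta_eq[OF nz] al_pos by (simp add: norm_divide norm_mult A_def A'_def)
  have "norm (S.G' t) \<le> 128 * norm b / \<tau>\<^sup>2 * exp (- S.\<kappa> * \<bar>Im t\<bar>) * c0"
    using S.G'_bound[OF tb(1,2,3)] by (simp add: \<tau>_def c0_def)
  then have "norm (S.G' t * zeta z) \<le> 128 * norm b / \<tau>\<^sup>2 * exp (- S.\<kappa> * \<bar>Im t\<bar>) * c0 * (2 * al / (A' * A))"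
    unfolding norm_mult nzeta using al_pos pos by (intro mult_right_mono) auto
  \<comment> \<open>One factor \<open>2 * al\<close> comes from \<open>b\<close>, that is, from the
    derivative at the emitter, the other from \<open>zeta\<close> at \<open>z\<close>; 64 is 128
    divided by the 2 of 2\<pi>.\<close>
  also have "\<dots> = (64 * norm a * c0 * exp (- S.\<kappa> * \<bar>Im t\<bar>)) * ((2 * al)\<^sup>2 / (Bq\<^sup>2 * (A' * A) * \<tau>\<^sup>2)) * (1 / pi)"
    unfolding nb by (simp add: power2_eq_square mult_ac)
  also have "\<dots> \<le> (64 * norm a * c0 * exp (- S.\<kappa> * \<bar>Im t\<bar>)) * (lam ^ 3 / d\<^sup>2) * 1"
    using pi_gt3 c0_pos lam_gt frac pos by (intro mult_mono) auto
  finally show ?thesis by (simp add: z_def t_def d_def mult_ac)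
qed

lemma energy_Q: "set_integrable lborel (exterior_dom \<epsilon>) (\<lambda>x. (norm (grad Q x))\<^sup>2)"
proof -
  have X: "x \<in> closed_ext \<epsilon>" "cx x \<in> T" if "x \<in> exterior_dom \<epsilon>" for x
    using that exterior_subset_closed_ext cx_closed_ext_T by blast+
  \<comment> \<open>The distance of \<plusminus>al from the circle around it: each point lies inside
    a disk, at distance cc - al < 1 from the centre.\<close>
  define k where "k = 1 - (cc - al)"
  have cc_al: "cc - al > 0"
    using zero_less_mult_pos2[of "cc - al" lam] lam_inverse lam_gt by simp
  have k: "k > 0"
  proof -
    have "(cc - al) * 1 < (cc - al) * lam"
      using lam_gt cc_al by (intro mult_strict_left_mono) auto
    then show ?thesis using lam_inverse by (simp add: k_def)
  qed
  define K where "K = 1 + (1 + al) / k"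
  have far: "1 + norm (cx x) \<le> norm (cx x - ca) * K" "1 + norm (cx x) \<le> norm (cx x + ca) * K"
    if x: "x \<in> exterior_dom \<epsilon>" for x
  proof -
    have n: "norm (cx x + of_real cc) > 1" "norm (cx x - of_real cc) > 1"
      using x norm_center[of x] by (auto simp: exterior_dom_iff)
    have c: "norm (of_real cc - ca) = cc - al"
      using cc_al by (simp flip: of_real_diff)
    have "norm (cx x - of_real cc) \<le> norm (cx x - ca) + norm (of_real cc - ca)"
      using norm_triangle_ineq4[of "cx x - ca" "of_real cc - ca"] by simp
    then have 1: "norm (cx x - ca) \<ge> k" using n(2) c by (simp add: k_def)
    have "norm (cx x + of_real cc) \<le> norm (cx x + ca) + norm (of_real cc - ca)"
      using norm_triangle_ineq[of "cx x + ca" "of_real cc - ca"] by simp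
    then have 2: "norm (cx x - (- ca)) \<ge> k" using n(1) c by (simp add: k_def)
    show "1 + norm (cx x) \<le> norm (cx x - ca) * K" "1 + norm (cx x) \<le> norm (cx x + ca) * K"
      using far_bound[OF k 1] far_bound[OF k 2] al_pos by (simp_all add: K_def)
  qed
  have eq: "(norm (grad Q x))\<^sup>2 = (S.Aq)\<^sup>2 * (norm (zeta (cx x)))\<^sup>2" if "x \<in> exterior_dom \<epsilon>" for x
    unfolding grad_eq[OF GDERIV_Q[OF X(2)[OF that]]] norm_conj_pair by (simp add: norm_mult power_mult_distrib)
  show ?thesis
  proof (rule set_integrable_decay[OF open_exterior_dom])
    have "continuous_on (exterior_dom \<epsilon>) (\<lambda>x. zeta (cx x))"
      by (rule continuous_on_compose2[OF holomorphic_on_imp_continuous_on[OF zeta_holomorphic]])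
        (use X in \<open>auto intro: continuous_intros\<close>)
    then have "continuous_on (exterior_dom \<epsilon>) (\<lambda>x. (S.Aq)\<^sup>2 * (norm (zeta (cx x)))\<^sup>2)"
      by (intro continuous_intros)
    then show "continuous_on (exterior_dom \<epsilon>) (\<lambda>x. (norm (grad Q x))\<^sup>2)"
      by (rule continuous_on_eq) (simp add: eq)
    show "\<bar>(norm (grad Q x))\<^sup>2\<bar> \<le> (S.Aq)\<^sup>2 * (2 * al * K\<^sup>2)\<^sup>2 * (1 / (1 + (norm x)\<^sup>2)\<^sup>2)" if x: "x \<in> exterior_dom \<epsilon>" for x
    proof -
      define q where "q = norm (cx x - ca) * norm (cx x + ca)"
      have q: "q > 0" using T_nonzero[OF X(2)[OF x]] by (simp add: q_def)
      have "1 + (norm x)\<^sup>2 \<le> (1 + norm x)\<^sup>2" by (rule one_plus_square_le) simp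
      also have "\<dots> = (1 + norm (cx x)) * (1 + norm (cx x))" by (simp add: norm_cx power2_eq_square)
      also have "\<dots> \<le> (norm (cx x - ca) * K) * (norm (cx x + ca) * K)"
        by (rule mult_mono[OF far[OF x]]) (use far(1)[OF x] norm_ge_zero[of "cx x"] in linarith)+
      finally have "1 + (norm x)\<^sup>2 \<le> q * K\<^sup>2" by (simp add: q_def power2_eq_square mult_ac)
      moreover have p1: "1 + (norm x)\<^sup>2 > 0" by (simp add: add_pos_nonneg)
      ultimately have "2 * al / q \<le> (2 * al * K\<^sup>2) / (1 + (norm x)\<^sup>2)"
        using q al_pos by (simp add: divide_le_eq le_divide_eq mult_ac)
      moreover have "norm (zeta (cx x)) = 2 * al / q"
        using zeta_eq[OF T_nonzero[OF X(2)[OF x]]] al_pos by (simp add: norm_divide norm_mult q_def)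
      ultimately have "norm (zeta (cx x)) \<le> (2 * al * K\<^sup>2) / (1 + (norm x)\<^sup>2)" by simp
      then have "(norm (zeta (cx x)))\<^sup>2 \<le> ((2 * al * K\<^sup>2) / (1 + (norm x)\<^sup>2))\<^sup>2"
        by (rule power_mono) simp
      then have "(S.Aq)\<^sup>2 * (norm (zeta (cx x)))\<^sup>2 \<le> (S.Aq)\<^sup>2 * ((2 * al * K\<^sup>2) / (1 + (norm x)\<^sup>2))\<^sup>2"
        by (intro mult_left_mono) auto
      then show ?thesis unfolding eq[OF x] by (simp add: power_divide)
    qed
  qed
qed

lemma is_Q: "is_Q_part \<epsilon> cst Q"
  unfolding is_Q_part_def closure_exterior_dom[OF eps] frontier_D
  using continuous_Q harmonic_Q Q_boundary energy_Q by blast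

lemma is_r: "is_r_part \<epsilon> (0, p) a r"
  unfolding is_r_part_def closure_exterior_dom[OF eps] frontier_D
proof (intro conjI ballI)
  obtain k e where ke: "k holomorphic_on T" "\<And>x. cx x \<in> T \<Longrightarrow> GDERIV e x :> (Re (k (cx x)), - Im (k (cx x)))"
    "\<And>x. cx x \<in> T - {zP} \<Longrightarrow> r x = dipole a (0, p) x + e x"
    "\<And>z. z \<in> T - {zP} \<Longrightarrow> k z = S.G' (Ln (M z)) * zeta z + cx a / (2 * pi * (z - zP)\<^sup>2)"
    using r_decomposition by metis
  have X: "x \<in> closed_ext \<epsilon>" "cx x \<in> T" if "x \<in> exterior_dom \<epsilon>" for x
    using that exterior_subset_closed_ext cx_closed_ext_T by blast+
  have XP: "cx x \<in> T - {zP}" if "x \<in> exterior_dom \<epsilon> - {(0, p)}" for x using that X cx_P by auto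
  show "continuous_on (closed_ext \<epsilon> - {(0, p)}) r" by (rule continuous_r)
  show "r differentiable (at x)" if "x \<in> exterior_dom \<epsilon> - {(0, p)}" for x
    by (rule GDERIV_differentiable[OF GDERIV_r[OF XP[OF that]]])
  show "r x = 0" if "j \<in> {1, 2}" "x \<in> sphere (center \<epsilon> j) 1" for j x
    by (rule r_boundary[OF that])
  have kc: "continuous_on T k" by (rule holomorphic_on_imp_continuous_on[OF ke(1)])
  have "harmonic_in e (exterior_dom \<epsilon>)"
    by (rule holomorphic_gradient_harmonic[OF open_exterior_dom holomorphic_on_subset[OF ke(1)] ke(2)]) (use X in auto)
  from distr_laplace_eq_add[OF dipole_distr harmonic_in_distr[OF open_exterior_dom this]]
  have "distr_laplace_eq (exterior_dom \<epsilon>) (\<lambda>x. dipole a (0, p) x + e x) (\<lambda>\<phi>. distr_deriv a (dirac (0, p)) \<phi> + 0)" .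
  then have "distr_laplace_eq (exterior_dom \<epsilon>) r (\<lambda>\<phi>. distr_deriv a (dirac (0, p)) \<phi> + 0)"
    by (rule distr_laplace_eq_cong_except[where P = "(0, p)"]) (use ke(3) XP in auto)
  then show "distr_laplace_eq (exterior_dom \<epsilon>) r (distr_deriv a (dirac (0, p)))" by simp
  define f where "f x = (norm (k (cx x)))\<^sup>2" for x
  define g where "g x = (norm (grad (\<lambda>y. r y - a \<bullet> grad (fund_sol (0, p)) y) x))\<^sup>2" for x
  have gf: "g x = f x" if x: "x \<in> exterior_dom \<epsilon> - {(0, p)}" for x
  proof -
    have o: "open (exterior_dom \<epsilon> - {(0, p)})" using open_exterior_dom by auto
    have "GDERIV (\<lambda>y. r y - a \<bullet> grad (fund_sol (0, p)) y) x :> (Re (k (cx x)), - Im (k (cx x)))"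
    proof (rule GDERIV_transform_open[OF ke(2) o x])
      show "cx x \<in> T" using x X by auto
      show "e y = r y - a \<bullet> grad (fund_sol (0, p)) y" if "y \<in> exterior_dom \<epsilon> - {(0, p)}" for y
        using ke(3)[OF XP[OF that]] grad_fund_sol[of y "(0, p)"] that by simp
    qed
    then show ?thesis by (simp add: g_def f_def grad_eq norm_conj_pair)
  qed
  have fi: "set_integrable lborel (exterior_dom \<epsilon>) f"
  proof -
    \<comment> \<open>Near the emitter \<open>k\<close> is bounded by continuity; farther away both
      terms of its formula decay like 1 / |z - zP|^2, the exponential being at most 1.\<close>
    obtain \<delta> where \<delta>: "\<delta> > 0" "cball zP \<delta> \<subseteq> T" using zP_T open_T open_contains_cball by blast
    have "compact (k ` cball zP \<delta>)"
      by (intro compact_continuous_image continuous_on_subset[OF kc \<delta>(2)] compact_cball)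
    then have "bounded (k ` cball zP \<delta>)" by (rule compact_imp_bounded)
    then obtain B1 where "\<forall>w\<in>k ` cball zP \<delta>. norm w \<le> B1"
      unfolding bounded_iff by blast
    then have B1: "norm (k z) \<le> B1" if "z \<in> cball zP \<delta>" for z using that by blast
    have B1n: "B1 \<ge> 0" using B1[of zP] \<delta>(1) order_trans[OF norm_ge_zero] by simp
    define C1 where "C1 = 64 * norm a * c0 * lam ^ 3 + norm a"
    have C1: "C1 \<ge> 0" using c0_pos lam_gt by (simp add: C1_def)
    define K1 where "K1 = 1 + (1 + norm zP) / \<delta>"
    define K2 where "K2 = 1 + (norm zP + \<delta>)\<^sup>2"
    define C where "C = B1 * K2 + C1 * K1\<^sup>2"
    have bound: "norm (k (cx x)) \<le> C / (1 + (norm x)\<^sup>2)" if x: "x \<in> exterior_dom \<epsilon>" for x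
    proof -
      have p1: "1 + (norm x)\<^sup>2 > 0" by (simp add: add_pos_nonneg)
      show ?thesis
      proof (cases "cx x \<in> cball zP \<delta>")
        case True
        then have "norm (cx x) \<le> norm zP + \<delta>"
          using norm_triangle_sub[of "cx x" zP] by (simp add: dist_norm norm_minus_commute)
        then have "(norm x)\<^sup>2 \<le> (norm zP + \<delta>)\<^sup>2" unfolding norm_cx by (rule power_mono) simp
        then have "1 + (norm x)\<^sup>2 \<le> K2" by (simp add: K2_def)
        then have "norm (k (cx x)) * (1 + (norm x)\<^sup>2) \<le> B1 * K2"
          using B1[OF True] B1n p1 by (intro mult_mono) auto
        also have "\<dots> \<le> C" using C1 by (simp add: C_def)
        finally show ?thesis using p1 by (simp add: le_divide_eq)
      next
        case False
        define d where "d = norm (cx x - zP)"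
        have d: "d > \<delta>" using False by (simp add: d_def dist_norm norm_minus_commute)
        then have "cx x \<noteq> zP" using \<delta>(1) by (auto simp: d_def)
        then have xP: "x \<noteq> (0, p)" using cx_P by blast
        have "k (cx x) = S.G' (Ln (M (cx x))) * zeta (cx x) + cx a / (2 * pi * (cx x - zP)\<^sup>2)"
          by (rule ke(4)) (use XP x xP in auto)
        then have "norm (k (cx x)) \<le> norm (S.G' (Ln (M (cx x))) * zeta (cx x)) + norm (cx a / (2 * pi * (cx x - zP)\<^sup>2))"
          by (simp add: norm_triangle_ineq)
        also have "\<dots> \<le> 64 * norm a * c0 * lam ^ 3 / d\<^sup>2 * 1 + norm a / d\<^sup>2"
        proof (rule add_mono)
          have "64 * norm a * c0 * lam ^ 3 / d\<^sup>2 * exp (- S.\<kappa> * \<bar>Im (Ln (M (cx x)))\<bar>) \<le> 64 * norm a * c0 * lam ^ 3 / d\<^sup>2 * 1"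
            using S.\<kappa>_pos c0_pos lam_gt by (intro mult_left_mono) auto
          with r_gradient_estimate[OF X(1)[OF x] xP]
          show "norm (S.G' (Ln (M (cx x))) * zeta (cx x)) \<le> 64 * norm a * c0 * lam ^ 3 / d\<^sup>2 * 1"
            unfolding d_def by linarith
          have "norm (cx a / (2 * pi * (cx x - zP)\<^sup>2)) = norm a / (2 * pi * d\<^sup>2)"
            by (simp add: norm_divide norm_mult norm_power norm_cx d_def)
          also have "\<dots> \<le> norm a / d\<^sup>2"
          proof (rule divide_left_mono)
            show "d\<^sup>2 \<le> 2 * pi * d\<^sup>2" using pi_gt3 mult_right_mono[of 1 "2 * pi" "d\<^sup>2"] by simp
          qed (use d \<delta> in auto)
          finally show "norm (cx a / (2 * pi * (cx x - zP)\<^sup>2)) \<le> norm a / d\<^sup>2" .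
        qed
        also have "\<dots> = C1 / d\<^sup>2" by (simp add: C1_def add_divide_distrib)
        finally have n: "norm (k (cx x)) \<le> C1 / d\<^sup>2" .
        have "1 + norm x \<le> d * K1"
          using far_bound[OF \<delta>(1), of "cx x" zP] d by (simp add: d_def K1_def norm_cx)
        then have "(1 + norm x)\<^sup>2 \<le> (d * K1)\<^sup>2" by (rule power_mono) simp
        then have "1 + (norm x)\<^sup>2 \<le> d\<^sup>2 * K1\<^sup>2"
          using one_plus_square_le[of "norm x"] by (simp add: power_mult_distrib)
        then have "C1 / d\<^sup>2 * (1 + (norm x)\<^sup>2) \<le> C1 / d\<^sup>2 * (d\<^sup>2 * K1\<^sup>2)"
          using C1 by (intro mult_left_mono) auto
        also have "\<dots> = C1 * K1\<^sup>2" using d \<delta>(1) by simp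
        also have "\<dots> \<le> C" using B1n by (simp add: C_def K2_def)
        finally have "C1 / d\<^sup>2 * (1 + (norm x)\<^sup>2) \<le> C" .
        then have "C1 / d\<^sup>2 \<le> C / (1 + (norm x)\<^sup>2)" using p1 by (subst pos_le_divide_eq) auto
        with n show ?thesis by linarith
      qed
    qed
    show ?thesis
    proof (rule set_integrable_decay[OF open_exterior_dom])
      show "continuous_on (exterior_dom \<epsilon>) f"
        unfolding f_def
        by (intro continuous_intros continuous_on_compose2[OF kc]) (use X in auto)
      show "\<bar>f x\<bar> \<le> C\<^sup>2 * (1 / (1 + (norm x)\<^sup>2)\<^sup>2)" if "x \<in> exterior_dom \<epsilon>" for x
        using power_mono[OF bound[OF that] norm_ge_zero, of 2] by (simp add: f_def power_divide)
    qed
  qed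
  \<comment> \<open>At the emitter itself the gradient in \<open>g\<close> has no controlled value;
    the indicator term replaces \<open>f\<close> by \<open>g\<close> at this single point.\<close>
  have "integrable lborel (\<lambda>x. indicator {(0, p)} x * (g (0, p) - f (0, p)))"
    by (rule integrable_mult_left) (auto simp: integrable_real_indicator)
  with fi have "integrable lborel (\<lambda>x. indicator (exterior_dom \<epsilon>) x *\<^sub>R f x + indicator {(0, p)} x * (g (0, p) - f (0, p)))"
    unfolding set_integrable_def by (rule Bochner_Integration.integrable_add)
  moreover have "(\<lambda>x. indicator (exterior_dom \<epsilon>) x *\<^sub>R f x + indicator {(0, p)} x * (g (0, p) - f (0, p))) =
      (\<lambda>x. indicator (exterior_dom \<epsilon>) x *\<^sub>R g x)"
  proof
    fix x
    show "indicator (exterior_dom \<epsilon>) x *\<^sub>R f x + indicator {(0, p)} x * (g (0, p) - f (0, p)) = indicator (exterior_dom \<epsilon>) x *\<^sub>R g x"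
    proof (cases "x = (0, p)")
      case True
      then show ?thesis using P_ext by simp
    next
      case False
      then show ?thesis using gf[of x] by (cases "x \<in> exterior_dom \<epsilon>") auto
    qed
  qed
  ultimately show "set_integrable lborel (exterior_dom \<epsilon>) (\<lambda>x. (norm (grad (\<lambda>y. r y - a \<bullet> grad (fund_sol (0, p)) y) x))\<^sup>2)"
    unfolding set_integrable_def g_def by simp
qed

text \<open>The difference of \<open>u\<close> and Q + r solves the homogeneous problem, the two
  dipole sources cancelling, so \<open>exterior_solution_zero\<close> applies. The constants are
  read off at a boundary point of each disk.\<close>

lemma dipole_solution_unique:
  assumes u: "dipole_solution \<epsilon> (0, p) a c u"
  shows "x \<in> closed_ext \<epsilon> - {(0, p)} \<Longrightarrow> u x = Q x + r x" and "j \<in> {1, 2} \<Longrightarrow> c j = cst j"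
proof -
  define w where "w x = u x - (Q x + r x)" for x
  have u': "continuous_on (closed_ext \<epsilon> - {(0, p)}) u"
    "distr_laplace_eq (exterior_dom \<epsilon>) u (distr_deriv a (dirac (0, p)))"
    "\<And>j x. j \<in> {1, 2} \<Longrightarrow> x \<in> sphere (center \<epsilon> j) 1 \<Longrightarrow> u x = c j"
    "\<And>j. j \<in> {1, 2} \<Longrightarrow> zero_flux u (center \<epsilon> j)" "u \<in> O[at_infinity](\<lambda>x. 1 / norm x)"
    using u unfolding dipole_solution_def closure_exterior_dom[OF eps] frontier_D by blast+
  have "w x = 0" if "x \<in> closed_ext \<epsilon> - {(0, p)}" for x
  proof (rule exterior_solution_zero[OF eps P_ext _ _ _ _ _ that, of w "\<lambda>j. c j - cst j"])
    show "continuous_on (closed_ext \<epsilon> - {(0, p)}) w"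
      unfolding w_def using continuous_Q by (intro continuous_intros u'(1) continuous_r) (auto intro: continuous_on_subset)
    have "distr_laplace_eq (exterior_dom \<epsilon>) r (distr_deriv a (dirac (0, p)))"
      using is_r by (simp add: is_r_part_def)
    from distr_laplace_eq_add[OF harmonic_in_distr[OF open_exterior_dom harmonic_Q] this]
    have "distr_laplace_eq (exterior_dom \<epsilon>) (\<lambda>x. Q x + r x) (\<lambda>\<phi>. 0 + distr_deriv a (dirac (0, p)) \<phi>)" .
    from distr_laplace_eq_add[OF u'(2) distr_laplace_eq_cmult[OF this, of "- 1"]]
    have d: "distr_laplace_eq (exterior_dom \<epsilon>) (\<lambda>x. u x + - 1 * (Q x + r x))
      (\<lambda>\<phi>. distr_deriv a (dirac (0, p)) \<phi> + - 1 * (0 + distr_deriv a (dirac (0, p)) \<phi>))" .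
    have "(\<lambda>x. u x + - 1 * (Q x + r x)) = w" by (simp add: w_def fun_eq_iff)
    moreover have "(\<lambda>\<phi>. distr_deriv a (dirac (0, p)) \<phi> + - 1 * (0 + distr_deriv a (dirac (0, p)) \<phi>)) = (\<lambda>_. 0)"
      by simp
    ultimately show "distr_laplace_eq (exterior_dom \<epsilon>) w (\<lambda>_. 0)" using d by (simp only:)
    show "w x = c j - cst j" if "j \<in> {1, 2}" "x \<in> sphere (center \<epsilon> j) 1" for j x
      using u'(3)[OF that] Q_boundary[OF that] r_boundary[OF that] by (simp add: w_def)
    show "zero_flux w (center \<epsilon> j)" if "j \<in> {1, 2}" for j
      unfolding w_def by (rule zero_flux_diff[OF u'(4)[OF that] zero_flux_Qr[OF that]])
    have "filterlim (\<lambda>x::R2. norm x) at_infinity at_infinity"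
      using filterlim_at_top_imp_at_infinity[OF filterlim_norm_at_top] .
    then have "((\<lambda>x::R2. 1 / norm x) \<longlongrightarrow> 0) at_infinity" by (rule tendsto_divide_0[OF tendsto_const])
    then have n0: "((\<lambda>x::R2. norm (1 / norm x)) \<longlongrightarrow> 0) at_infinity" by (rule tendsto_norm_zero)
    obtain C where "\<forall>\<^sub>F x in at_infinity. norm (u x) \<le> C * norm (1 / norm x)"
      using landau_o.bigE[OF u'(5)] by blast
    then have "(u \<longlongrightarrow> 0) at_infinity"
      by (rule Lim_null_comparison) (rule tendsto_mult_right_zero[OF n0])
    from tendsto_diff[OF this Qr_tendsto] show "(w \<longlongrightarrow> 0) at_infinity" by (simp add: w_def[abs_def])
  qed
  then show main: "x \<in> closed_ext \<epsilon> - {(0, p)} \<Longrightarrow> u x = Q x + r x" for x by (simp add: w_def)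
  assume j: "j \<in> {1, 2}"
  define x where "x = center \<epsilon> j + (1, 0)"
  have s: "x \<in> sphere (center \<epsilon> j) 1" by (simp add: x_def dist_norm norm_Pair)
  have "x \<notin> exterior_dom \<epsilon>" using s j by (auto simp: exterior_dom_iff dist_norm norm_minus_commute)
  then have "x \<noteq> (0, p)" using P_ext by auto
  moreover have "x \<in> closed_ext \<epsilon>" using boundary_lm[of x] s j by auto
  ultimately have "u x = Q x + r x" using main by simp
  then show "c j = cst j" using u'(3)[OF j s] Q_boundary[OF j s] r_boundary[OF j s] by simp
qed

end

section \<open>Estimates for close disks\<close>

text \<open>The bound 1/5 gives al \<le> 1/2 and lam \<le> 2, which turns the geometric factors into
  numerical constants.\<close>

locale two_close_disks = two_disks +
  assumes small: "\<epsilon> < 1 / 5"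
begin

text \<open>The quantities al, s0 and sqrt \<epsilon> are comparable, by al^2 = \<epsilon> +
  \<epsilon>^2 / 4 and s0 = log lam \<ge> 1 - 1 / lam.\<close>

lemma small_constants:
  "\<epsilon> \<le> al\<^sup>2" "al\<^sup>2 \<le> 2 * \<epsilon>" "al\<^sup>2 \<le> 1 / 4" "sqrt \<epsilon> \<le> al" "al \<le> 2 * sqrt \<epsilon>" "al \<le> 1 / 2"
  "lam \<le> 2" "al \<le> 2 * s0" "\<epsilon>\<^sup>2 / 4 \<le> \<epsilon>"
proof -
  have e2: "\<epsilon>\<^sup>2 \<le> \<epsilon> * (1 / 5)" unfolding power2_eq_square using eps small by (intro mult_left_mono) auto
  show "\<epsilon>\<^sup>2 / 4 \<le> \<epsilon>" using e2 eps by simp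
  show 1: "\<epsilon> \<le> al\<^sup>2" unfolding al2_eps by simp
  show 2: "al\<^sup>2 \<le> 2 * \<epsilon>" unfolding al2_eps using e2 eps by simp
  show 3: "al\<^sup>2 \<le> 1 / 4" unfolding al2_eps using e2 small by simp
  show "sqrt \<epsilon> \<le> al" using 1 al_pos by (simp add: real_le_lsqrt)
  have "al\<^sup>2 \<le> (2 * sqrt \<epsilon>)\<^sup>2" using 2 eps by (simp add: power_mult_distrib)
  then show "al \<le> 2 * sqrt \<epsilon>" by (rule power2_le_imp_le) (use eps in simp)
  have "al\<^sup>2 \<le> (1 / 2)\<^sup>2" using 3 by (simp add: power_divide)
  then show 4: "al \<le> 1 / 2" by (rule power2_le_imp_le) simp
  show l: "lam \<le> 2" using 4 small by (simp add: lam_def cc_def)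
  have "ln (1 / lam) \<le> 1 / lam - 1" using lam_gt by (intro ln_le_minus_one) simp
  then have "s0 \<ge> 1 - 1 / lam" using lam_gt by (simp add: s0_def ln_div)
  moreover have "1 - 1 / lam \<ge> al / 2"
  proof -
    have "al / 2 \<le> al / lam" using l lam_gt al_pos by (intro divide_left_mono) auto
    also have "\<dots> \<le> (lam - 1) / lam"
      using lam_gt cc_gt by (intro divide_right_mono) (auto simp: lam_def)
    finally show ?thesis using lam_gt by (simp add: diff_divide_distrib)
  qed
  ultimately show "al \<le> 2 * s0" by simp
qed

text \<open>Everything follows from \<kappa> s0 = \<pi>/4 and s0 \<le> al \<le> 1/2.\<close>

lemma \<kappa>_bounds: "S.\<kappa> \<ge> 1" "S.\<kappa> * al \<ge> 3 / 4" "S.\<kappa> * s0 \<le> 1"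
proof -
  have "S.\<kappa> * s0 = pi / 4" using s0_pos by (simp add: S.\<kappa>_def)
  then show "S.\<kappa> * s0 \<le> 1" using pi_less_4 by simp
  have "S.\<kappa> * s0 \<le> S.\<kappa> * al" using S.\<kappa>_pos s0_le_al by (intro mult_left_mono) auto
  then show k: "S.\<kappa> * al \<ge> 3 / 4" using \<open>S.\<kappa> * s0 = pi / 4\<close> pi_gt3 by simp
  have "S.\<kappa> * al \<le> S.\<kappa> * (1 / 2)" using S.\<kappa>_pos small_constants(6) by (intro mult_left_mono) auto
  with k show "S.\<kappa> \<ge> 1" by simp
qed

lemma c0_le: "c0 \<le> 5"
proof -
  have "2 * pi * S.\<kappa> \<ge> 1" using pi_gt3 \<kappa>_bounds(1) mult_mono[of 1 "2 * pi" 1 S.\<kappa>] by simp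
  then have "exp (- 2 * pi * S.\<kappa>) \<le> exp (- 1)" by simp
  also have "exp (- 1) \<le> (1 / 2 :: real)"
    using exp_ge_add_one_self[of 1] by (simp add: exp_minus divide_simps)
  finally have e: "1 / 2 \<le> 1 - exp (- 2 * pi * S.\<kappa>)" by simp
  then have "2 / (1 - exp (- 2 * pi * S.\<kappa>)) \<le> 2 / (1 / 2)"
    using S.\<kappa>_pos by (intro divide_left_mono) auto
  then show ?thesis by (simp add: c0_def)
qed

definition den :: "R2 \<Rightarrow> real" where
  "den x = sqrt \<epsilon> * norm (cx x - zP) + norm (p *\<^sub>R x + (0, \<epsilon>))"

text \<open>Rests on \<open>(z + \<alpha>) (\<alpha> - i p) = \<alpha> (z - i p) + \<alpha>\<^sup>2 - i p z\<close> and \<open>\<alpha>\<^sup>2 = \<epsilon> + \<epsilon>\<^sup>2 / 4\<close>.\<close>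

lemma den_lower: "norm (cx x + ca) * norm (zP + ca) \<le> 4 * den x"
proof -
  define z where "z = cx x"
  define d where "d = norm (z - zP)"
  define N where "N = norm (p *\<^sub>R x + (0, \<epsilon>))"
  have N: "N = norm (of_real p * z + \<i> * of_real \<epsilon>)"
  proof -
    have "cx (p *\<^sub>R x + (0, \<epsilon>)) = of_real p * z + \<i> * of_real \<epsilon>" by (simp add: z_def complex_eq_iff)
    then show ?thesis by (simp add: N_def flip: norm_cx)
  qed
  have den: "den x = sqrt \<epsilon> * d + N" by (simp add: den_def d_def N_def z_def)
  have zPi: "zP = \<i> * of_real p" by (simp add: zP_def complex_eq_iff)
  have "(z + ca) * (ca - zP) = ca * (z - zP) + (of_real (al\<^sup>2) - \<i> * of_real p * z)"
    by (simp add: zPi power2_eq_square algebra_simps)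
  also have "of_real (al\<^sup>2) - \<i> * of_real p * z = - \<i> * ((of_real p * z + \<i> * of_real \<epsilon>) + \<i> * of_real (\<epsilon>\<^sup>2 / 4))"
    unfolding al2_eps by (simp add: algebra_simps)
  finally have eq: "(z + ca) * (ca - zP) = ca * (z - zP) + - \<i> * ((of_real p * z + \<i> * of_real \<epsilon>) + \<i> * of_real (\<epsilon>\<^sup>2 / 4))" .
  have "norm (z + ca) * norm (zP + ca) = norm ((z + ca) * (ca - zP))"
    using zP_simps(3) by (simp add: norm_mult norm_minus_commute)
  also have "\<dots> \<le> norm (ca * (z - zP)) + norm (- \<i> * ((of_real p * z + \<i> * of_real \<epsilon>) + \<i> * of_real (\<epsilon>\<^sup>2 / 4)))"
    unfolding eq by (rule norm_triangle_ineq)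
  also have "norm (- \<i> * ((of_real p * z + \<i> * of_real \<epsilon>) + \<i> * of_real (\<epsilon>\<^sup>2 / 4))) \<le> N + \<epsilon>\<^sup>2 / 4"
  proof -
    have "norm (- \<i> * w) = norm w" for w :: complex by (simp add: norm_mult)
    moreover have "norm (\<i> * of_real (\<epsilon>\<^sup>2 / 4)) = \<epsilon>\<^sup>2 / 4" by (simp only: norm_mult norm_ii norm_of_real) simp
    ultimately show ?thesis
      using norm_triangle_ineq[of "of_real p * z + \<i> * of_real \<epsilon>" "\<i> * of_real (\<epsilon>\<^sup>2 / 4)"] unfolding N by metis
  qed
  also have "norm (ca * (z - zP)) = al * d" using al_pos by (simp add: norm_mult d_def)
  finally have 1: "norm (z + ca) * norm (zP + ca) \<le> al * d + (N + \<epsilon>\<^sup>2 / 4)" by simp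
  have 2: "al * d \<le> 2 * sqrt \<epsilon> * d" using small_constants(5) by (intro mult_right_mono) (simp_all add: d_def)
  \<comment> \<open>Absorbs the remainder \<epsilon>^2 / 4, which is at most \<epsilon>. Either p y
    \<ge> - \<epsilon> / 2, and the imaginary part alone makes \<open>N\<close> at least \<epsilon>
    / 2, or p and y have opposite signs and (y - p)^2 \<ge> - 4 p y exceeds \<epsilon>, so that d
    \<ge> sqrt \<epsilon>.\<close>
  have 3: "\<epsilon> \<le> 2 * (sqrt \<epsilon> * d + N)"
  proof -
    define y where "y = Im z"
    have "\<bar>Im (of_real p * z + \<i> * of_real \<epsilon>)\<bar> \<le> N" unfolding N by (rule abs_Im_le_cmod)
    then have Ny: "\<bar>p * y + \<epsilon>\<bar> \<le> N" by (simp add: y_def)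
    have "\<bar>Im (z - zP)\<bar> \<le> d" unfolding d_def by (rule abs_Im_le_cmod)
    then have dy: "\<bar>y - p\<bar> \<le> d" by (simp add: y_def zPi)
    have d0: "d \<ge> 0" "sqrt \<epsilon> * d \<ge> 0" "N \<ge> 0" using eps by (simp_all add: d_def N_def)
    show ?thesis
    proof (cases "p * y + \<epsilon> \<ge> \<epsilon> / 2")
      case True
      then have "\<epsilon> \<le> 2 * N" using Ny by linarith
      then show ?thesis using d0 by (simp add: distrib_left)
    next
      case False
      have "(y - p)\<^sup>2 = (y + p)\<^sup>2 - 4 * (p * y)" by (simp add: power2_eq_square algebra_simps)
      then have "\<epsilon> \<le> (y - p)\<^sup>2" using False eps zero_le_power2[of "y + p"] by linarith
      also have "\<dots> \<le> d\<^sup>2" using dy d0 by (simp add: abs_le_square_iff[symmetric])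
      finally have "sqrt \<epsilon> \<le> d" using d0 by (intro real_le_lsqrt) auto
      then have "sqrt \<epsilon> * sqrt \<epsilon> \<le> sqrt \<epsilon> * d" using eps by (intro mult_left_mono) auto
      then show ?thesis using eps d0 by simp
    qed
  qed
  define S where "S = sqrt \<epsilon> * d"
  have "al * d \<le> 2 * S" "\<epsilon> \<le> 2 * S + 2 * N" using 2 3 by (simp_all add: S_def mult.assoc)
  moreover have "0 \<le> N" by (simp add: N_def)
  ultimately have "norm (z + ca) * norm (zP + ca) \<le> 4 * S + 4 * N" using 1 small_constants(9) by linarith
  then show ?thesis unfolding den S_def z_def by simp
qed

text \<open>As \<kappa> |Re t| \<le> 1, replacing |Im t| by |t| in the exponential costs a factor e
  \<le> 3. The exponent then comes from the lower bound for |t|: 3/16 is 3/4, from \<kappa> al \<ge>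
  3/4, divided by the 4 of \<open>den_lower\<close>, while lam \<le> 2 cancels the 2 of
  \<open>Ln_M_bounds\<close>. The constant 7680 is 64 * 5 * 8 * 3.\<close>

lemma r_bound:
  assumes x: "x \<in> exterior_dom \<epsilon>" "x \<noteq> (0, p)"
  shows "norm (grad r x) \<le> 7680 * norm a * (1 / (norm (x - (0, p)))\<^sup>2 *
    exp (- (3 / 16) * (norm (x - (0, p)) / (sqrt \<epsilon> * norm (x - (0, p)) + norm (p *\<^sub>R x + (0, \<epsilon>))))))"
proof -
  have xE: "x \<in> closed_ext \<epsilon>" using x exterior_subset_closed_ext by blast
  define z where "z = cx x"
  define t where "t = Ln (M z)"
  have z: "z \<in> T - {zP}" using cx_closed_ext_T[OF xE] x(2) cx_P by (auto simp: z_def)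
  note tb = Ln_M_bounds[OF xE x(2), folded z_def, folded t_def]
  define d where "d = norm (z - zP)"
  have dx: "norm (x - (0, p)) = d"
  proof -
    have "z - zP = cx (x - (0, p))" by (simp add: z_def zP_def complex_eq_iff)
    then show ?thesis by (simp add: d_def norm_cx)
  qed
  have d: "d > 0" using z by (simp add: d_def)
  define W where "W = norm (z + ca) * norm (zP + ca)"
  have W: "W > 0" using T_nonzero[of z] z zP_simps by (simp add: W_def)
  have WE: "W \<le> 4 * den x" using den_lower[of x] by (simp add: W_def z_def)
  then have E: "den x > 0" using W by simp
  have "2 * al * d \<le> lam * norm t * W" using tb(4) by (simp add: d_def W_def)
  also have "\<dots> \<le> 2 * norm t * (4 * den x)"
    using small_constants(7) WE W lam_gt E by (intro mult_mono) auto
  finally have "al * d \<le> 4 * norm t * den x" by (simp add: mult_ac)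
  then have "S.\<kappa> * (al * d) \<le> S.\<kappa> * (4 * norm t * den x)"
    using S.\<kappa>_pos by (intro mult_left_mono) auto
  moreover have "3 / 4 * d \<le> S.\<kappa> * al * d" using \<kappa>_bounds(2) d by (intro mult_right_mono) auto
  ultimately have "3 / 4 * d \<le> S.\<kappa> * norm t * 4 * den x" by (simp add: mult_ac)
  then have "3 / 16 * (d / den x) \<le> S.\<kappa> * norm t" using E by (simp add: divide_le_eq mult_ac)
  also have "\<dots> \<le> S.\<kappa> * (\<bar>Re t\<bar> + \<bar>Im t\<bar>)"
    using S.\<kappa>_pos cmod_le[of t] by (intro mult_left_mono) auto
  also have "\<dots> \<le> S.\<kappa> * (s0 + \<bar>Im t\<bar>)" using S.\<kappa>_pos tb(1) by (intro mult_left_mono) auto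
  also have "\<dots> \<le> 1 + S.\<kappa> * \<bar>Im t\<bar>" using \<kappa>_bounds(3) by (simp add: distrib_left)
  finally have "- S.\<kappa> * \<bar>Im t\<bar> \<le> 1 + - (3 / 16) * (d / den x)" by simp
  then have "exp (- S.\<kappa> * \<bar>Im t\<bar>) \<le> exp (1 + - (3 / 16) * (d / den x))" by (simp only: exp_le_cancel_iff)
  also have "\<dots> = exp 1 * exp (- (3 / 16) * (d / den x))" by (rule exp_add)
  also have "\<dots> \<le> 3 * exp (- (3 / 16) * (d / den x))" using exp_le by (intro mult_right_mono) auto
  finally have ex: "exp (- S.\<kappa> * \<bar>Im t\<bar>) \<le> 3 * exp (- (3 / 16) * (d / den x))" .
  have "norm (grad r x) = norm (S.G' t * zeta z)"
    unfolding grad_eq[OF GDERIV_r[OF z[unfolded z_def]]] norm_conj_pair by (simp add: t_def z_def)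
  also have "\<dots> \<le> 64 * norm a * c0 * lam ^ 3 / d\<^sup>2 * exp (- S.\<kappa> * \<bar>Im t\<bar>)"
    using r_gradient_estimate[OF xE x(2)] by (simp add: t_def z_def d_def)
  also have "\<dots> \<le> 64 * norm a * 5 * 2 ^ 3 / d\<^sup>2 * (3 * exp (- (3 / 16) * (d / den x)))"
    using c0_le c0_pos small_constants(7) lam_gt ex d
    by (intro mult_mono divide_right_mono power_mono) auto
  finally show ?thesis unfolding dx by (simp add: den_def d_def z_def mult_ac)
qed

text \<open>Here |zeta| = 2 al / |z^2 - al^2|. Outside both disks 2 cc |x1| < x1^2 + Y with Y = x2^2
  + al^2; in the ball of radius 1/2 this forces |x1| \<le> 2 Y / 3, the narrowness of the gap. Hence
  x1^2 \<le> Y / 2, and |z^2 - al^2| is comparable to Y and so to \<epsilon> + x2^2.\<close>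

lemma zeta_bounds:
  assumes x: "x \<in> exterior_dom \<epsilon>" "norm x < 1 / 2"
  defines "q \<equiv> \<epsilon> + (snd x)\<^sup>2"
  shows "2 * al / (4 * q) \<le> norm (zeta (cx x))" "norm (zeta (cx x)) \<le> 2 * al / (q / 2)"
proof -
  have xE: "x \<in> closed_ext \<epsilon>" using x exterior_subset_closed_ext by blast
  define z where "z = cx x"
  define x1 x2 where "x1 = fst x" and "x2 = snd x"
  define Y where "Y = x2\<^sup>2 + al\<^sup>2"
  have zT: "z \<in> T" using cx_closed_ext_T[OF xE] by (simp add: z_def)
  define W where "W = norm ((z - ca) * (z + ca))"
  have W: "W > 0" using T_nonzero[OF zT] by (simp add: W_def)
  have nz: "norm (zeta z) = 2 * al / W"
    using zeta_eq[OF T_nonzero[OF zT]] al_pos by (simp add: norm_divide W_def norm_mult)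
  have "norm (x - center \<epsilon> 1) > 1" "norm (x - center \<epsilon> 2) > 1" using x(1) by (simp_all add: exterior_dom_iff)
  then have "(norm (x - center \<epsilon> 1))\<^sup>2 > 1" "(norm (x - center \<epsilon> 2))\<^sup>2 > 1" by (simp_all add: one_less_power)
  moreover have "(norm (x - center \<epsilon> 1))\<^sup>2 = (x1 + cc)\<^sup>2 + x2\<^sup>2" "(norm (x - center \<epsilon> 2))\<^sup>2 = (x1 - cc)\<^sup>2 + x2\<^sup>2"
    unfolding norm_R2_squared by (simp_all add: center_def cc_def x1_def x2_def power2_eq_square algebra_simps)
  ultimately have "(x1 + cc)\<^sup>2 + x2\<^sup>2 > 1" "(x1 - cc)\<^sup>2 + x2\<^sup>2 > 1" by simp_all
  then have "2 * cc * \<bar>x1\<bar> < x1\<^sup>2 + Y"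
    unfolding Y_def al2 by (simp add: abs_if power2_eq_square algebra_simps)
  moreover have "2 * \<bar>x1\<bar> \<le> 2 * cc * \<bar>x1\<bar>" using cc_gt by (intro mult_right_mono) auto
  ultimately have a: "2 * \<bar>x1\<bar> < x1\<^sup>2 + Y" by linarith
  have n2: "x1\<^sup>2 + x2\<^sup>2 < 1 / 4"
  proof -
    have "(norm x)\<^sup>2 < (1 / 2)\<^sup>2" by (rule power_strict_mono[OF x(2)]) auto
    then show ?thesis by (simp add: norm_R2_squared x1_def x2_def power_divide)
  qed
  have x1h: "\<bar>x1\<bar> \<le> 1 / 2"
  proof -
    have "x1\<^sup>2 \<le> x1\<^sup>2 + x2\<^sup>2" by simp
    also have "\<dots> \<le> (1 / 2)\<^sup>2" using n2 by (simp add: power_divide)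
    finally have "x1\<^sup>2 \<le> (1 / 2)\<^sup>2" .
    then show ?thesis by (simp add: abs_le_square_iff[symmetric])
  qed
  have "x1\<^sup>2 = \<bar>x1\<bar> * \<bar>x1\<bar>" by (simp add: power2_eq_square)
  also have "\<dots> \<le> 1 / 2 * \<bar>x1\<bar>" using x1h by (intro mult_right_mono) auto
  finally have s: "x1\<^sup>2 \<le> 1 / 2 * \<bar>x1\<bar>" .
  then have b: "\<bar>x1\<bar> \<le> 2 / 3 * Y" using a by linarith
  have "x2\<^sup>2 \<le> x1\<^sup>2 + x2\<^sup>2" by simp
  also have "\<dots> \<le> 1 / 4" using n2 by simp
  finally have Y: "0 < Y" "Y \<le> 1 / 2"
    using small_constants(3) al_pos by (auto simp: Y_def intro: add_nonneg_pos)
  have "x1\<^sup>2 \<le> 1 / 3 * Y" using s b by linarith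
  then have sq: "x1\<^sup>2 \<le> Y / 2" using Y by linarith
  have Weq: "W = norm (z\<^sup>2 - of_real (al\<^sup>2))" by (simp add: W_def power2_eq_square algebra_simps)
  have "\<bar>Re (z\<^sup>2 - of_real (al\<^sup>2))\<bar> \<le> W" unfolding Weq by (rule abs_Re_le_cmod)
  moreover have "Re (z\<^sup>2 - of_real (al\<^sup>2)) = x1\<^sup>2 - Y"
    by (simp add: z_def x1_def x2_def Y_def power2_eq_square)
  ultimately have lo: "Y / 2 \<le> W" using sq by linarith
  have "W \<le> norm (z\<^sup>2) + norm (complex_of_real (al\<^sup>2))" unfolding Weq by (rule norm_triangle_ineq4)
  also have "\<dots> = x1\<^sup>2 + Y"
    by (simp add: norm_power cmod_power2 z_def x1_def x2_def Y_def)
  finally have hi: "W \<le> 2 * Y" using sq Y by linarith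
  have qY: "q \<le> Y" "Y \<le> 2 * q"
    using small_constants(1) add_mono[OF zero_le_power2[of x2] small_constants(2)]
    by (simp_all add: q_def Y_def x2_def)
  have q: "q > 0" using eps by (simp add: q_def add_pos_nonneg)
  show "2 * al / (4 * q) \<le> norm (zeta (cx x))"
    unfolding z_def[symmetric] nz using hi qY W al_pos by (intro divide_left_mono) auto
  show "norm (zeta (cx x)) \<le> 2 * al / (q / 2)"
    unfolding z_def[symmetric] nz using lo qY q W al_pos by (intro divide_left_mono) auto
qed

text \<open>Explicitly |Aq| = |a1| (al / s0) / (2\<pi>(p^2 + al^2)), where al / s0 lies between 1
  and 2.\<close>

lemma Aq_bounds:
  defines "q \<equiv> \<epsilon> + p\<^sup>2"
  shows "\<bar>fst a\<bar> / (16 * q) \<le> \<bar>S.Aq\<bar>" "\<bar>S.Aq\<bar> \<le> \<bar>fst a\<bar> / q"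
proof -
  define Y where "Y = p\<^sup>2 + al\<^sup>2"
  have q: "q > 0" using eps by (simp add: q_def add_pos_nonneg)
  have qY: "q \<le> Y" "Y \<le> 2 * q" using small_constants(1) add_mono[OF zero_le_power2[of p] small_constants(2)]
    by (simp_all add: q_def Y_def)
  have "Re b = fst a * dP / (2 * pi)" by (simp add: b_def)
  then have A: "\<bar>S.Aq\<bar> = \<bar>fst a\<bar> * (al / s0) / (2 * pi * Y)"
    using s0_pos al_pos q qY pi_gt_zero by (simp add: S.Aq_def S.\<kappa>_def dP_def Y_def abs_mult abs_divide)
  have r: "1 \<le> al / s0" "al / s0 \<le> 2"
    using s0_pos s0_le_al small_constants(8) by (simp_all add: divide_le_eq le_divide_eq)
  have "\<bar>fst a\<bar> / (16 * q) \<le> \<bar>fst a\<bar> * 1 / (2 * pi * Y)"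
  proof -
    have "2 * pi * Y \<le> 8 * (2 * q)" using pi_less_4 qY q by (intro mult_mono) auto
    then show ?thesis using q qY pi_gt_zero by (simp add: divide_left_mono)
  qed
  also have "\<dots> \<le> \<bar>S.Aq\<bar>" unfolding A using r q qY pi_gt_zero by (intro divide_right_mono mult_left_mono) auto
  finally show "\<bar>fst a\<bar> / (16 * q) \<le> \<bar>S.Aq\<bar>" .
  have "\<bar>S.Aq\<bar> \<le> \<bar>fst a\<bar> * 2 / (2 * pi * Y)" unfolding A using r q qY pi_gt_zero by (intro divide_right_mono mult_left_mono) auto
  also have "\<dots> = \<bar>fst a\<bar> / (pi * Y)" by simp
  also have "\<dots> \<le> \<bar>fst a\<bar> / q"
  proof -
    have "1 * q \<le> pi * Y" using pi_gt3 qY q by (intro mult_mono) auto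
    then show ?thesis using q by (intro divide_left_mono) auto
  qed
  finally show "\<bar>S.Aq\<bar> \<le> \<bar>fst a\<bar> / q" .
qed

text \<open>The gradient has modulus |Aq| |zeta|. For given \<epsilon>, the first factor depends on
  the dipole only and the second on x only, whence the product form of the estimate.\<close>

lemma Q_bounds:
  assumes x: "x \<in> exterior_dom \<epsilon>" "norm x < 1 / 2"
  defines "v \<equiv> \<bar>fst a\<bar> * (sqrt \<epsilon> / ((\<epsilon> + p\<^sup>2) * (\<epsilon> + (snd x)\<^sup>2)))"
  shows "norm (grad Q x) \<le> 8 * v" "v \<le> 32 * norm (grad Q x)"
proof -
  have xE: "x \<in> closed_ext \<epsilon>" using x exterior_subset_closed_ext by blast
  define q1 q2 where "q1 = \<epsilon> + p\<^sup>2" and "q2 = \<epsilon> + (snd x)\<^sup>2"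
  have q: "q1 > 0" "q2 > 0" using eps by (simp_all add: q1_def q2_def add_pos_nonneg)
  have g: "norm (grad Q x) = \<bar>S.Aq\<bar> * norm (zeta (cx x))"
    unfolding grad_eq[OF GDERIV_Q[OF cx_closed_ext_T[OF xE]]] norm_conj_pair by (simp add: norm_mult)
  have v: "v = \<bar>fst a\<bar> / q1 * (sqrt \<epsilon> / q2)" by (simp add: v_def q1_def q2_def)
  have "norm (grad Q x) \<le> \<bar>fst a\<bar> / q1 * (2 * al / (q2 / 2))"
    unfolding g using Aq_bounds(2) zeta_bounds(2)[OF x] q by (intro mult_mono) (auto simp: q1_def q2_def)
  also have "\<dots> \<le> \<bar>fst a\<bar> / q1 * (2 * (2 * sqrt \<epsilon>) / (q2 / 2))"
    using small_constants(5) q by (intro mult_left_mono divide_right_mono) auto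
  finally show "norm (grad Q x) \<le> 8 * v" by (simp add: v mult_ac)
  have "\<bar>fst a\<bar> / (16 * q1) * (2 * sqrt \<epsilon> / (4 * q2)) \<le> \<bar>fst a\<bar> / (16 * q1) * (2 * al / (4 * q2))"
    using small_constants(4) q by (intro mult_left_mono divide_right_mono) auto
  also have "\<dots> \<le> norm (grad Q x)"
    unfolding g using Aq_bounds(1) zeta_bounds(1)[OF x] q al_pos by (intro mult_mono) (auto simp: q1_def q2_def)
  finally show "v \<le> 32 * norm (grad Q x)" by (simp add: v)
qed

end

theorem proposition1p3:
  shows "\<exists>A>0. \<exists>C>0. \<exists>\<epsilon>0>0. \<forall>(\<epsilon>::real) (p::real) (a::real \<times> real) (c::nat \<Rightarrow> real) u.
    \<epsilon> > 0 \<longrightarrow> norm a = 1 \<longrightarrow> dipole_solution \<epsilon> (0, p) a c u \<longrightarrow>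
    (\<exists>Q r.
       (\<forall>x\<in>exterior_dom \<epsilon> - {(0, p)}. u x = Q x + r x) \<and>
       is_Q_part \<epsilon> c Q \<and>
       is_r_part \<epsilon> (0, p) a r \<and>
       (\<epsilon> < \<epsilon>0 \<longrightarrow> norm ((0, p) :: real \<times> real) < 1/2 \<longrightarrow>
         (\<forall>x\<in>ball (0, 0) (1/2) \<inter> exterior_dom \<epsilon>.
            norm (grad Q x)
              \<le> C * (\<bar>fst a\<bar> * (sqrt \<epsilon> / ((\<epsilon> + p\<^sup>2) * (\<epsilon> + (snd x)\<^sup>2)))) \<and>
            \<bar>fst a\<bar> * (sqrt \<epsilon> / ((\<epsilon> + p\<^sup>2) * (\<epsilon> + (snd x)\<^sup>2)))
              \<le> C * norm (grad Q x) \<and>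
            (x \<noteq> (0, p) \<longrightarrow>
              norm (grad r x)
                \<le> C * (1 / (norm (x - (0, p)))\<^sup>2 *
                     exp (- A * (norm (x - (0, p)) /
                       (sqrt \<epsilon> * norm (x - (0, p)) + norm (p *\<^sub>R x + (0, \<epsilon>))))))))))"
proof -
  have main: "\<exists>Q r.
       (\<forall>x\<in>exterior_dom \<epsilon> - {(0, p)}. u x = Q x + r x) \<and>
       is_Q_part \<epsilon> c Q \<and>
       is_r_part \<epsilon> (0, p) a r \<and>
       (\<epsilon> < 1 / 5 \<longrightarrow> norm ((0, p) :: real \<times> real) < 1/2 \<longrightarrow>
         (\<forall>x\<in>ball (0, 0) (1/2) \<inter> exterior_dom \<epsilon>.
            norm (grad Q x)
              \<le> 7680 * (\<bar>fst a\<bar> * (sqrt \<epsilon> / ((\<epsilon> + p\<^sup>2) * (\<epsilon> + (snd x)\<^sup>2)))) \<and>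
            \<bar>fst a\<bar> * (sqrt \<epsilon> / ((\<epsilon> + p\<^sup>2) * (\<epsilon> + (snd x)\<^sup>2)))
              \<le> 7680 * norm (grad Q x) \<and>
            (x \<noteq> (0, p) \<longrightarrow>
              norm (grad r x)
                \<le> 7680 * (1 / (norm (x - (0, p)))\<^sup>2 *
                     exp (- (3 / 16) * (norm (x - (0, p)) /
                       (sqrt \<epsilon> * norm (x - (0, p)) + norm (p *\<^sub>R x + (0, \<epsilon>)))))))))"
    if eps: "\<epsilon> > 0" and a: "norm a = 1" and u: "dipole_solution \<epsilon> (0, p) a c u"
    for \<epsilon> p :: real and a :: "real \<times> real" and c :: "nat \<Rightarrow> real" and u
  proof -
    interpret two_disks \<epsilon> p a by unfold_locales (rule eps)
    have "is_Q_part \<epsilon> c Q"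
      using is_Q dipole_solution_unique(2)[OF u] by (simp add: is_Q_part_def)
    moreover have "\<forall>x\<in>exterior_dom \<epsilon> - {(0, p)}. u x = Q x + r x"
      using dipole_solution_unique(1)[OF u] exterior_subset_closed_ext by blast
    moreover have "norm (grad Q x)
              \<le> 7680 * (\<bar>fst a\<bar> * (sqrt \<epsilon> / ((\<epsilon> + p\<^sup>2) * (\<epsilon> + (snd x)\<^sup>2)))) \<and>
            \<bar>fst a\<bar> * (sqrt \<epsilon> / ((\<epsilon> + p\<^sup>2) * (\<epsilon> + (snd x)\<^sup>2)))
              \<le> 7680 * norm (grad Q x) \<and>
            (x \<noteq> (0, p) \<longrightarrow>
              norm (grad r x)
                \<le> 7680 * (1 / (norm (x - (0, p)))\<^sup>2 *
                     exp (- (3 / 16) * (norm (x - (0, p)) /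
                       (sqrt \<epsilon> * norm (x - (0, p)) + norm (p *\<^sub>R x + (0, \<epsilon>)))))))"
      if small: "\<epsilon> < 1 / 5" and x: "x \<in> ball (0, 0) (1/2) \<inter> exterior_dom \<epsilon>" for x
    proof -
      interpret two_close_disks \<epsilon> p a by unfold_locales (rule small)
      have x': "x \<in> exterior_dom \<epsilon>" "norm x < 1 / 2"
        using x by (auto simp: zero_prod_def[symmetric])
      \<comment> \<open>Nonnegativity allows the constants 8 and 32 for Q to be raised to the 7680
        of the bound for r.\<close>
      have "0 \<le> \<bar>fst a\<bar> * (sqrt \<epsilon> / ((\<epsilon> + p\<^sup>2) * (\<epsilon> + (snd x)\<^sup>2)))" using eps by simp
      then show ?thesis
        using Q_bounds[OF x'] r_bound[OF x'(1)] a norm_ge_zero[of "grad Q x"] by auto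
    qed
    ultimately show ?thesis using is_r by blast
  qed
  show ?thesis
    by (rule exI[of _ "3 / 16"], rule conjI, simp, rule exI[of _ 7680], rule conjI, simp,
        rule exI[of _ "1 / 5"], rule conjI, simp) (intro allI impI main)
qed

end
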